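(* Suppose Assumptions A1, A2, A3 (stated in the context) hold and let $\{(X^{(t)},\Lambda^{(t)},Y^{(t)})\}_{t\ge0}$ be generated by the VRLM algorithm with the SPIDER option, with $q=\mathcal S_2$, $\eta_y=\frac1{4L}$, and $$\eta_x=\min\Big\{\frac{(1-\rho)^2}{180L_P},\ \frac{1}{20(L+1)(12\kappa^2+2\kappa+5)}\Big\},$$ $$\eta_\Lambda=\min\Big\{\frac{5L_P(1-\rho)^2}{24L^2(12\kappa^2+\kappa+1)},\ \frac{1}{2L_P+128L\kappa^2+\frac{(L+1)(20\kappa^2+\kappa+1)}{2}+\frac{4L^2(12\kappa^2+\kappa+1)}{30L_P}}\Big\},$$ where $L_P=L\sqrt{4\kappa^2+1}$. If the finite-sum setting $f_i=\frac1n\sum_{j=1}^n\tilde f_i(\cdot,\cdot;\xi_{ij})$ holds and $\mathcal S_0=\mathcal S_1=n$ (all local samples used), then for any $\varepsilon>0$, $$\lim_{t\to\infty}\mathrm{Prob}\Big\{\Big\|\tfrac1{\eta_x}\big(\bar x^{(t)}-\mathrm{prox}_{\eta_xg}(\bar x^{(t)}-\eta_x\nabla_xP(\bar x^{(t)},\Lambda^{(t)}))\big)\Big\|_2^2+\tfrac{L^2}{m}\|X_\perp^{(t)}\|_F^2\ge\varepsilon\Big\}=0,$$ $$\lim_{t\to\infty}\mathrm{Prob}\Big\{\|\nabla_\Lambda P(\bar x^{(t)},\Lambda^{(t)})\|_F^2\ge\varepsilon\Big\}=0.$$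
   Context: **Setting and notation.** $m,n,d_1,d_2\ge1$ are integers, $[m]=\{1,\dots,m\}$. For $i\in[m]$, $f_i(x,y)=\mathbb E_{\xi\sim\mathcal D_i}[\tilde f_i(x,y;\xi)]$ on $\mathbb R^{d_1}\times\mathbb R^{d_2}$, where in the finite-sum setting $\mathcal D_i$ is uniform on $\{\xi_{i1},\dots,\xi_{in}\}$. $g:\mathbb R^{d_1}\to\mathbb R\cup\{+\infty\}$ and $h:\mathbb R^{d_2}\to\mathbb R\cup\{+\infty\}$ are closed convex functions. $W=(w_{ij})\in\mathbb R^{m\times m}$ is the mixing matrix, $I$ the identity, $\mathbf 1\in\mathbb R^m$ the all-ones vector. $X=[x_1,\dots,x_m]^\top\in\mathbb R^{m\times d_1}$, $Y=[y_1,\dots,y_m]^\top\in\mathbb R^{m\times d_2}$, $\Lambda=[\lambda_1,\dots,\lambda_m]^\top\in\mathbb R^{m\times d_2}$; $\bar x=\frac1m\sum_ix_i$, $X_\perp=X-\mathbf 1\bar x^\top$. $\mathrm{prox}_r(u)=\arg\min_v\{r(v)+\frac12\|v-u\|^2\}$, acting row-wise on matrices. $$\Phi(X,\Lambda,Y)=\frac1m\sum_{i=1}^m\big(f_i(x_i,y_i)-h(y_i)\big)-\frac{L}{2\sqrt m}\langle\Lambda,(W-I)Y\rangle,$$ $P(x,\Lambda)=\max_Y\Phi(\mathbf 1x^\top,\Lambda,Y)$, $\phi(x,\Lambda)=P(x,\Lambda)+g(x)$. **Assumptions.** A1: for each $i$, $f_i(x,\cdot)$ is $\mu$-strongly concave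 with $\mu>0$; there is $\phi^*\in\mathbb R$ with $\phi(x,\Lambda)\ge\phi^*$ for all $x,\Lambda$; $\mathrm{dom}(h)$ has nonempty relative interior. A2: $\mathrm{Null}(W-I)=\mathrm{Span}\{\mathbf 1\}$, $W^\top\mathbf 1=\mathbf 1$, $\rho:=\|W-\frac1m\mathbf 1\mathbf 1^\top\|_2<1$, $\|W-I\|_2\le2$. A3: each $f_i$ is $L$-smooth (gradient $L$-Lipschitz), and the stochastic gradient $\tilde\nabla f_i(x,y;\xi)$, $\xi\sim\mathcal D_i$, satisfies (i) $\mathbb E_\xi[\tilde\nabla f_i(x,y;\xi)]=\nabla f_i(x,y)$; (ii) $\mathbb E_\xi\|\tilde\nabla f_i(x,y;\xi)-\nabla f_i(x,y)\|_2^2\le\sigma^2$ for some $\sigma^2\ge0$; (iii) $\mathbb E_\xi\|\tilde\nabla f_i(x,y;\xi)-\tilde\nabla f_i(x',y';\xi)\|_2^2\le L^2(\|x-x'\|_2^2+\|y-y'\|_2^2)$ for all $(x,y),(x',y')$. The condition number is $\kappa=L/\mu$. **VRLM algorithm with SPIDER option.** For a finite sample set $\mathcal B$, $G_i^{(t)}(\mathcal B)=\frac1{|\mathcal B|}\sum_{\xi\in\mathcal B}\tilde\nabla f_i(x_i^{(t)},y_i^{(t)};\xi)$. Start from deterministic $x_i^{(0)}=x^{(0)}\in\mathrm{dom}(g)$, $y_i^{(0)}=y^{(0)}\in\mathrm{dom}(h)$ for all $i$, $\Lambda^{(0)}=0$; $d_i^{(0)}=[d_{x,i}^{(0)};d_{y,i}^{(0)}]=G_i^{(0)}(\mathcal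 B_i^{(0)})$ with $|\mathcal B_i^{(0)}|=\mathcal S_0$; $V_x^{(0)}=D_x^{(0)}$. Here $D_x^{(t)},D_y^{(t)}$ have rows $d_{x,i}^{(t)},d_{y,i}^{(t)}$. For $t\ge1$: - if $t\equiv0\ (\mathrm{mod}\ q)$: $d_i^{(t)}=G_i^{(t)}(\tilde{\mathcal B}_i^{(t)})$ with $|\tilde{\mathcal B}_i^{(t)}|=\mathcal S_1$; otherwise $d_i^{(t)}=G_i^{(t)}(\mathcal B_i^{(t)})-G_i^{(t-1)}(\mathcal B_i^{(t)})+d_i^{(t-1)}$ with $|\mathcal B_i^{(t)}|=\mathcal S_2$, the samples in $\mathcal B_i^{(t)}$ being drawn i.i.d. from $\mathcal D_i$ independently of the past; - $V_x^{(t)}=W(V_x^{(t-1)}+D_x^{(t)}-D_x^{(t-1)})$. With $\mathcal S_0=\mathcal S_1=n$ the batches $\mathcal B_i^{(0)}$ and $\tilde{\mathcal B}_i^{(t)}$ consist of all $n$ local samples, so $d_i^{(t)}=\nabla f_i(x_i^{(t)},y_i^{(t)})$ whenever $t\equiv 0\ (\mathrm{mod}\ q)$. For $t\ge0$: $V_y^{(t)}=D_y^{(t)}-\frac{L\sqrt m}{2}(W-I)^\top\Lambda^{(t)}$, $\Lambda^{(t+1)}=\Lambda^{(t)}+\frac{L\eta_\Lambda}{2\sqrt m}(W-I)Y^{(t)}$, $X^{(t+1)}=\mathrm{prox}_{\eta_xg}(WX^{(t)}-\eta_xV_x^{(t)})$, $Y^{(t+1)}=\mathrm{prox}_{\eta_yh}(Y^{(t)}+\eta_yV_y^{(t)})$.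 *)

theory Defs
  imports "HOL-Probability.Probability"
begin

text \<open>
  Agents are indexed by the finite type \<open>'m\<close>, the local samples of each agent by the finite type
  \<open>'n\<close>, and \<open>'d1\<close>, \<open>'d2\<close> are the dimensions of the primal and dual variables.  The rows of
  \<open>X :: real^'d1^'m\<close> are the local copies \<open>x\<^sub>i\<close>; the norm and inner product on this type are the
  Frobenius ones.  A pair \<open>(x, y) :: (real^'d1) \<times> (real^'d2)\<close> carries the Euclidean norm.
\<close>

definition grad :: "('a::real_inner \<Rightarrow> real) \<Rightarrow> 'a \<Rightarrow> 'a" where
  "grad F z = (THE D. GDERIV F z :> D)"

definition smooth_fun :: "real \<Rightarrow> ('a::real_inner \<Rightarrow> real) \<Rightarrow> bool" where
  "smooth_fun L F \<longleftrightarrow> (\<forall>z. \<exists>D. GDERIV F z :> D) \<and> L-lipschitz_on UNIV (grad F)"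

definition strongly_concave :: "real \<Rightarrow> ('a::real_inner \<Rightarrow> real) \<Rightarrow> bool" where
  "strongly_concave \<mu> F \<longleftrightarrow>
     (\<forall>y y'. \<forall>t\<in>{0..1}. F (t *\<^sub>R y + (1 - t) *\<^sub>R y')
        \<ge> t * F y + (1 - t) * F y' + \<mu> / 2 * t * (1 - t) * (norm (y - y'))\<^sup>2)"

subsection \<open>Extended-valued convex functions\<close>

definition edom :: "('a \<Rightarrow> ereal) \<Rightarrow> 'a set" where
  "edom r = {x. r x < \<infinity>}"

definition closed_convex_fun :: "('a::euclidean_space \<Rightarrow> ereal) \<Rightarrow> bool" where
  "closed_convex_fun r \<longleftrightarrow>
     (\<forall>x. r x \<noteq> -\<infinity>) \<and> convex {(x, a::real). r x \<le> ereal a} \<and> closed {(x, a::real). r x \<le> ereal a}"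

text \<open>For \<open>r\<close> closed, convex and not identically \<open>\<infinity>\<close> the minimiser below exists and is unique.\<close>

definition prox :: "('a::euclidean_space \<Rightarrow> ereal) \<Rightarrow> 'a \<Rightarrow> 'a" where
  "prox r u = (ARG_MIN (\<lambda>v. r v + ereal (1 / 2 * (norm (v - u))\<^sup>2)) v. True)"

definition prox_rows :: "(real^'d \<Rightarrow> ereal) \<Rightarrow> real^'d^'m \<Rightarrow> real^'d^'m" where
  "prox_rows r U = (\<chi> i. prox r (U $ i))"

subsection \<open>The decentralised minimax problem\<close>

definition all_rows :: "real^'d \<Rightarrow> real^'d^'m" where
  "all_rows x = (\<chi> i. x)"

definition row_mean :: "real^'d^'m \<Rightarrow> real^'d" where
  "row_mean X = (1 / real CARD('m)) *\<^sub>R (\<Sum>i\<in>UNIV. X $ i)"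

definition perp :: "real^'d^'m \<Rightarrow> real^'d^'m" where
  "perp X = X - all_rows (row_mean X)"

definition Phi :: "real \<Rightarrow> real^'m^'m \<Rightarrow> ('m \<Rightarrow> (real^'d1) \<times> (real^'d2) \<Rightarrow> real) \<Rightarrow> (real^'d2 \<Rightarrow> ereal)
    \<Rightarrow> real^'d1^'m \<Rightarrow> real^'d2^'m \<Rightarrow> real^'d2^'m \<Rightarrow> ereal" where
  "Phi L W f h X \<Lambda> Y =
     ereal (1 / real CARD('m)) * (\<Sum>i\<in>UNIV. ereal (f i (X $ i, Y $ i)) - h (Y $ i))
     - ereal (L / (2 * sqrt (real CARD('m))) * (\<Lambda> \<bullet> ((W - mat 1) ** Y)))"

text \<open>
  Under the standing assumptions the supremum is a maximum and is finite, so \<open>Pval\<close> is the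
  function \<open>P\<close> itself; its gradients are only taken through \<open>Pval\<close>.
\<close>

definition P :: "real \<Rightarrow> real^'m^'m \<Rightarrow> ('m \<Rightarrow> (real^'d1) \<times> (real^'d2) \<Rightarrow> real) \<Rightarrow> (real^'d2 \<Rightarrow> ereal)
    \<Rightarrow> real^'d1 \<Rightarrow> real^'d2^'m \<Rightarrow> ereal" where
  "P L W f h x \<Lambda> = (SUP Y. Phi L W f h (all_rows x) \<Lambda> Y)"

definition Pval :: "real \<Rightarrow> real^'m^'m \<Rightarrow> ('m \<Rightarrow> (real^'d1) \<times> (real^'d2) \<Rightarrow> real) \<Rightarrow> (real^'d2 \<Rightarrow> ereal)
    \<Rightarrow> real^'d1 \<Rightarrow> real^'d2^'m \<Rightarrow> real" where
  "Pval L W f h x \<Lambda> = real_of_ereal (P L W f h x \<Lambda>)"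

definition phi :: "real \<Rightarrow> real^'m^'m \<Rightarrow> ('m \<Rightarrow> (real^'d1) \<times> (real^'d2) \<Rightarrow> real) \<Rightarrow> (real^'d1 \<Rightarrow> ereal)
    \<Rightarrow> (real^'d2 \<Rightarrow> ereal) \<Rightarrow> real^'d1 \<Rightarrow> real^'d2^'m \<Rightarrow> ereal" where
  "phi L W f g h x \<Lambda> = P L W f h x \<Lambda> + g x"

definition spectral_norm :: "real^'n^'m \<Rightarrow> real" where
  "spectral_norm A = onorm ((*v) A)"

definition averaging :: "real^'m^'m" where
  "averaging = (\<chi> i j. 1 / real CARD('m))"

subsection \<open>Sampling\<close>

text \<open>Samples are counted with multiplicity if some of the \<open>\<xi> i j\<close> coincide.\<close>

definition local_dist :: "('m \<Rightarrow> 'n::finite \<Rightarrow> 'xi) \<Rightarrow> 'm \<Rightarrow> 'xi pmf" where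
  "local_dist \<xi> i = map_pmf (\<xi> i) (pmf_of_set UNIV)"

definition full_batch :: "('m \<Rightarrow> 'n::finite \<Rightarrow> 'xi) \<Rightarrow> 'm \<Rightarrow> 'xi multiset" where
  "full_batch \<xi> i = image_mset (\<xi> i) (mset_set UNIV)"

definition batch_grad :: "('z \<Rightarrow> 'xi \<Rightarrow> 'b::real_vector) \<Rightarrow> 'xi multiset \<Rightarrow> 'z \<Rightarrow> 'b" where
  "batch_grad G B z = (1 / real (size B)) *\<^sub>R (\<Sum>\<xi>\<in>#B. G z \<xi>)"

text \<open>
  \<open>s t i k \<omega>\<close> is the \<open>k\<close>-th member of the minibatch of agent \<open>i\<close> at step \<open>t\<close> (used only when \<open>q\<close>
  does not divide \<open>t\<close>).  Each minibatch is i.i.d. from the local distribution and jointly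
  independent of all minibatches, of all agents, drawn at earlier steps; nothing is required
  about the dependence between different agents at the same step.  The sample values lie in the
  finite support of the local distribution, so all iterates are simple functions of \<open>\<omega>\<close> and the
  events in the conclusion are automatically measurable.

  Both blocks are indexed by \<open>(step, agent, position)\<close> because \<open>indep_var\<close> requires
  the two random variables to have the same type.
\<close>

definition sample_block ::
  "(nat \<Rightarrow> 'm \<Rightarrow> nat \<Rightarrow> 'w \<Rightarrow> 'xi) \<Rightarrow> (nat \<times> 'm \<times> nat) set \<Rightarrow> 'w \<Rightarrow> nat \<times> 'm \<times> nat \<Rightarrow> 'xi" where
  "sample_block s J \<omega> = (\<lambda>(t, i, k)\<in>J. s t i k \<omega>)"

definition block_space :: "('m \<Rightarrow> 'xi pmf) \<Rightarrow> (nat \<times> 'm \<times> nat) set \<Rightarrow> (nat \<times> 'm \<times> nat \<Rightarrow> 'xi) measure" where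
  "block_space D J = (\<Pi>\<^sub>M (t, i, k)\<in>J. count_space (set_pmf (D i)))"

definition spider_samples ::
  "'w measure \<Rightarrow> ('m \<Rightarrow> 'xi pmf) \<Rightarrow> nat \<Rightarrow> nat \<Rightarrow> (nat \<Rightarrow> 'm \<Rightarrow> nat \<Rightarrow> 'w \<Rightarrow> 'xi) \<Rightarrow> bool" where
  "spider_samples M D q S2 s \<longleftrightarrow>
     (\<forall>t i. t mod q \<noteq> 0 \<longrightarrow>
        (let past = {(r, j, k). r < t \<and> r mod q \<noteq> 0 \<and> k < S2};
             batch = {t} \<times> {i} \<times> {..<S2}
         in prob_space.indep_vars M (\<lambda>k. count_space (set_pmf (D i))) (\<lambda>k. s t i k) {..<S2}
          \<and> (\<forall>k<S2. distr M (count_space UNIV) (s t i k) = measure_pmf (D i))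
          \<and> prob_space.indep_var M (block_space D past) (sample_block s past)
                                    (block_space D batch) (sample_block s batch)))"

text \<open>
  The batch used at step \<open>t\<close>: all local samples if \<open>q\<close> divides \<open>t\<close> (including \<open>t = 0\<close>), i.e. the
  setting where the sizes of the large batches equal the number of local samples, and a
  minibatch of size \<open>S2\<close> otherwise.
\<close>

definition spider_batch ::
  "('m \<Rightarrow> 'n::finite \<Rightarrow> 'xi) \<Rightarrow> nat \<Rightarrow> nat \<Rightarrow> (nat \<Rightarrow> 'm \<Rightarrow> nat \<Rightarrow> 'w \<Rightarrow> 'xi) \<Rightarrow> 'w \<Rightarrow> nat \<Rightarrow> 'm \<Rightarrow> 'xi multiset" where
  "spider_batch \<xi> q S2 s \<omega> t i =
     (if t mod q = 0 then full_batch \<xi> i else image_mset (\<lambda>k. s t i k \<omega>) (mset_set {..<S2}))"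

subsection \<open>VRLM with the SPIDER option\<close>

text \<open>
  The trajectory \<open>X, \<Lambda>, Y\<close> produced from the batches \<open>B t i\<close> on one sample path.  \<open>G i (x, y) \<xi>\<close>
  is the stochastic gradient oracle of agent \<open>i\<close>.
\<close>

definition vrlm_spider ::
  "(real^'d1 \<Rightarrow> ereal) \<Rightarrow> (real^'d2 \<Rightarrow> ereal) \<Rightarrow> real^'m^'m \<Rightarrow> real
   \<Rightarrow> ('m \<Rightarrow> (real^'d1) \<times> (real^'d2) \<Rightarrow> 'xi \<Rightarrow> (real^'d1) \<times> (real^'d2))
   \<Rightarrow> nat \<Rightarrow> real \<Rightarrow> real \<Rightarrow> real \<Rightarrow> real^'d1 \<Rightarrow> real^'d2 \<Rightarrow> (nat \<Rightarrow> 'm \<Rightarrow> 'xi multiset)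
   \<Rightarrow> (nat \<Rightarrow> real^'d1^'m) \<Rightarrow> (nat \<Rightarrow> real^'d2^'m) \<Rightarrow> (nat \<Rightarrow> real^'d2^'m) \<Rightarrow> bool" where
  "vrlm_spider g h W L G q \<eta>x \<eta>y \<eta>\<Lambda> x0 y0 B X \<Lambda> Y \<longleftrightarrow>
     (\<exists>d Dx Dy Vx Vy.
        X 0 = all_rows x0 \<and> Y 0 = all_rows y0 \<and> \<Lambda> 0 = 0
      \<and> (\<forall>i. d 0 i = batch_grad (G i) (B 0 i) (X 0 $ i, Y 0 $ i))
      \<and> (\<forall>t i. d (Suc t) i =
           (if Suc t mod q = 0
            then batch_grad (G i) (B (Suc t) i) (X (Suc t) $ i, Y (Suc t) $ i)
            else batch_grad (G i) (B (Suc t) i) (X (Suc t) $ i, Y (Suc t) $ i)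
                 - batch_grad (G i) (B (Suc t) i) (X t $ i, Y t $ i) + d t i))
      \<and> (\<forall>t. Dx t = (\<chi> i. fst (d t i)) \<and> Dy t = (\<chi> i. snd (d t i)))
      \<and> Vx 0 = Dx 0
      \<and> (\<forall>t. Vx (Suc t) = W ** (Vx t + Dx (Suc t) - Dx t))
      \<and> (\<forall>t. Vy t = Dy t - (L * sqrt (real CARD('m)) / 2) *\<^sub>R (transpose (W - mat 1) ** \<Lambda> t))
      \<and> (\<forall>t. \<Lambda> (Suc t) = \<Lambda> t + (L * \<eta>\<Lambda> / (2 * sqrt (real CARD('m)))) *\<^sub>R ((W - mat 1) ** Y t))
      \<and> (\<forall>t. X (Suc t) = prox_rows (\<lambda>v. ereal \<eta>x * g v) (W ** X t - \<eta>x *\<^sub>R Vx t))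
      \<and> (\<forall>t. Y (Suc t) = prox_rows (\<lambda>v. ereal \<eta>y * h v) (Y t + \<eta>y *\<^sub>R Vy t)))"

end

theory Submission
  imports Defs
begin

text \<open>
  The sum of \<open>P + g\<close>, a multiple of the dual gap \<open>P - \<Phi>\<close>, the consensus error \<open>\<parallel>X - J X\<parallel>\<^sup>2\<close> and the
  tracking error \<open>\<parallel>V - J V\<parallel>\<^sup>2\<close> (\<open>J\<close> averages the rows) is a Lyapunov function.  Its decrease controls the
  squared increments of \<open>x\<close>, \<open>\<Lambda>\<close> and \<open>Y\<close> and the consensus error, up to the squared error of the
  gradient estimator.  Since the estimator is reset to the exact gradient every \<open>q\<close> steps and the
  batch size is \<open>q\<close>, the summed expected estimation error is in turn at most \<open>L\<^sup>2\<close> times the summed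
  squared increments, and the step sizes are small enough to absorb it.  Hence all these quantities
  are summable in expectation; they bound both stationarity measures, and Markov's inequality
  gives convergence in probability.

  Two points keep the constants within the prescribed step sizes.  The dual gap decreases by
  \<open>7/2 L \<parallel>\<Delta>Y\<parallel>\<^sup>2\<close> per step, without a factor \<open>1/\<kappa>\<close>, and it enters with the weight
  \<open>1 + 10 \<eta> L / (1 - \<rho>)\<^sup>3\<close>, which pays for the tracking error.
\<close>

section \<open>Closed convex functions, proximal points and smooth functions\<close>

lemma edom_real:
  assumes "closed_convex_fun r" "x \<in> edom r"
  shows "r x = ereal (real_of_ereal (r x))"
  using assms by (cases "r x") (auto simp: closed_convex_fun_def edom_def)

lemma closed_convex_fun_convex:
  assumes r: "closed_convex_fun r" and u: "u \<in> edom r" and v: "v \<in> edom r" and t: "0 \<le> t" "t \<le> 1"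
  shows "(1 - t) *\<^sub>R u + t *\<^sub>R v \<in> edom r"
    and "real_of_ereal (r ((1 - t) *\<^sub>R u + t *\<^sub>R v))
      \<le> (1 - t) * real_of_ereal (r u) + t * real_of_ereal (r v)"
proof -
  have cv: "convex {(x, a::real). r x \<le> ereal a}"
    using r by (simp add: closed_convex_fun_def)
  have "(u, real_of_ereal (r u)) \<in> {(x, a::real). r x \<le> ereal a}"
    "(v, real_of_ereal (r v)) \<in> {(x, a::real). r x \<le> ereal a}"
    using edom_real[OF r u] edom_real[OF r v] by auto
  from convexD[OF cv this, of "1 - t" t] t
  have le: "r ((1 - t) *\<^sub>R u + t *\<^sub>R v)
      \<le> ereal ((1 - t) * real_of_ereal (r u) + t * real_of_ereal (r v))"
    by simp
  then show in_dom: "(1 - t) *\<^sub>R u + t *\<^sub>R v \<in> edom r"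
    by (auto simp: edom_def intro: le_less_trans)
  show "real_of_ereal (r ((1 - t) *\<^sub>R u + t *\<^sub>R v))
      \<le> (1 - t) * real_of_ereal (r u) + t * real_of_ereal (r v)"
    using le edom_real[OF r in_dom] by (metis ereal_less_eq(3))
qed

lemma closed_convex_fun_affine_minorant:
  fixes r :: "'a::euclidean_space \<Rightarrow> ereal"
  assumes r: "closed_convex_fun r" and x0: "x0 \<in> edom r"
  obtains a :: 'a and b :: real where "\<And>v c. r v \<le> ereal c \<Longrightarrow> a \<bullet> v + b \<le> c"
proof -
  let ?E = "{(x, a::real). r x \<le> ereal a}"
  let ?r0 = "real_of_ereal (r x0)"
  have r0: "r x0 = ereal ?r0" by (rule edom_real[OF r x0])
  have cv: "convex ?E" and cl: "closed ?E"
    using r by (simp_all add: closed_convex_fun_def)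
  have "(x0, ?r0 - 1) \<notin> ?E" by (subst mem_Collect_eq, simp, subst r0, simp)
  then obtain ab c where ab: "ab \<bullet> (x0, ?r0 - 1) < c" "\<And>z. z \<in> ?E \<Longrightarrow> c < ab \<bullet> z"
    using separating_hyperplane_closed_point[OF cv cl] by blast
  obtain a b where abp: "ab = (a, b)" by (cases ab)
  have in_E: "(x0, ?r0) \<in> ?E" using r0 by simp
  have "b > 0"
    using ab(1) ab(2)[OF in_E] by (simp add: abp inner_Pair algebra_simps)
  show ?thesis
  proof (rule that)
    fix v t assume "r v \<le> ereal t"
    then have "c < ab \<bullet> (v, t)" by (intro ab(2)) simp
    then have "c \<le> a \<bullet> v + b * t" by (simp add: abp inner_Pair)
    then show "(- (1 / b)) *\<^sub>R a \<bullet> v + c / b \<le> t"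
      using \<open>b > 0\<close> by (simp add: field_simps)
  qed
qed

lemma closed_convex_fun_minimiser:
  fixes r :: "'a::euclidean_space \<Rightarrow> ereal"
  assumes r: "closed_convex_fun r" and x0: "x0 \<in> edom r"
    and cont: "continuous_on UNIV \<phi>" and c: "c > 0"
    and growth: "\<And>v. \<phi> v \<ge> c * (norm v)\<^sup>2 + a' \<bullet> v + b'"
  obtains p where "p \<in> edom r"
    "\<And>v. v \<in> edom r \<Longrightarrow> real_of_ereal (r p) + \<phi> p \<le> real_of_ereal (r v) + \<phi> v"
proof -
  let ?E = "{(x, a::real). r x \<le> ereal a}"
  let ?K = "real_of_ereal (r x0) + \<phi> x0"
  define S where "S = ?E \<inter> {z. snd z + \<phi> (fst z) \<le> ?K}"
  obtain a b where min: "\<And>v t. r v \<le> ereal t \<Longrightarrow> a \<bullet> v + b \<le> t"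
    using closed_convex_fun_affine_minorant[OF r x0] by blast
  have contz: "continuous_on UNIV (\<lambda>z::'a \<times> real. snd z + \<phi> (fst z))"
    by (intro continuous_intros continuous_on_compose2[OF cont]) auto
  have "closed S"
    unfolding S_def using r
    by (intro closed_Int closed_Collect_le contz continuous_intros) (simp add: closed_convex_fun_def)
  define A where "A = norm a + norm a'"
  define R where "R = (A + \<bar>?K - b - b'\<bar> + 1) / c + 1"
  have "S \<subseteq> cball 0 R \<times> {- norm a * R + b .. ?K + norm a' * R - b'}"
  proof
    fix z assume "z \<in> S"
    then obtain v t where z: "z = (v, t)" and vt: "r v \<le> ereal t" "t + \<phi> v \<le> ?K"
      by (cases z) (auto simp: S_def)
    have ineq: "c * (norm v)\<^sup>2 + (a + a') \<bullet> v \<le> ?K - b - b'"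
      using min[OF vt(1)] vt(2) growth[of v] by (simp add: inner_add_left)
    have "\<bar>a \<bullet> v\<bar> \<le> norm a * norm v" "\<bar>a' \<bullet> v\<bar> \<le> norm a' * norm v"
      by (rule Cauchy_Schwarz_ineq2)+
    then have ineq2: "c * (norm v)\<^sup>2 \<le> A * norm v + \<bar>?K - b - b'\<bar>"
      using ineq by (simp add: A_def inner_add_left algebra_simps)
    have "A \<ge> 0" by (simp add: A_def)
    have nv: "norm v \<le> R"
    proof (rule ccontr)
      assume "\<not> norm v \<le> R"
      then have g: "norm v > R" by simp
      have "R \<ge> 1" using c \<open>A \<ge> 0\<close> by (simp add: R_def)
      have "c * R \<ge> A + \<bar>?K - b - b'\<bar> + 1" using c by (simp add: R_def field_simps)
      then have "c * norm v > A + \<bar>?K - b - b'\<bar>"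
        using g c by (smt (verit) mult_less_cancel_left_pos)
      then have "c * norm v * norm v > (A + \<bar>?K - b - b'\<bar>) * norm v"
        using g \<open>R \<ge> 1\<close> by (intro mult_strict_right_mono) auto
      moreover have "\<bar>?K - b - b'\<bar> * norm v \<ge> \<bar>?K - b - b'\<bar> * 1"
        using g \<open>R \<ge> 1\<close> by (intro mult_left_mono) auto
      ultimately show False using ineq2 by (simp add: power2_eq_square algebra_simps)
    qed
    have "norm a * norm v \<le> norm a * R" "norm a' * norm v \<le> norm a' * R"
      using nv by (intro mult_left_mono; simp)+
    moreover have "c * (norm v)\<^sup>2 \<ge> 0" using c by simp
    ultimately have "t \<ge> - norm a * R + b" "t \<le> ?K + norm a' * R - b'"
      using min[OF vt(1)] vt(2) growth[of v] \<open>\<bar>a \<bullet> v\<bar> \<le> _\<close> \<open>\<bar>a' \<bullet> v\<bar> \<le> _\<close> by linarith+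
    then show "z \<in> cball 0 R \<times> {- norm a * R + b .. ?K + norm a' * R - b'}"
      using nv by (simp add: z)
  qed
  moreover have "compact (cball (0::'a) R \<times> {- norm a * R + b .. ?K + norm a' * R - b'})"
    by (intro compact_Times) auto
  ultimately have "compact S"
    using \<open>closed S\<close> by (metis closed_Int_compact inf.absorb_iff1)
  moreover have x0S: "(x0, real_of_ereal (r x0)) \<in> S"
    using edom_real[OF r x0] by (simp add: S_def)
  ultimately obtain z where z: "z \<in> S" "\<And>y. y \<in> S \<Longrightarrow> snd z + \<phi> (fst z) \<le> snd y + \<phi> (fst y)"
    using continuous_attains_inf[OF _ _ continuous_on_subset[OF contz], of S] by blast
  obtain p t where zp: "z = (p, t)" by (cases z)
  have rp: "r p \<le> ereal t" using z(1) by (simp add: S_def zp)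
  then have p: "p \<in> edom r" by (auto simp: edom_def intro: le_less_trans)
  have rpt: "real_of_ereal (r p) \<le> t"
    using rp edom_real[OF r p] by (metis ereal_less_eq(3))
  show ?thesis
  proof (rule that[OF p])
    fix v assume v: "v \<in> edom r"
    show "real_of_ereal (r p) + \<phi> p \<le> real_of_ereal (r v) + \<phi> v"
    proof (cases "real_of_ereal (r v) + \<phi> v \<le> ?K")
      case True
      then have "(v, real_of_ereal (r v)) \<in> S"
        using edom_real[OF r v] by (simp add: S_def)
      from z(2)[OF this] rpt show ?thesis by (simp add: zp)
    next
      case False
      with z(2)[OF x0S] rpt show ?thesis by (simp add: zp)
    qed
  qed
qed

lemma GDERIV_line:
  fixes F :: "'a::real_inner \<Rightarrow> real"
  assumes "GDERIV F (p + t *\<^sub>R d) :> D"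
  shows "((\<lambda>t. F (p + t *\<^sub>R d)) has_real_derivative D \<bullet> d) (at t)"
proof -
  have "((\<lambda>t. p + t *\<^sub>R d) has_derivative (\<lambda>t. t *\<^sub>R d)) (at t)"
    by (auto intro!: derivative_eq_intros)
  from has_derivative_compose[OF this, of F "\<lambda>h. h \<bullet> D"] assms
  have "((\<lambda>t. F (p + t *\<^sub>R d)) has_derivative (\<lambda>t. t *\<^sub>R d \<bullet> D)) (at t)"
    by (simp add: gderiv_def)
  moreover have "(\<lambda>t. t *\<^sub>R d \<bullet> D) = (*) (D \<bullet> d)"
    by (rule ext) (simp add: inner_commute[of d D])
  ultimately show ?thesis
    by (simp only: has_field_derivative_def)
qed

lemma gderiv_directional:
  fixes F :: "'a::real_inner \<Rightarrow> real"
  assumes "GDERIV F p :> D"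
  shows "((\<lambda>t. (F (p + t *\<^sub>R d) - F p) / t) \<longlongrightarrow> D \<bullet> d) (at_right 0)"
proof -
  have "((\<lambda>t. F (p + t *\<^sub>R d)) has_real_derivative D \<bullet> d) (at 0)"
    using assms by (intro GDERIV_line) simp
  then have "((\<lambda>t. (F (p + t *\<^sub>R d) - F p) / t) \<longlongrightarrow> D \<bullet> d) (at 0)"
    by (simp add: has_field_derivative_iff)
  then show ?thesis by (rule tendsto_within_subset) simp
qed

lemma closed_convex_fun_first_order:
  fixes r :: "'a::euclidean_space \<Rightarrow> ereal"
  assumes r: "closed_convex_fun r" and p: "p \<in> edom r" and v: "v \<in> edom r"
    and min: "\<And>v. v \<in> edom r \<Longrightarrow> real_of_ereal (r p) + \<phi> p \<le> real_of_ereal (r v) + \<phi> v"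
    and D: "GDERIV \<phi> p :> D"
  shows "real_of_ereal (r v) \<ge> real_of_ereal (r p) - D \<bullet> (v - p)"
proof -
  have "- (D \<bullet> (v - p)) \<le> real_of_ereal (r v) - real_of_ereal (r p)"
  proof (rule tendsto_upperbound)
    show "((\<lambda>t. - ((\<phi> (p + t *\<^sub>R (v - p)) - \<phi> p) / t)) \<longlongrightarrow> - (D \<bullet> (v - p))) (at_right 0)"
      by (intro tendsto_minus gderiv_directional D)
    have "\<forall>\<^sub>F t in at_right (0::real). t \<in> {0<..<1}"
      by (rule eventually_at_right_real) simp
    then show "\<forall>\<^sub>F t in at_right 0. - ((\<phi> (p + t *\<^sub>R (v - p)) - \<phi> p) / t)
        \<le> real_of_ereal (r v) - real_of_ereal (r p)"
    proof eventually_elim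
      case (elim t)
      have eq: "(1 - t) *\<^sub>R p + t *\<^sub>R v = p + t *\<^sub>R (v - p)" by (simp add: algebra_simps)
      have "real_of_ereal (r p) + \<phi> p \<le> (1 - t) * real_of_ereal (r p) + t * real_of_ereal (r v)
          + \<phi> (p + t *\<^sub>R (v - p))"
        using closed_convex_fun_convex[OF r p v, of t] min[of "p + t *\<^sub>R (v - p)"] elim
        unfolding eq by auto
      then have "- (\<phi> (p + t *\<^sub>R (v - p)) - \<phi> p) \<le> t * (real_of_ereal (r v) - real_of_ereal (r p))"
        by (simp add: algebra_simps)
      then show ?case using elim by (simp add: field_simps)
    qed
  qed simp
  then show ?thesis by simp
qed

lemma GDERIV_sq_dist:
  "GDERIV (\<lambda>v::'a::real_inner. c / 2 * (norm (v - u))\<^sup>2) p :> c *\<^sub>R (p - u)"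
  unfolding gderiv_def power2_norm_eq_inner
  by (auto intro!: derivative_eq_intros simp: inner_commute algebra_simps)

lemma prox_variational:
  fixes r :: "'a::euclidean_space \<Rightarrow> ereal"
  assumes r: "closed_convex_fun r" and x0: "x0 \<in> edom r" and \<eta>: "\<eta> > 0"
  defines "p \<equiv> \<lambda>u. prox (\<lambda>v. ereal \<eta> * r v) u"
  shows "p u \<in> edom r"
    and "v \<in> edom r \<Longrightarrow> real_of_ereal (r v)
          \<ge> real_of_ereal (r (p u)) + (1 / \<eta>) *\<^sub>R (u - p u) \<bullet> (v - p u)"
proof -
  let ?\<psi> = "\<lambda>v. ereal \<eta> * r v + ereal (1 / 2 * (norm (v - u))\<^sup>2)"
  let ?\<phi> = "\<lambda>v. (1 / \<eta>) / 2 * (norm (v - u))\<^sup>2"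
  have dom: "?\<psi> v = ereal (\<eta> * (real_of_ereal (r v) + ?\<phi> v))" if "v \<in> edom r" for v
    using edom_real[OF r that] \<eta> by (cases "r v") (auto simp: field_simps)
  have ndom: "?\<psi> v = \<infinity>" if "v \<notin> edom r" for v
    using that \<eta> by (auto simp: edom_def)
  obtain p0 where p0: "p0 \<in> edom r"
    "\<And>v. v \<in> edom r \<Longrightarrow> real_of_ereal (r p0) + ?\<phi> p0 \<le> real_of_ereal (r v) + ?\<phi> v"
  proof (rule closed_convex_fun_minimiser[OF r x0, of ?\<phi> "(1 / \<eta>) / 2" "- (1 / \<eta>) *\<^sub>R u"
        "(1 / \<eta>) / 2 * (norm u)\<^sup>2"])
    show "continuous_on UNIV ?\<phi>" by (intro continuous_intros)
    show "(1 / \<eta>) / 2 * (norm v)\<^sup>2 + (- (1 / \<eta>) *\<^sub>R u) \<bullet> v + (1 / \<eta>) / 2 * (norm u)\<^sup>2 \<le> ?\<phi> v" for v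
      using \<eta> unfolding power2_norm_eq_inner
      by (simp add: inner_diff_left inner_diff_right inner_commute field_simps)
  qed (use \<eta> in auto)
  have le0: "?\<psi> p0 \<le> ?\<psi> v" for v
    using p0(2)[of v] dom[OF p0(1)] dom[of v] ndom[of v] \<eta> by (cases "v \<in> edom r") auto
  have "is_arg_min ?\<psi> (\<lambda>_. True) p0"
    using le0 by (auto simp: is_arg_min_linorder)
  then have am: "is_arg_min ?\<psi> (\<lambda>_. True) (p u)"
    unfolding p_def prox_def arg_min_def by (rule someI)
  then have le: "?\<psi> (p u) \<le> ?\<psi> v" for v by (auto simp: is_arg_min_linorder)
  show in_dom: "p u \<in> edom r"
    using le[of p0] dom[OF p0(1)] ndom[of "p u"] by force
  have min: "real_of_ereal (r (p u)) + ?\<phi> (p u) \<le> real_of_ereal (r v) + ?\<phi> v" if "v \<in> edom r" for v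
    using le[of v] dom[OF in_dom] dom[OF that] \<eta> by simp
  show "real_of_ereal (r v) \<ge> real_of_ereal (r (p u)) + (1 / \<eta>) *\<^sub>R (u - p u) \<bullet> (v - p u)"
    if "v \<in> edom r"
    using closed_convex_fun_first_order[OF r in_dom that min GDERIV_sq_dist]
    by (simp add: inner_diff_left diff_divide_distrib algebra_simps)
qed

lemma grad_eq:
  assumes "GDERIV F z :> D"
  shows "grad F z = D"
  unfolding grad_def
proof (rule the_equality)
  show "GDERIV F z :> D" by (rule assms)
next
  fix D' assume "GDERIV F z :> D'"
  then have "(\<lambda>h. h \<bullet> D') = (\<lambda>h. h \<bullet> D)"
    using assms unfolding gderiv_def by (rule has_derivative_unique)
  then have "(D' - D) \<bullet> D' = (D' - D) \<bullet> D" by (rule fun_cong)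
  then have "(D' - D) \<bullet> (D' - D) = 0" by (simp add: inner_diff_right)
  then show "D' = D" by simp
qed

lemma smooth_fun_GDERIV:
  assumes "smooth_fun L F"
  shows "GDERIV F z :> grad F z"
  using assms grad_eq by (metis smooth_fun_def)

lemma smooth_fun_lipschitz:
  assumes "smooth_fun L F"
  shows "norm (grad F z - grad F z') \<le> L * norm (z - z')" and "0 \<le> L"
  using assms by (auto simp: smooth_fun_def lipschitz_on_def dist_norm)

lemma smooth_fun_upper:
  fixes F :: "'a::real_inner \<Rightarrow> real"
  assumes D: "\<And>z. GDERIV F z :> D z" and lip: "\<And>z z'. norm (D z - D z') \<le> L * norm (z - z')"
  shows "F z' \<le> F z + D z \<bullet> (z' - z) + L / 2 * (norm (z' - z))\<^sup>2"
proof -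
  define d where "d = z' - z"
  let ?u = "\<lambda>t. F (z + t *\<^sub>R d) - t * (D z \<bullet> d) - L / 2 * t\<^sup>2 * (norm d)\<^sup>2"
  have "?u 1 \<le> ?u 0"
  proof (rule DERIV_nonpos_imp_nonincreasing[of 0 1])
    fix t :: real assume t: "0 \<le> t" "t \<le> 1"
    have "(?u has_real_derivative D (z + t *\<^sub>R d) \<bullet> d - D z \<bullet> d - L * t * (norm d)\<^sup>2) (at t)"
      by (auto intro!: derivative_eq_intros GDERIV_line D)
    moreover have "(D (z + t *\<^sub>R d) - D z) \<bullet> d \<le> norm (D (z + t *\<^sub>R d) - D z) * norm d"
      by (rule norm_cauchy_schwarz)
    moreover have "norm (D (z + t *\<^sub>R d) - D z) * norm d \<le> (L * norm (t *\<^sub>R d)) * norm d"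
      using lip[of "z + t *\<^sub>R d" z] by (intro mult_right_mono) auto
    ultimately show "\<exists>y. (?u has_real_derivative y) (at t) \<and> y \<le> 0"
      using t by (intro exI[of _ "D (z + t *\<^sub>R d) \<bullet> d - D z \<bullet> d - L * t * (norm d)\<^sup>2"])
        (auto simp: inner_diff_left power2_eq_square)
  qed simp
  then show ?thesis by (simp add: d_def)
qed

lemma smooth_fun_quadratic:
  fixes F :: "'a::real_inner \<Rightarrow> real"
  assumes "smooth_fun L F"
  shows "\<bar>F z' - F z - grad F z \<bullet> (z' - z)\<bar> \<le> L / 2 * (norm (z' - z))\<^sup>2"
proof -
  have "GDERIV (\<lambda>z. - F z) z :> - grad F z" for z
    using smooth_fun_GDERIV[OF assms] by (rule GDERIV_minus)
  moreover have "norm (- grad F z - - grad F z') \<le> L * norm (z - z')" for z z'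
    using smooth_fun_lipschitz(1)[OF assms, of z z'] by (simp add: norm_minus_commute)
  ultimately have "- F z' \<le> - F z + - grad F z \<bullet> (z' - z) + L / 2 * (norm (z' - z))\<^sup>2"
    by (rule smooth_fun_upper)
  moreover have "F z' \<le> F z + grad F z \<bullet> (z' - z) + L / 2 * (norm (z' - z))\<^sup>2"
    by (rule smooth_fun_upper) (auto intro: smooth_fun_GDERIV assms smooth_fun_lipschitz)
  ultimately show ?thesis unfolding inner_minus_left by linarith
qed

lemma strongly_concave_first_order:
  fixes F :: "'a::real_inner \<Rightarrow> real"
  assumes sc: "strongly_concave \<mu> F" and D: "GDERIV F y :> D"
  shows "F y' \<le> F y + D \<bullet> (y' - y) - \<mu> / 2 * (norm (y' - y))\<^sup>2"
proof -
  have "F y' - F y + \<mu> / 2 * (1 - 0) * (norm (y' - y))\<^sup>2 \<le> D \<bullet> (y' - y)"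
  proof (rule tendsto_le)
    show "((\<lambda>t. (F (y + t *\<^sub>R (y' - y)) - F y) / t) \<longlongrightarrow> D \<bullet> (y' - y)) (at_right 0)"
      by (rule gderiv_directional[OF D])
    show "((\<lambda>t. F y' - F y + \<mu> / 2 * (1 - t) * (norm (y' - y))\<^sup>2)
        \<longlongrightarrow> F y' - F y + \<mu> / 2 * (1 - 0) * (norm (y' - y))\<^sup>2) (at_right 0)"
      by (intro tendsto_intros)
    have "\<forall>\<^sub>F t in at_right (0::real). t \<in> {0<..<1}"
      by (rule eventually_at_right_real) simp
    then show "\<forall>\<^sub>F t in at_right 0. F y' - F y + \<mu> / 2 * (1 - t) * (norm (y' - y))\<^sup>2
        \<le> (F (y + t *\<^sub>R (y' - y)) - F y) / t"
    proof eventually_elim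
      case (elim t)
      have eq: "t *\<^sub>R y' + (1 - t) *\<^sub>R y = y + t *\<^sub>R (y' - y)" by (simp add: algebra_simps)
      have "t * F y' + (1 - t) * F y + \<mu> / 2 * t * (1 - t) * (norm (y' - y))\<^sup>2
          \<le> F (y + t *\<^sub>R (y' - y))"
        using sc elim unfolding strongly_concave_def eq[symmetric] by auto
      then have "t * (F y' - F y + \<mu> / 2 * (1 - t) * (norm (y' - y))\<^sup>2) \<le> F (y + t *\<^sub>R (y' - y)) - F y"
        by (simp add: algebra_simps)
      then show ?case using elim by (simp add: field_simps)
    qed
  qed simp
  then show ?thesis by simp
qed

section \<open>Descent along one trajectory\<close>

lemma young:
  fixes a b c :: real
  assumes "c > 0"
  shows "a * b \<le> c * a\<^sup>2 + b\<^sup>2 / (4 * c)"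
proof -
  have "0 \<le> (2 * c * a - b)\<^sup>2" by simp
  then show ?thesis using assms by (simp add: power2_eq_square field_simps)
qed

lemma power2_sum3_le: "(a + b + c)\<^sup>2 \<le> 3 * (a\<^sup>2 + b\<^sup>2 + (c::real)\<^sup>2)"
  using sum_squares_bound[of a b] sum_squares_bound[of a c] sum_squares_bound[of b c]
  by (simp add: power2_eq_square algebra_simps)

lemma power2_sum2_le: "(a + b)\<^sup>2 \<le> 2 * a\<^sup>2 + 2 * (b::real)\<^sup>2"
  using sum_squares_bound[of a b] by (simp add: power2_eq_square algebra_simps)

locale saddle =
  fixes F :: "'a::real_inner \<Rightarrow> 'b::real_inner \<Rightarrow> real"
    and FX :: "'a \<Rightarrow> 'b \<Rightarrow> 'a" and FY :: "'a \<Rightarrow> 'b \<Rightarrow> 'b"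
    and H :: "'b \<Rightarrow> real" and K :: "'b set"
    and B :: "'b \<Rightarrow> 'c::real_inner" and B' :: "'c \<Rightarrow> 'b"
    and Ys :: "'a \<Rightarrow> 'c \<Rightarrow> 'b"
    and L \<mu> \<kappa> :: real
  assumes mu: "0 < \<mu>" "\<mu> \<le> L" and kappa: "\<kappa> = L / \<mu>"
    and F_lip: "(norm (FX x y - FX x' y'))\<^sup>2 + (norm (FY x y - FY x' y'))\<^sup>2
      \<le> L\<^sup>2 * ((norm (x - x'))\<^sup>2 + (norm (y - y'))\<^sup>2)"
    and F_quad: "\<bar>F x' y' - F x y - FX x y \<bullet> (x' - x) - FY x y \<bullet> (y' - y)\<bar>
      \<le> L / 2 * ((norm (x' - x))\<^sup>2 + (norm (y' - y))\<^sup>2)"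
    and F_conc: "F x y' \<le> F x y + FY x y \<bullet> (y' - y) - \<mu> / 2 * (norm (y' - y))\<^sup>2"
    and B_diff: "B (y - y') = B y - B y'" and B_norm: "norm (B y) \<le> L * norm y"
    and B_adj: "B' l \<bullet> y = l \<bullet> B y"
    and Ys_in: "Ys x l \<in> K"
    and Ys_opt: "y \<in> K \<Longrightarrow> H y \<ge> H (Ys x l) + (FY x (Ys x l) + B' l) \<bullet> (y - Ys x l)"
begin

definition \<Phi> :: "'a \<Rightarrow> 'c \<Rightarrow> 'b \<Rightarrow> real" where
  "\<Phi> x l y = F x y - H y + l \<bullet> B y"

definition \<P> :: "'a \<Rightarrow> 'c \<Rightarrow> real" where
  "\<P> x l = \<Phi> x l (Ys x l)"

lemma L_pos: "0 < L" and kappa_ge_1: "1 \<le> \<kappa>"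
  using mu by (auto simp: kappa field_simps)

lemma F_upper: "F x' y' \<le> F x y + FX x y \<bullet> (x' - x) + FY x y \<bullet> (y' - y)
      + L / 2 * ((norm (x' - x))\<^sup>2 + (norm (y' - y))\<^sup>2)"
  and F_lower: "F x' y' \<ge> F x y + FX x y \<bullet> (x' - x) + FY x y \<bullet> (y' - y)
      - L / 2 * ((norm (x' - x))\<^sup>2 + (norm (y' - y))\<^sup>2)"
  using F_quad[of x' y' x y] unfolding abs_le_iff by linarith+

lemma FX_lip: "(norm (FX x y - FX x' y'))\<^sup>2 \<le> L\<^sup>2 * ((norm (x - x'))\<^sup>2 + (norm (y - y'))\<^sup>2)"
  and FY_lip: "(norm (FY x y - FY x' y'))\<^sup>2 \<le> L\<^sup>2 * ((norm (x - x'))\<^sup>2 + (norm (y - y'))\<^sup>2)"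
  using F_lip[of x y x' y'] zero_le_power2[of "norm (FX x y - FX x' y')"]
    zero_le_power2[of "norm (FY x y - FY x' y')"] by linarith+

lemma FX_lip_norm: "norm (FX x y - FX x' y') \<le> L * (norm (x - x') + norm (y - y'))"
proof (rule power2_le_imp_le)
  show "(norm (FX x y - FX x' y'))\<^sup>2 \<le> (L * (norm (x - x') + norm (y - y')))\<^sup>2"
    using FX_lip[of x y x' y'] L_pos
    by (smt (verit) mult_left_mono power_mult_distrib power2_sum mult_nonneg_nonneg norm_ge_zero zero_le_power2)
qed (use L_pos in auto)

lemma FX_lip_y: "norm (FX x y - FX x y') \<le> L * norm (y - y')"
  using FX_lip_norm[of x y x y'] by simp

lemma FY_lip_x: "norm (FY x y - FY x' y) \<le> L * norm (x - x')"
  and FY_lip_y: "norm (FY x y - FY x y') \<le> L * norm (y - y')"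
  using FY_lip[of x y x' y] FY_lip[of x y x y'] L_pos
  by (auto simp: power_mult_distrib[symmetric] intro: power2_le_imp_le)

lemma \<P>_ge:
  assumes "y \<in> K"
  shows "\<Phi> x l y \<le> \<P> x l - \<mu> / 2 * (norm (y - Ys x l))\<^sup>2"
proof -
  let ?y = "Ys x l"
  have "F x y \<le> F x ?y + FY x ?y \<bullet> (y - ?y) - \<mu> / 2 * (norm (y - ?y))\<^sup>2" by (rule F_conc)
  moreover have "H y \<ge> H ?y + (FY x ?y + B' l) \<bullet> (y - ?y)" by (rule Ys_opt[OF assms])
  moreover have "B' l \<bullet> (y - ?y) = l \<bullet> B y - l \<bullet> B ?y"
    by (simp add: B_adj B_diff inner_diff_right)
  ultimately show ?thesis
    by (simp add: \<Phi>_def \<P>_def inner_add_left)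
qed

lemma \<Phi>_le_\<P>: "y \<in> K \<Longrightarrow> \<Phi> x l y \<le> \<P> x l"
  using \<P>_ge[of y x l] mu by (smt (verit) divide_nonneg_pos mult_nonneg_nonneg zero_le_power2)

text \<open>
  The next two bounds take the place of Danskin's theorem: they identify the gradient of \<open>\<P>\<close>
  and serve as descent inequality.
\<close>

lemma \<P>_lower:
  "\<P> x' l' \<ge> \<P> x l + FX x (Ys x l) \<bullet> (x' - x) + (l' - l) \<bullet> B (Ys x l) - L / 2 * (norm (x' - x))\<^sup>2"
proof -
  have "\<Phi> x' l' (Ys x l) \<le> \<P> x' l'" by (rule \<Phi>_le_\<P>[OF Ys_in])
  moreover have "F x' (Ys x l) \<ge> F x (Ys x l) + FX x (Ys x l) \<bullet> (x' - x) - L / 2 * (norm (x' - x))\<^sup>2"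
    using F_lower[of x "Ys x l" x' "Ys x l"] by simp
  ultimately show ?thesis
    unfolding \<Phi>_def \<P>_def inner_diff_left[of l' l] by linarith
qed

lemma \<P>_upper:
  "\<P> x' l' \<le> \<P> x l + FX x (Ys x l) \<bullet> (x' - x) + (l' - l) \<bullet> B (Ys x l)
    + (L * \<kappa> + L / 2) * (norm (x' - x))\<^sup>2 + L * \<kappa> * (norm (l' - l))\<^sup>2"
proof -
  define y y' where "y = Ys x l" and "y' = Ys x' l'"
  define p q d where "p = norm (x' - x)" and "q = norm (l' - l)" and "d = norm (y' - y)"
  have 1: "\<Phi> x l y' \<le> \<P> x l - \<mu> / 2 * d\<^sup>2"
    unfolding y_def d_def by (rule \<P>_ge) (simp add: y'_def Ys_in)
  have 2: "F x' y' \<le> F x y' + FX x y' \<bullet> (x' - x) + L / 2 * p\<^sup>2"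
    using F_upper[of x' y' x y'] by (simp add: p_def)
  have "(FX x y' - FX x y) \<bullet> (x' - x) \<le> norm (FX x y' - FX x y) * p"
    unfolding p_def by (rule norm_cauchy_schwarz)
  also have "\<dots> \<le> L * d * p"
    unfolding d_def by (intro mult_right_mono FX_lip_y) (simp add: p_def)
  finally have 3: "FX x y' \<bullet> (x' - x) \<le> FX x y \<bullet> (x' - x) + L * d * p"
    by (simp add: inner_diff_left)
  have "(l' - l) \<bullet> B (y' - y) \<le> q * norm (B (y' - y))"
    unfolding q_def by (rule norm_cauchy_schwarz)
  also have "\<dots> \<le> q * (L * d)"
    unfolding d_def by (intro mult_left_mono B_norm) (simp add: q_def)
  finally have 4: "(l' - l) \<bullet> B y' \<le> (l' - l) \<bullet> B y + L * d * q"
    by (simp add: B_diff inner_diff_right mult_ac)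
  have young: "L * d * z \<le> \<mu> / 4 * d\<^sup>2 + L * \<kappa> * z\<^sup>2" for z
  proof -
    have "d * (L * z) \<le> \<mu> / 4 * d\<^sup>2 + (L * z)\<^sup>2 / (4 * (\<mu> / 4))"
      by (rule young) (use mu in simp)
    then show ?thesis by (simp add: kappa power2_eq_square mult_ac)
  qed
  have "\<P> x' l' - \<P> x l \<le> F x' y' - F x y' + (l' - l) \<bullet> B y' - \<mu> / 2 * d\<^sup>2"
    using 1 by (simp add: \<P>_def \<Phi>_def y'_def inner_diff_left)
  then show ?thesis
    using 2 3 4 young[of p] young[of q]
    unfolding y_def[symmetric] p_def[symmetric] q_def[symmetric] distrib_right by linarith
qed

end

text \<open>
  \<open>J\<close> is the averaging projection, \<open>G\<close> and \<open>H\<close> are the regularisers, \<open>Dx\<close> and \<open>Dy\<close> arbitrary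
  gradient estimators.  The proximal steps enter only through their variational inequalities.
\<close>

locale vrlm_path = saddle F FX FY H K B B' Ys L \<mu> \<kappa>
  for F :: "'a::real_inner \<Rightarrow> 'b::real_inner \<Rightarrow> real"
    and FX FY H K and B :: "'b \<Rightarrow> 'c::real_inner" and B' Ys L \<mu> \<kappa> +
  fixes J W :: "'a \<Rightarrow> 'a" and G :: "'a \<Rightarrow> real" and C :: "'a set"
    and X V Dx :: "nat \<Rightarrow> 'a" and Y Dy :: "nat \<Rightarrow> 'b" and \<Lambda> :: "nat \<Rightarrow> 'c"
    and \<rho> \<eta> \<theta> :: real
  assumes J_lin: "linear J" and J_idem: "J (J x) = J x" and J_adj: "J x \<bullet> x' = x \<bullet> J x'"
    and J_W: "J (W x) = J x" and W_gap: "norm (W x - J x) \<le> \<rho> * norm (x - J x)"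
    and rho: "0 \<le> \<rho>" "\<rho> < 1"
    and G_J: "x \<in> C \<Longrightarrow> J x \<in> C" "x \<in> C \<Longrightarrow> G (J x) \<le> G x"
    and X_in: "X t \<in> C" and Y_in: "Y t \<in> K"
    and V_0: "V 0 = Dx 0" and V_Suc: "V (Suc t) = W (V t + Dx (Suc t) - Dx t)"
    and \<Lambda>_Suc: "\<Lambda> (Suc t) = \<Lambda> t - \<theta> *\<^sub>R B (Y t)"
    and X_Suc: "x \<in> C \<Longrightarrow> G x \<ge> G (X (Suc t))
      + (1 / \<eta>) *\<^sub>R (W (X t) - \<eta> *\<^sub>R V t - X (Suc t)) \<bullet> (x - X (Suc t))"
    and Y_Suc: "y \<in> K \<Longrightarrow> H y \<ge> H (Y (Suc t))
      + (4 * L) *\<^sub>R (Y t + (1 / (4 * L)) *\<^sub>R (Dy t + B' (\<Lambda> t)) - Y (Suc t)) \<bullet> (y - Y (Suc t))"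
    and eta: "0 < \<eta>" "\<eta> * L * \<kappa> \<le> (1 - \<rho>)\<^sup>2 / 360" "\<eta> * L * \<kappa>\<^sup>2 \<le> 1 / 240"
    and theta: "0 < \<theta>" "\<theta> * L * \<kappa> \<le> (1 - \<rho>)\<^sup>2 / 25" "\<theta> * L * \<kappa>\<^sup>2 \<le> 1 / 138"
begin

abbreviation r :: real where "r \<equiv> 1 - \<rho>"

definition weight :: real where "weight = 1 + 10 * (\<eta> * L) / r ^ 3"

definition ex :: "nat \<Rightarrow> 'a" where "ex t = Dx t - FX (X t) (Y t)"
definition ey :: "nat \<Rightarrow> 'b" where "ey t = Dy t - FY (X t) (Y t)"
definition Er :: "nat \<Rightarrow> real" where "Er t = (norm (ex t))\<^sup>2 + (norm (ey t))\<^sup>2"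
definition dp :: "nat \<Rightarrow> real" where "dp t = norm (J (X (Suc t)) - J (X t))"
definition dl :: "nat \<Rightarrow> real" where "dl t = norm (\<Lambda> (Suc t) - \<Lambda> t)"
definition ds :: "nat \<Rightarrow> real" where "ds t = norm (Y (Suc t) - Y t)"
definition cons :: "nat \<Rightarrow> real" where "cons t = norm (X t - J (X t))"
definition vperp :: "nat \<Rightarrow> real" where "vperp t = norm (V t - J (V t))"
definition Yopt :: "nat \<Rightarrow> 'b" where "Yopt t = Ys (J (X t)) (\<Lambda> t)"

lemma r: "0 < r" "r \<le> 1" using rho by auto

lemma J_diff: "J (x - y) = J x - J y" by (rule linear_diff[OF J_lin])
lemma J_add: "J (x + y) = J x + J y" by (rule linear_add[OF J_lin])

lemma perp_orth: "(x - J x) \<bullet> J y = 0"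
  by (simp add: inner_diff_left J_adj J_idem)

lemma J_V: "J (V t) = J (Dx t)"
  by (induction t) (simp_all add: V_0 V_Suc J_W J_diff J_add)

lemma norm_sq_split: "(norm x)\<^sup>2 = (norm (x - J x))\<^sup>2 + (norm (J x))\<^sup>2"
  using perp_orth[of x x] unfolding power2_norm_eq_inner
  by (simp add: inner_diff_left inner_diff_right J_adj[of x x] J_adj[of x "J x"] J_idem)

lemma norm_perp_le: "norm (x - J x) \<le> norm x" and norm_J_le: "norm (J x) \<le> norm x"
proof -
  note norm_sq_split[of x]
  then show "norm (x - J x) \<le> norm x" "norm (J x) \<le> norm x"
    by (auto intro: power2_le_imp_le[OF _ norm_ge_zero])
qed

text \<open>Testing the proximal inequality at \<open>J (X t)\<close> yields the decrease of the consensus error as well.\<close>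

lemma consensus_descent:
  "G (J (X (Suc t))) - G (J (X t)) \<le> - ((dp t)\<^sup>2 / \<eta>) - (J (X (Suc t)) - J (X t)) \<bullet> Dx t
    - (cons (Suc t))\<^sup>2 / \<eta> + \<rho> / \<eta> * (cons (Suc t) * cons t) + cons (Suc t) * vperp t"
proof -
  let ?X = "X t" and ?X' = "X (Suc t)"
  define u where "u = J ?X' - J ?X"
  define w where "w = ?X' - J ?X'"
  define z where "z = W ?X - J ?X"
  have uJ: "u = J (?X' - ?X)" by (simp add: u_def J_diff)
  have zp: "z = W ?X - J (W ?X)" by (simp add: z_def J_W)
  have zu: "z \<bullet> u = 0" unfolding zp uJ by (rule perp_orth)
  have wu: "w \<bullet> u = 0" unfolding w_def uJ by (rule perp_orth)
  have Vu: "V t \<bullet> u = u \<bullet> Dx t"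
  proof -
    have "V t \<bullet> u = J (V t) \<bullet> (?X' - ?X)" unfolding uJ by (simp add: J_adj)
    also have "\<dots> = Dx t \<bullet> u" unfolding uJ J_V by (simp add: J_adj)
    finally show ?thesis by (simp add: inner_commute)
  qed
  have Vw: "V t \<bullet> w = (V t - J (V t)) \<bullet> w"
    using perp_orth[of "?X'" "V t"] by (simp add: w_def inner_diff_left inner_commute)
  have xw: "?X' - J ?X = u + w" by (simp add: u_def w_def)
  have dec: "(1 / \<eta>) *\<^sub>R (W ?X - \<eta> *\<^sub>R V t - ?X') = (1 / \<eta>) *\<^sub>R (z - u - w) - V t"
    using eta by (simp add: z_def u_def w_def scaleR_diff_right algebra_simps)
  have "G (J ?X') \<le> G ?X'" by (rule G_J(2)[OF X_in])
  also have "\<dots> \<le> G (J ?X) + ((1 / \<eta>) *\<^sub>R (z - u - w) - V t) \<bullet> (u + w)"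
    using X_Suc[OF G_J(1)[OF X_in[of t]], of t] unfolding dec
    unfolding xw[symmetric] by (simp add: inner_diff_right)
  also have "((1 / \<eta>) *\<^sub>R (z - u - w) - V t) \<bullet> (u + w)
      = (z \<bullet> w - u \<bullet> u - w \<bullet> w) / \<eta> - V t \<bullet> u - V t \<bullet> w"
    using zu wu unfolding inner_diff_left inner_scaleR_left inner_add_right inner_commute[of u w]
    by (simp add: add_divide_distrib diff_divide_distrib)
  finally have main: "G (J ?X') \<le> G (J ?X) + ((z \<bullet> w - u \<bullet> u - w \<bullet> w) / \<eta> - V t \<bullet> u - V t \<bullet> w)" .
  have "z \<bullet> w \<le> norm z * norm w" by (rule norm_cauchy_schwarz)
  also have "\<dots> \<le> (\<rho> * cons t) * norm w"
    unfolding z_def cons_def by (intro mult_right_mono W_gap) simp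
  finally have zw: "z \<bullet> w / \<eta> \<le> \<rho> / \<eta> * (norm w * cons t)"
    using eta by (simp add: divide_right_mono mult_ac)
  have "- ((V t - J (V t)) \<bullet> w) \<le> norm (V t - J (V t)) * norm w"
    using Cauchy_Schwarz_ineq2[of "V t - J (V t)" w] by linarith
  then have vw: "- (V t \<bullet> w) \<le> norm w * vperp t" by (simp add: Vw vperp_def mult.commute)
  have "u \<bullet> u = (dp t)\<^sup>2" "w \<bullet> w = (norm w)\<^sup>2" "norm w = cons (Suc t)"
    by (simp_all add: u_def w_def dp_def cons_def power2_norm_eq_inner)
  with main zw vw Vu show ?thesis
    unfolding u_def[symmetric] by (simp add: diff_divide_distrib)
qed

lemma V_perp_step:
  "(vperp (Suc t))\<^sup>2 \<le> \<rho> * (vperp t)\<^sup>2 + (norm (Dx (Suc t) - Dx t))\<^sup>2 / r"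
proof -
  define d where "d = norm (Dx (Suc t) - Dx t)"
  let ?u = "V t + Dx (Suc t) - Dx t"
  have "vperp (Suc t) = norm (W ?u - J ?u)" by (simp add: vperp_def V_Suc J_W)
  also have "\<dots> \<le> \<rho> * norm (?u - J ?u)" by (rule W_gap)
  also have "?u - J ?u = (V t - J (V t)) + ((Dx (Suc t) - Dx t) - J (Dx (Suc t) - Dx t))"
    by (simp add: J_diff J_add)
  also have "norm \<dots> \<le> vperp t + d"
    unfolding vperp_def d_def by (intro norm_triangle_le add_left_mono norm_perp_le)
  finally have "vperp (Suc t) \<le> \<rho> * (vperp t + d)" using rho by (simp add: mult_left_mono)
  then have "(vperp (Suc t))\<^sup>2 \<le> (\<rho> * (vperp t + d))\<^sup>2"
    by (intro power_mono) (simp_all add: vperp_def)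
  also have "\<dots> \<le> \<rho> * (vperp t)\<^sup>2 + d\<^sup>2 / r"
  proof -
    have "r * (\<rho> * (vperp t + d))\<^sup>2 + (\<rho> * (r * vperp t - \<rho> * d)\<^sup>2 + (1 - \<rho>\<^sup>2) * d\<^sup>2)
        = r * (\<rho> * (vperp t)\<^sup>2) + d\<^sup>2"
      by algebra
    moreover have "0 \<le> \<rho> * (r * vperp t - \<rho> * d)\<^sup>2 + (1 - \<rho>\<^sup>2) * d\<^sup>2"
      using rho by (intro add_nonneg_nonneg mult_nonneg_nonneg) (auto simp: power_le_one)
    ultimately show ?thesis using r by (simp add: field_simps)
  qed
  finally show ?thesis by (simp add: d_def)
qed

lemma Yopt_dist:
  fixes t
  defines "e \<equiv> norm (ey t) + L * cons t"
  shows "norm (Y (Suc t) - Yopt t) \<le> 5 * \<kappa> * ds t + e / \<mu>"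
    and "norm (Y t - Yopt t) \<le> 6 * \<kappa> * ds t + e / \<mu>"
proof -
  let ?x = "J (X t)" and ?Y = "Y t" and ?Y' = "Y (Suc t)" and ?Z = "Yopt t"
  define D where "D = norm (?Y' - ?Z)"
  define w where "w = (4 * L) *\<^sub>R (?Y - ?Y') + (FY ?x ?Y - FY ?x ?Y') + (ey t + (FY (X t) ?Y - FY ?x ?Y))"
  have 1: "H ?Z \<ge> H ?Y' + ((4 * L) *\<^sub>R (?Y - ?Y') + Dy t + B' (\<Lambda> t)) \<bullet> (?Z - ?Y')"
    using Y_Suc[of ?Z t] L_pos Ys_in by (simp add: Yopt_def scaleR_add_right scaleR_diff_right algebra_simps)
  have 2: "H ?Y' \<ge> H ?Z + (FY ?x ?Z + B' (\<Lambda> t)) \<bullet> (?Y' - ?Z)"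
    unfolding Yopt_def by (rule Ys_opt[OF Y_in])
  have 3: "F ?x ?Y' \<le> F ?x ?Z + FY ?x ?Z \<bullet> (?Y' - ?Z) - \<mu> / 2 * D\<^sup>2"
    unfolding D_def by (rule F_conc)
  have 4: "F ?x ?Z \<le> F ?x ?Y' + FY ?x ?Y' \<bullet> (?Z - ?Y') - \<mu> / 2 * D\<^sup>2"
    using F_conc[of ?x ?Z ?Y'] unfolding D_def by (simp add: norm_minus_commute)
  have neg: "a \<bullet> (?Z - ?Y') = - (a \<bullet> (?Y' - ?Z))" for a
    by (simp add: inner_diff_right)
  have "\<mu> * D\<^sup>2 \<le> w \<bullet> (?Y' - ?Z)"
    using 1 2 3 4 unfolding neg w_def ey_def by (simp add: inner_add_left inner_diff_left)
  also have "\<dots> \<le> norm w * D" unfolding D_def by (rule norm_cauchy_schwarz)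
  also have "norm w \<le> 4 * L * ds t + L * ds t + e"
    unfolding w_def e_def
  proof (intro norm_triangle_le add_mono)
    show "norm ((4 * L) *\<^sub>R (?Y - ?Y')) \<le> 4 * L * ds t"
      using L_pos by (simp add: ds_def norm_minus_commute)
    show "norm (FY ?x ?Y - FY ?x ?Y') \<le> L * ds t"
      using FY_lip_y[of ?x ?Y ?Y'] by (simp add: ds_def norm_minus_commute)
    show "norm (FY (X t) ?Y - FY ?x ?Y) \<le> L * cons t"
      unfolding cons_def by (rule FY_lip_x)
  qed simp
  finally have "\<mu> * D * D \<le> (5 * L * ds t + e) * D"
    by (simp add: D_def power2_eq_square mult_right_mono mult.assoc)
  moreover have "0 \<le> 5 * L * ds t + e"
    using L_pos by (simp add: e_def ds_def cons_def)
  ultimately have "\<mu> * D \<le> 5 * L * ds t + e"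
    by (cases "D = 0") (auto simp: D_def)
  then show D: "D \<le> 5 * \<kappa> * ds t + e / \<mu>"
    using mu by (simp add: kappa field_simps)
  have "norm (?Y - ?Z) \<le> norm (?Y - ?Y') + D"
    unfolding D_def by (rule norm_triangle_sub[of "?Y - ?Z" "?Y - ?Y'", THEN order_trans]) simp
  also have "norm (?Y - ?Y') \<le> \<kappa> * ds t"
    using mult_right_mono[OF kappa_ge_1, of "ds t"] by (simp add: ds_def norm_minus_commute)
  finally show "norm (?Y - ?Z) \<le> 6 * \<kappa> * ds t + e / \<mu>" using D by simp
qed

lemma Yopt_dist_sq:
  fixes t
  defines "R \<equiv> 45 * \<kappa>\<^sup>2 * (ds t)\<^sup>2 + 10 * \<kappa>\<^sup>2 * (Er t / L\<^sup>2 + (cons t)\<^sup>2)"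
  shows "(norm (Y (Suc t) - Yopt t))\<^sup>2 \<le> R" and "(norm (Y t - Yopt t))\<^sup>2 \<le> R"
proof -
  define e where "e = norm (ey t) + L * cons t"
  have e0: "0 \<le> e" using L_pos by (simp add: e_def cons_def)
  have "e\<^sup>2 \<le> 2 * (norm (ey t))\<^sup>2 + 2 * (L * cons t)\<^sup>2" unfolding e_def by (rule power2_sum2_le)
  also have "\<dots> \<le> 2 * Er t + 2 * L\<^sup>2 * (cons t)\<^sup>2" by (simp add: Er_def power_mult_distrib)
  finally have "(e / \<mu>)\<^sup>2 \<le> (2 * Er t + 2 * L\<^sup>2 * (cons t)\<^sup>2) / \<mu>\<^sup>2"
    by (simp add: power_divide divide_right_mono)
  also have "\<dots> = 2 * \<kappa>\<^sup>2 * (Er t / L\<^sup>2 + (cons t)\<^sup>2)"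
    using L_pos mu by (simp add: kappa field_simps power2_eq_square)
  finally have e2: "(e / \<mu>)\<^sup>2 \<le> 2 * \<kappa>\<^sup>2 * (Er t / L\<^sup>2 + (cons t)\<^sup>2)" .
  have "(6 * x + y)\<^sup>2 + (3 * x - 2 * y)\<^sup>2 = 45 * x\<^sup>2 + 5 * y\<^sup>2" for x y :: real
    by algebra
  from this[of "\<kappa> * ds t" "e / \<mu>"]
  have cross: "(6 * \<kappa> * ds t + e / \<mu>)\<^sup>2 \<le> 45 * \<kappa>\<^sup>2 * (ds t)\<^sup>2 + 5 * (e / \<mu>)\<^sup>2"
    using zero_le_power2[of "3 * (\<kappa> * ds t) - 2 * (e / \<mu>)"]
    unfolding mult.assoc power_mult_distrib[of \<kappa> "ds t"] by linarith
  have "5 * \<kappa> * ds t \<le> 6 * \<kappa> * ds t" using kappa_ge_1 by (simp add: ds_def)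
  then have le: "norm (Y (Suc t) - Yopt t) \<le> 6 * \<kappa> * ds t + e / \<mu>"
    "norm (Y t - Yopt t) \<le> 6 * \<kappa> * ds t + e / \<mu>"
    using Yopt_dist[of t] unfolding e_def[symmetric] by linarith+
  have "z \<le> 6 * \<kappa> * ds t + e / \<mu> \<Longrightarrow> 0 \<le> z \<Longrightarrow> z\<^sup>2 \<le> R" for z
    using power_mono[of z "6 * \<kappa> * ds t + e / \<mu>" 2] cross e2 unfolding R_def by linarith
  with le show "(norm (Y (Suc t) - Yopt t))\<^sup>2 \<le> R" "(norm (Y t - Yopt t))\<^sup>2 \<le> R" by simp_all
qed

lemma dLambda: "\<Lambda> (Suc t) - \<Lambda> t = - (\<theta> *\<^sub>R B (Y t))"
  by (simp add: \<Lambda>_Suc)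

lemma primal_descent:
  "\<P> (J (X (Suc t))) (\<Lambda> (Suc t)) - \<P> (J (X t)) (\<Lambda> t) - (J (X (Suc t)) - J (X t)) \<bullet> Dx t
    \<le> dp t * (norm (ex t) + L * cons t + L * norm (Y t - Yopt t)) + (L * \<kappa> + L / 2) * (dp t)\<^sup>2
      - (dl t)\<^sup>2 / \<theta> + L * norm (Y t - Yopt t) * dl t + L * \<kappa> * (dl t)\<^sup>2"
proof -
  define u where "u = J (X (Suc t)) - J (X t)"
  define q where "q = \<Lambda> (Suc t) - \<Lambda> t"
  define D where "D = norm (Y t - Yopt t)"
  let ?x = "J (X t)"
  have 1: "\<P> (J (X (Suc t))) (\<Lambda> (Suc t)) \<le> \<P> ?x (\<Lambda> t) + FX ?x (Yopt t) \<bullet> u + q \<bullet> B (Yopt t)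
      + (L * \<kappa> + L / 2) * (dp t)\<^sup>2 + L * \<kappa> * (dl t)\<^sup>2"
    unfolding u_def q_def dp_def dl_def Yopt_def by (rule \<P>_upper)
  have "(FX ?x (Yopt t) - Dx t) \<bullet> u \<le> norm (FX ?x (Yopt t) - Dx t) * dp t"
    unfolding dp_def u_def by (rule norm_cauchy_schwarz)
  also have "\<dots> \<le> (norm (ex t) + L * cons t + L * D) * dp t"
  proof (rule mult_right_mono)
    have eq: "FX ?x (Yopt t) - Dx t = FX ?x (Yopt t) - FX (X t) (Y t) - ex t" by (simp add: ex_def)
    have "norm (FX ?x (Yopt t) - FX (X t) (Y t)) \<le> L * (cons t + D)"
      using FX_lip_norm[of ?x "Yopt t" "X t" "Y t"] by (simp add: cons_def D_def norm_minus_commute)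
    then show "norm (FX ?x (Yopt t) - Dx t) \<le> norm (ex t) + L * cons t + L * D"
      unfolding eq using norm_triangle_ineq4[of "FX ?x (Yopt t) - FX (X t) (Y t)" "ex t"]
      by (simp add: algebra_simps)
  qed (simp add: dp_def)
  finally have 2: "FX ?x (Yopt t) \<bullet> u - u \<bullet> Dx t \<le> dp t * (norm (ex t) + L * cons t + L * D)"
    by (simp add: inner_diff_left inner_commute[of u] mult.commute)
  have "B (Y t) = - (1 / \<theta>) *\<^sub>R q" using theta by (simp add: q_def dLambda)
  then have 3: "q \<bullet> B (Y t) = - ((dl t)\<^sup>2 / \<theta>)"
    by (simp add: q_def dl_def power2_norm_eq_inner)
  have "q \<bullet> B (Yopt t - Y t) \<le> norm q * norm (B (Yopt t - Y t))" by (rule norm_cauchy_schwarz)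
  also have "\<dots> \<le> norm q * (L * norm (Yopt t - Y t))" by (intro mult_left_mono B_norm) simp
  finally have 4: "q \<bullet> B (Yopt t) \<le> q \<bullet> B (Y t) + L * D * dl t"
    by (simp add: B_diff inner_diff_right D_def q_def dl_def norm_minus_commute mult_ac)
  show ?thesis
    using 1 2 3 4 unfolding u_def[symmetric] D_def[symmetric] by linarith
qed

definition gap :: "nat \<Rightarrow> real" where
  "gap t = \<P> (J (X t)) (\<Lambda> t) - \<Phi> (J (X t)) (\<Lambda> t) (Y t)"

lemma gap_nonneg: "0 \<le> gap t"
  unfolding gap_def using \<Phi>_le_\<P>[OF Y_in] by simp

lemma gap_descent:
  "gap (Suc t) - gap t \<le> L * norm (Y (Suc t) - Yopt t) * (dp t + dl t)
    + (L * \<kappa> + L) * (dp t)\<^sup>2 + L * \<kappa> * (dl t)\<^sup>2 - 7 / 2 * L * (ds t)\<^sup>2 + (norm (ey t) + L * cons t) * ds t"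
proof -
  define u where "u = J (X (Suc t)) - J (X t)"
  define q where "q = \<Lambda> (Suc t) - \<Lambda> t"
  define s where "s = Y (Suc t) - Y t"
  define D where "D = norm (Y (Suc t) - Yopt t)"
  let ?x = "J (X t)" and ?x' = "J (X (Suc t))" and ?Y = "Y t" and ?Y' = "Y (Suc t)"
  have 1: "\<P> ?x' (\<Lambda> (Suc t)) \<le> \<P> ?x (\<Lambda> t) + FX ?x (Yopt t) \<bullet> u + q \<bullet> B (Yopt t)
      + (L * \<kappa> + L / 2) * (dp t)\<^sup>2 + L * \<kappa> * (dl t)\<^sup>2"
    unfolding u_def q_def dp_def dl_def Yopt_def by (rule \<P>_upper)
  have 2: "F ?x' ?Y' \<ge> F ?x ?Y' + FX ?x ?Y' \<bullet> u - L / 2 * (dp t)\<^sup>2"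
    using F_lower[of ?x ?Y' ?x' ?Y'] by (simp add: u_def dp_def)
  have 3: "F ?x ?Y' \<ge> F ?x ?Y + FY ?x ?Y \<bullet> s - L / 2 * (ds t)\<^sup>2"
    using F_lower[of ?x ?Y ?x ?Y'] by (simp add: s_def ds_def)
  have "H ?Y \<ge> H ?Y' + ((4 * L) *\<^sub>R (?Y - ?Y') + Dy t + B' (\<Lambda> t)) \<bullet> (?Y - ?Y')"
    using Y_Suc[OF Y_in[of t], of t] L_pos
    by (simp add: scaleR_add_right scaleR_diff_right algebra_simps)
  moreover have "((4 * L) *\<^sub>R (?Y - ?Y') + Dy t + B' (\<Lambda> t)) \<bullet> (?Y - ?Y')
      = 4 * L * (ds t)\<^sup>2 - Dy t \<bullet> s - \<Lambda> t \<bullet> B s"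
    unfolding B_adj[symmetric] ds_def s_def power2_norm_eq_inner
    by (simp add: inner_add_left inner_diff_right inner_diff_left inner_commute algebra_simps)
  ultimately have 4: "H ?Y' \<le> H ?Y - 4 * L * (ds t)\<^sup>2 + Dy t \<bullet> s + \<Lambda> t \<bullet> B s" by linarith
  have "(Dy t - FY ?x ?Y) \<bullet> s \<le> norm (Dy t - FY ?x ?Y) * ds t"
    unfolding ds_def s_def by (rule norm_cauchy_schwarz)
  also have "\<dots> \<le> (norm (ey t) + L * cons t) * ds t"
  proof (rule mult_right_mono)
    have eq: "Dy t - FY ?x ?Y = ey t + (FY (X t) ?Y - FY ?x ?Y)" by (simp add: ey_def)
    show "norm (Dy t - FY ?x ?Y) \<le> norm (ey t) + L * cons t"
      unfolding eq cons_def by (intro norm_triangle_le add_left_mono FY_lip_x)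
  qed (simp add: ds_def)
  finally have 5: "Dy t \<bullet> s - FY ?x ?Y \<bullet> s \<le> (norm (ey t) + L * cons t) * ds t"
    by (simp add: inner_diff_left)
  have "(FX ?x (Yopt t) - FX ?x ?Y') \<bullet> u \<le> norm (FX ?x (Yopt t) - FX ?x ?Y') * norm u"
    by (rule norm_cauchy_schwarz)
  also have "\<dots> \<le> L * norm (Yopt t - ?Y') * norm u" by (intro mult_right_mono FX_lip_y) simp
  finally have 6: "FX ?x (Yopt t) \<bullet> u - FX ?x ?Y' \<bullet> u \<le> L * D * dp t"
    by (simp add: inner_diff_left D_def dp_def u_def norm_minus_commute)
  have "q \<bullet> B (Yopt t - ?Y') \<le> norm q * norm (B (Yopt t - ?Y'))" by (rule norm_cauchy_schwarz)
  also have "\<dots> \<le> norm q * (L * norm (Yopt t - ?Y'))" by (intro mult_left_mono B_norm) simp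
  finally have 7: "q \<bullet> B (Yopt t) - q \<bullet> B ?Y' \<le> L * D * dl t"
    by (simp add: B_diff inner_diff_right D_def q_def dl_def norm_minus_commute mult_ac)
  have 8: "\<Lambda> (Suc t) \<bullet> B ?Y' = \<Lambda> t \<bullet> B ?Y + \<Lambda> t \<bullet> B s + q \<bullet> B ?Y'"
    by (simp add: q_def s_def B_diff inner_diff_left inner_diff_right)
  have "gap (Suc t) - gap t = \<P> ?x' (\<Lambda> (Suc t)) - \<P> ?x (\<Lambda> t)
      - (F ?x' ?Y' - F ?x ?Y) + (H ?Y' - H ?Y) - (\<Lambda> (Suc t) \<bullet> B ?Y' - \<Lambda> t \<bullet> B ?Y)"
    by (simp add: gap_def \<Phi>_def)
  also have "\<dots> \<le> L * D * dp t + L * D * dl t + (L * \<kappa> + L / 2) * (dp t)\<^sup>2 + L / 2 * (dp t)\<^sup>2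
      + L * \<kappa> * (dl t)\<^sup>2 + L / 2 * (ds t)\<^sup>2 - 4 * L * (ds t)\<^sup>2 + (norm (ey t) + L * cons t) * ds t"
    using 1 2 3 4 5 6 7 8 by linarith
  finally show ?thesis unfolding D_def by (simp add: algebra_simps)
qed

end

lemma descent_arithmetic:
  fixes c L k \<eta> \<theta> r p l s b ex ey D D' :: real
  assumes c: "1 \<le> c" and L: "0 < L" and k: "1 \<le> k" and \<eta>: "0 < \<eta>" and \<theta>: "0 < \<theta>"
    and r: "0 < r" "r \<le> 1"
    and h1: "c * \<eta> * L * k\<^sup>2 \<le> 1 / 235" and h2: "c * \<theta> * L * k\<^sup>2 \<le> 1 / 119"
    and h3: "c * \<eta> * L \<le> 3 / 1000 * r"
  defines "E \<equiv> ex\<^sup>2 + ey\<^sup>2"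
  defines "R \<equiv> 45 * k\<^sup>2 * s\<^sup>2 + 10 * k\<^sup>2 * (E / L\<^sup>2 + b\<^sup>2)"
  assumes D: "D\<^sup>2 \<le> R" "D'\<^sup>2 \<le> R"
  shows "- (p\<^sup>2 / \<eta>) + p * (ex + L * b + L * D) + (L * k + L / 2) * p\<^sup>2
      - l\<^sup>2 / \<theta> + L * D * l + L * k * l\<^sup>2
      + c * (L * D' * (p + l) + (L * k + L) * p\<^sup>2 + L * k * l\<^sup>2 - 7 / 2 * L * s\<^sup>2 + (ey + L * b) * s)
    \<le> - (7 / 20) * (p\<^sup>2 / \<eta>) - 12 / 25 * (l\<^sup>2 / \<theta>) - 9 / 5 * (c * L * s\<^sup>2)
      + 79 / 100 * (c * E / L) + 1 / 20 * (r * b\<^sup>2 / \<eta>)"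
proof -
  define Pa Q S T Z where "Pa = p\<^sup>2 / \<eta>" and "Q = l\<^sup>2 / \<theta>" and "S = c * L * s\<^sup>2"
    and "T = c * E / L" and "Z = r * b\<^sup>2 / \<eta>"
  have nn: "0 \<le> Pa" "0 \<le> Q" "0 \<le> S" "0 \<le> T" "0 \<le> Z" "0 \<le> E"
    using c L \<eta> \<theta> r by (auto simp: Pa_def Q_def S_def T_def Z_def E_def)
  have k2: "k \<le> k\<^sup>2" "1 \<le> k\<^sup>2" using k one_le_power[OF k, of 2] by (simp_all add: power2_eq_square)
  have pe: "p\<^sup>2 = \<eta> * Pa" and le: "l\<^sup>2 = \<theta> * Q" and be: "b\<^sup>2 = \<eta> * Z / r"
    using \<eta> \<theta> r by (auto simp: Pa_def Q_def Z_def)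
  have cL: "c * \<eta> * L \<le> 1 / 235"
    using order_trans[OF mult_left_mono[OF k2(2), of "c * \<eta> * L"] h1] c \<eta> L by simp
  have cLk: "c * \<eta> * L * k \<le> 1 / 235"
    using order_trans[OF mult_left_mono[OF k2(1), of "c * \<eta> * L"] h1] c \<eta> L by simp
  have cLkt: "c * \<theta> * L * k \<le> 1 / 119"
    using order_trans[OF mult_left_mono[OF k2(1), of "c * \<theta> * L"] h2] c \<theta> L by simp
  have e1: "\<eta> * L \<le> c * \<eta> * L" using mult_right_mono[OF c, of "\<eta> * L"] \<eta> L by simp
  have cLb: "c * L * b\<^sup>2 \<le> 3 / 1000 * Z"
  proof -
    have "c * L * b\<^sup>2 = (c * \<eta> * L) * (Z / r)" by (simp add: be)
    also have "\<dots> \<le> (3 / 1000 * r) * (Z / r)" using h3 nn r by (intro mult_right_mono) auto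
    finally show ?thesis using r by simp
  qed
  have eE: "\<eta> * E \<le> T / 235"
  proof -
    have "\<eta> * E = (\<eta> * L) * (E / L)" using L by simp
    also have "\<dots> \<le> (1 / 235) * (E / L)"
      using e1 cL nn L by (intro mult_right_mono) auto
    also have "E / L \<le> T" using c L nn unfolding T_def
      by (intro divide_right_mono) (auto intro: mult_right_mono[of 1 c E, simplified])
    finally show ?thesis by simp
  qed
  have "p * ex \<le> 1 / (16 * \<eta>) * p\<^sup>2 + ex\<^sup>2 / (4 * (1 / (16 * \<eta>)))" by (rule young) (use \<eta> in simp)
  also have "\<dots> = Pa / 16 + 4 * (\<eta> * ex\<^sup>2)" using \<eta> by (simp add: Pa_def)
  also have "\<eta> * ex\<^sup>2 \<le> \<eta> * E" using \<eta> by (simp add: E_def)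
  finally have f1: "p * ex \<le> Pa / 16 + 4 / 235 * T" using eE by simp
  have "p * (L * b) \<le> 1 / (16 * \<eta>) * p\<^sup>2 + (L * b)\<^sup>2 / (4 * (1 / (16 * \<eta>)))"
    by (rule young) (use \<eta> in simp)
  also have "\<dots> = Pa / 16 + 4 * (\<eta> * L * (L * b\<^sup>2))" using \<eta> by (simp add: Pa_def power2_eq_square)
  also have "\<eta> * L * (L * b\<^sup>2) \<le> 1 / 235 * (c * L * b\<^sup>2)"
    using e1 cL L c by (intro mult_mono) (auto intro: mult_right_mono[of 1 c "L * b\<^sup>2", simplified])
  finally have f2: "p * (L * b) \<le> Pa / 16 + 1 / 1000 * Z" using cLb nn by simp
  have young_D: "c' * (L * d) * z \<le> 1 / (4 * h) * z\<^sup>2 + c\<^sup>2 * h * L\<^sup>2 * R"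
    if "0 \<le> c'" "c' \<le> c" "0 < h" "d\<^sup>2 \<le> R" for c' d z h :: real
  proof -
    have "z * (c' * (L * d)) \<le> 1 / (4 * h) * z\<^sup>2 + (c' * (L * d))\<^sup>2 / (4 * (1 / (4 * h)))"
      by (rule young) (use that in simp)
    also have "(c' * (L * d))\<^sup>2 / (4 * (1 / (4 * h))) = c'\<^sup>2 * (h * L\<^sup>2 * d\<^sup>2)"
      using that by (simp add: power_mult_distrib)
    also have "\<dots> \<le> c\<^sup>2 * (h * L\<^sup>2 * R)"
      using that L by (intro mult_mono power_mono) auto
    finally show ?thesis by (simp add: mult_ac)
  qed
  have Rb: "c\<^sup>2 * h * L\<^sup>2 * R \<le> w * (45 * S + 10 * T + 3 / 100 * Z)"
    if "c * h * L * k\<^sup>2 \<le> w" "0 < h" for h w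
  proof -
    have "c\<^sup>2 * h * L\<^sup>2 * R = (c * h * L * k\<^sup>2) * (45 * S + 10 * T + 10 * (c * L * b\<^sup>2))"
      using L by (simp add: R_def S_def T_def power2_eq_square field_simps)
    also have "\<dots> \<le> w * (45 * S + 10 * T + 10 * (c * L * b\<^sup>2))"
      using that c L nn by (intro mult_right_mono) (auto intro!: add_nonneg_nonneg)
    also have "\<dots> \<le> w * (45 * S + 10 * T + 3 / 100 * Z)"
      using that c L cLb order_trans[OF _ that(1), of 0] by (intro mult_left_mono) auto
    finally show ?thesis .
  qed
  have young_R: "c' * (L * d) * z \<le> 1 / (4 * h) * z\<^sup>2 + w * (45 * S + 10 * T + 3 / 100 * Z)"
    if "0 \<le> c'" "c' \<le> c" "0 < h" "d\<^sup>2 \<le> R" "c * h * L * k\<^sup>2 \<le> w" for c' d z h w :: real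
    using young_D[OF that(1-4), of z] Rb[OF that(5,3)] by linarith
  have f3: "p * (L * D) \<le> Pa / 4 + 1 / 235 * (45 * S + 10 * T + 3 / 100 * Z)"
    using young_R[OF _ c \<eta> D(1) h1, of p] by (simp add: Pa_def mult_ac)
  have f4: "c * (L * D' * p) \<le> Pa / 4 + 1 / 235 * (45 * S + 10 * T + 3 / 100 * Z)"
    using young_R[OF _ order_refl \<eta> D(2) h1, of p] c by (simp add: Pa_def mult_ac)
  have f5: "L * D * l \<le> Q / 4 + 1 / 119 * (45 * S + 10 * T + 3 / 100 * Z)"
    using young_R[OF _ c \<theta> D(1) h2, of l] by (simp add: Q_def mult_ac)
  have f6: "c * (L * D' * l) \<le> Q / 4 + 1 / 119 * (45 * S + 10 * T + 3 / 100 * Z)"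
    using young_R[OF _ order_refl \<theta> D(2) h2, of l] c by (simp add: Q_def mult_ac)
  have f9: "(L * k + L / 2) * p\<^sup>2 + c * ((L * k + L) * p\<^sup>2) \<le> 7 / 2 / 235 * Pa"
  proof -
    have "L \<le> L * k" using L k by simp
    moreover have "L * k \<le> c * (L * k)" using c L k by simp
    ultimately have "(L * k + L / 2) + c * (L * k + L) \<le> 7 / 2 * (c * L * k)"
      using c mult_left_mono[of L "L * k" c] unfolding distrib_left mult.assoc by linarith
    then have "((L * k + L / 2) + c * (L * k + L)) * p\<^sup>2 \<le> 7 / 2 * (c * L * k) * p\<^sup>2"
      by (rule mult_right_mono) simp
    also have "\<dots> = 7 / 2 * ((c * \<eta> * L * k) * Pa)" by (simp add: pe)
    also have "\<dots> \<le> 7 / 2 * (1 / 235 * Pa)" using cLk nn by (intro mult_left_mono mult_right_mono) auto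
    finally show ?thesis by (simp add: algebra_simps)
  qed
  have f10: "L * k * l\<^sup>2 + c * (L * k * l\<^sup>2) \<le> 2 / 119 * Q"
  proof -
    have "L * k * l\<^sup>2 \<le> c * (L * k * l\<^sup>2)" using c L k mult_right_mono[of 1 c "L * k * l\<^sup>2"] by simp
    also have "\<dots> = (c * \<theta> * L * k) * Q" by (simp add: le)
    also have "\<dots> \<le> 1 / 119 * Q" using cLkt nn by (intro mult_right_mono) auto
    finally have "c * (L * k * l\<^sup>2) \<le> 1 / 119 * Q" "L * k * l\<^sup>2 \<le> 1 / 119 * Q"
      using \<open>L * k * l\<^sup>2 \<le> c * (L * k * l\<^sup>2)\<close> \<open>c * (L * k * l\<^sup>2) = _\<close> \<open>c * \<theta> * L * k * Q \<le> _\<close> by linarith+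
    then show ?thesis by simp
  qed
  have f11: "c * (ey * s) \<le> T / 2 + S / 2"
  proof -
    have "s * ey \<le> L / 2 * s\<^sup>2 + ey\<^sup>2 / (4 * (L / 2))" by (rule young) (use L in simp)
    then have "ey * s \<le> L / 2 * s\<^sup>2 + ey\<^sup>2 / (2 * L)" by (simp add: mult.commute)
    also have "ey\<^sup>2 / (2 * L) \<le> E / (2 * L)" using L by (intro divide_right_mono) (auto simp: E_def)
    finally have "c * (ey * s) \<le> c * (L / 2 * s\<^sup>2 + E / (2 * L))" using c by (intro mult_left_mono) auto
    also have "\<dots> = T / 2 + S / 2" by (simp add: T_def S_def algebra_simps)
    finally show ?thesis .
  qed
  have f12: "c * (L * b * s) \<le> S / 40 + 3 / 100 * Z"
  proof -
    have "s * b \<le> 1 / 40 * s\<^sup>2 + b\<^sup>2 / (4 * (1 / 40))" by (rule young) simp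
    then have "(c * L) * (s * b) \<le> (c * L) * (1 / 40 * s\<^sup>2 + b\<^sup>2 / (4 * (1 / 40)))"
      using c L by (intro mult_left_mono) auto
    also have "\<dots> = S / 40 + 10 * (c * L * b\<^sup>2)" by (simp add: S_def algebra_simps)
    finally show ?thesis using cLb by (simp add: mult_ac)
  qed
  have "- Pa + p * (ex + L * b + L * D) + (L * k + L / 2) * p\<^sup>2
      - Q + L * D * l + L * k * l\<^sup>2
      + c * (L * D' * (p + l) + (L * k + L) * p\<^sup>2 + L * k * l\<^sup>2 - 7 / 2 * L * s\<^sup>2 + (ey + L * b) * s)
    = - Pa - Q - 7 / 2 * S + p * ex + p * (L * b) + p * (L * D) + c * (L * D' * p)
      + L * D * l + c * (L * D' * l)
      + ((L * k + L / 2) * p\<^sup>2 + c * ((L * k + L) * p\<^sup>2)) + (L * k * l\<^sup>2 + c * (L * k * l\<^sup>2))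
      + c * (ey * s) + c * (L * b * s)"
    by (simp add: S_def algebra_simps)
  also have "\<dots> \<le> - (7 / 20) * Pa - 12 / 25 * Q - 9 / 5 * S + 79 / 100 * T + 1 / 20 * Z"
    using f1 f2 f3 f4 f5 f6 f9 f10 f11 f12 nn by argo
  finally show ?thesis unfolding Pa_def Q_def S_def T_def Z_def .
qed

lemma square_divide_self: "z \<noteq> 0 \<Longrightarrow> z\<^sup>2 / c / z = z / (c::real)"
  by (simp add: power2_eq_square)

context vrlm_path
begin

lemma eta_L_le: "\<eta> * L \<le> r\<^sup>2 / 360"
proof -
  have "\<eta> * L * 1 \<le> \<eta> * L * \<kappa>" using kappa_ge_1 eta(1) L_pos by (intro mult_left_mono) auto
  with eta(2) show ?thesis by linarith
qed

lemma weight_ge_1: "1 \<le> weight" and weight_pos: "0 < weight"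
proof -
  have "0 \<le> 10 * (\<eta> * L) / r ^ 3" using eta L_pos r by simp
  then show "1 \<le> weight" "0 < weight" unfolding weight_def by linarith+
qed

lemma weight_mult: "weight * z \<le> z + 10 * (w / r)"
  if "\<eta> * L * z \<le> r\<^sup>2 * w"
proof -
  have "10 * (\<eta> * L) / r ^ 3 * z = 10 * (\<eta> * L * z) / r ^ 3" by simp
  also have "\<dots> \<le> 10 * (r\<^sup>2 * w) / r ^ 3" using that r by (intro divide_right_mono mult_left_mono) auto
  also have "\<dots> = 10 * (w / r)" using r by (simp add: power2_eq_square power3_eq_cube)
  finally show ?thesis by (simp add: weight_def algebra_simps)
qed

lemma weight_bounds:
  shows "weight * \<eta> * L * \<kappa>\<^sup>2 \<le> 1 / 235" and "weight * \<theta> * L * \<kappa>\<^sup>2 \<le> 1 / 119"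
    and "weight * \<eta> * L \<le> 3 / 1000 * r"
proof -
  have k: "0 \<le> \<eta> * L * \<kappa>" "0 \<le> \<theta> * L * \<kappa>" "0 \<le> \<eta> * L"
    using eta theta L_pos kappa_ge_1 by auto
  have r2: "r\<^sup>2 \<le> r" using r by (simp add: power2_eq_square mult_left_le)
  have "\<eta> * L * (\<eta> * L * \<kappa>\<^sup>2) = (\<eta> * L * \<kappa>) * (\<eta> * L * \<kappa>)" by (simp add: power2_eq_square)
  also have "\<dots> \<le> (r\<^sup>2 / 360) * (r\<^sup>2 / 360)" using eta k by (intro mult_mono) auto
  finally have "weight * (\<eta> * L * \<kappa>\<^sup>2) \<le> \<eta> * L * \<kappa>\<^sup>2 + 10 * (r\<^sup>2 / 129600 / r)"
    by (intro weight_mult) simp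
  also have "r\<^sup>2 / 129600 / r = r / 129600" using r by (intro square_divide_self) simp
  finally show "weight * \<eta> * L * \<kappa>\<^sup>2 \<le> 1 / 235"
    using eta(3) r unfolding mult.assoc by argo
  have "\<eta> * L * (\<theta> * L * \<kappa>\<^sup>2) = (\<eta> * L * \<kappa>) * (\<theta> * L * \<kappa>)" by (simp add: power2_eq_square)
  also have "\<dots> \<le> (r\<^sup>2 / 360) * (r\<^sup>2 / 25)" using eta theta k by (intro mult_mono) auto
  finally have "weight * (\<theta> * L * \<kappa>\<^sup>2) \<le> \<theta> * L * \<kappa>\<^sup>2 + 10 * (r\<^sup>2 / 9000 / r)"
    by (intro weight_mult) simp
  also have "r\<^sup>2 / 9000 / r = r / 9000" using r by (intro square_divide_self) simp
  finally show "weight * \<theta> * L * \<kappa>\<^sup>2 \<le> 1 / 119" using theta(3) r unfolding mult.assoc by argo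
  have "\<eta> * L * (\<eta> * L) \<le> (r\<^sup>2 / 360) * (r\<^sup>2 / 360)" using eta_L_le k by (intro mult_mono) auto
  then have "weight * (\<eta> * L) \<le> \<eta> * L + 10 * (r\<^sup>2 / 129600 / r)"
    by (intro weight_mult) simp
  also have "r\<^sup>2 / 129600 / r = r / 129600" using r by (intro square_divide_self) simp
  finally show "weight * \<eta> * L \<le> 3 / 1000 * r"
    using eta_L_le r2 r unfolding mult.assoc by argo
qed

lemma X_step_sq: "(norm (X (Suc t) - X t))\<^sup>2 \<le> (dp t)\<^sup>2 + 2 * (cons (Suc t))\<^sup>2 + 2 * (cons t)\<^sup>2"
proof -
  let ?x = "X (Suc t) - X t"
  have "(norm ?x)\<^sup>2 = (norm (?x - J ?x))\<^sup>2 + (norm (J ?x))\<^sup>2" by (rule norm_sq_split)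
  moreover have "norm (?x - J ?x) \<le> cons (Suc t) + cons t"
  proof -
    have "?x - J ?x = (X (Suc t) - J (X (Suc t))) - (X t - J (X t))" by (simp add: J_diff)
    then show ?thesis unfolding cons_def by (metis norm_triangle_ineq4)
  qed
  then have "(norm (?x - J ?x))\<^sup>2 \<le> (cons (Suc t) + cons t)\<^sup>2" by (intro power_mono) auto
  ultimately show ?thesis
    using power2_sum2_le[of "cons (Suc t)" "cons t"] by (simp add: dp_def J_diff)
qed

lemma Dx_step_sq:
  "(norm (Dx (Suc t) - Dx t))\<^sup>2 \<le> 3 * (Er (Suc t) + Er t)
    + 3 * L\<^sup>2 * ((norm (X (Suc t) - X t))\<^sup>2 + (ds t)\<^sup>2)"
proof -
  let ?g = "FX (X (Suc t)) (Y (Suc t)) - FX (X t) (Y t)"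
  have "Dx (Suc t) - Dx t = ?g + ex (Suc t) - ex t" by (simp add: ex_def)
  then have "norm (Dx (Suc t) - Dx t) \<le> norm ?g + norm (ex (Suc t)) + norm (ex t)"
    by (metis norm_triangle_le_diff norm_triangle_ineq add_right_mono)
  then have "(norm (Dx (Suc t) - Dx t))\<^sup>2 \<le> (norm ?g + norm (ex (Suc t)) + norm (ex t))\<^sup>2"
    by (intro power_mono) auto
  also have "\<dots> \<le> 3 * ((norm ?g)\<^sup>2 + (norm (ex (Suc t)))\<^sup>2 + (norm (ex t))\<^sup>2)"
    by (rule power2_sum3_le)
  also have "\<dots> \<le> 3 * (L\<^sup>2 * ((norm (X (Suc t) - X t))\<^sup>2 + (ds t)\<^sup>2) + Er (Suc t) + Er t)"
    unfolding ds_def Er_def by (intro mult_left_mono add_mono FX_lip) auto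
  finally show ?thesis by (simp add: algebra_simps)
qed

definition lyap :: "nat \<Rightarrow> real" where
  "lyap t = \<P> (J (X t)) (\<Lambda> t) + G (J (X t)) + weight * gap t
    + \<rho> / (2 * \<eta>) * (cons t)\<^sup>2 + \<eta> / r\<^sup>2 * (vperp t)\<^sup>2"

definition progress :: "nat \<Rightarrow> real" where
  "progress t = 1 / 3 * ((dp t)\<^sup>2 / \<eta>) + 12 / 25 * ((dl t)\<^sup>2 / \<theta>) + 3 / 2 * (weight * L * (ds t)\<^sup>2)
    + 9 / 20 * (r * (cons (Suc t))\<^sup>2 / \<eta>) + \<eta> * (vperp t)\<^sup>2 / (2 * r)"

lemma lyap_step:
  "lyap (Suc t) + progress t \<le> lyap t + 51 / 1000 * (r * (cons t)\<^sup>2 / \<eta>)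
    + weight / L * (109 / 100 * Er t + 3 / 10 * Er (Suc t))"
proof -
  define p l s a b v E E' where "p = dp t" and "l = dl t" and "s = ds t" and "a = cons (Suc t)"
    and "b = cons t" and "v = vperp t" and "E = Er t" and "E' = Er (Suc t)"
  note defs = p_def l_def s_def a_def b_def v_def E_def E'_def
  have nn: "0 \<le> E" "0 \<le> E'" by (auto simp: E_def E'_def Er_def)
  have 1: "\<P> (J (X (Suc t))) (\<Lambda> (Suc t)) + G (J (X (Suc t))) - \<P> (J (X t)) (\<Lambda> t) - G (J (X t))
      + weight * (gap (Suc t) - gap t)
    \<le> - (7 / 20) * (p\<^sup>2 / \<eta>) - 12 / 25 * (l\<^sup>2 / \<theta>) - 9 / 5 * (weight * L * s\<^sup>2)
      + 79 / 100 * (weight * E / L) + 1 / 20 * (r * b\<^sup>2 / \<eta>)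
      - a\<^sup>2 / \<eta> + \<rho> / \<eta> * (a * b) + a * v"
    using descent_arithmetic[OF weight_ge_1 L_pos kappa_ge_1 eta(1) theta(1) r weight_bounds
        Yopt_dist_sq(2)[of t, unfolded Er_def] Yopt_dist_sq(1)[of t, unfolded Er_def], of p l]
      mult_left_mono[OF gap_descent[of t], of weight] weight_pos primal_descent[of t]
      consensus_descent[of t]
    unfolding defs Er_def[of t] by linarith
  have "a * v \<le> r / (2 * \<eta>) * a\<^sup>2 + v\<^sup>2 / (4 * (r / (2 * \<eta>)))" by (rule young) (use r eta in simp)
  moreover have "z / (2 * \<eta>) * a\<^sup>2 + v\<^sup>2 / (4 * (z / (2 * \<eta>)))
      = 1 / 2 * (z * a\<^sup>2 / \<eta>) + \<eta> * v\<^sup>2 / (2 * z)" if "z > 0" for z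
    using that eta by (simp add: field_simps)
  ultimately have 2: "a * v \<le> 1 / 2 * (r * a\<^sup>2 / \<eta>) + \<eta> * v\<^sup>2 / (2 * r)"
    using r(1) by metis
  have "\<rho> / (2 * \<eta>) * (2 * a * b) \<le> \<rho> / (2 * \<eta>) * (a\<^sup>2 + b\<^sup>2)"
    using rho eta by (intro mult_left_mono sum_squares_bound) auto
  then have 3: "\<rho> / \<eta> * (a * b) \<le> \<rho> / (2 * \<eta>) * a\<^sup>2 + \<rho> / (2 * \<eta>) * b\<^sup>2"
    unfolding distrib_left by simp
  have 4: "a\<^sup>2 / \<eta> = 2 * (\<rho> / (2 * \<eta>) * a\<^sup>2) + r * a\<^sup>2 / \<eta>"
    using eta by (simp add: field_simps)
  define d where "d = (norm (Dx (Suc t) - Dx t))\<^sup>2"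
  have "\<eta> / r\<^sup>2 * (vperp (Suc t))\<^sup>2 \<le> \<eta> / r\<^sup>2 * (\<rho> * v\<^sup>2 + d / r)"
    unfolding v_def d_def using eta r by (intro mult_left_mono V_perp_step) auto
  also have "\<dots> = \<eta> / r\<^sup>2 * v\<^sup>2 - \<eta> * v\<^sup>2 / r + \<eta> / r ^ 3 * d"
  proof -
    have "\<eta> / z\<^sup>2 * ((1 - z) * v\<^sup>2 + d / z) = \<eta> / z\<^sup>2 * v\<^sup>2 - \<eta> * v\<^sup>2 / z + \<eta> / z ^ 3 * d"
      if "z \<noteq> 0" for z using that by (simp add: field_simps power2_eq_square power3_eq_cube)
    from this[of r] show ?thesis using r(1) by simp
  qed
  finally have 5: "\<eta> / r\<^sup>2 * (vperp (Suc t))\<^sup>2 \<le> \<eta> / r\<^sup>2 * v\<^sup>2 - \<eta> * v\<^sup>2 / r + \<eta> / r ^ 3 * d" .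
  have "d \<le> 3 * (E' + E) + 3 * L\<^sup>2 * ((norm (X (Suc t) - X t))\<^sup>2 + s\<^sup>2)"
    unfolding d_def defs by (rule Dx_step_sq)
  also have "\<dots> \<le> 3 * (E' + E) + 3 * L\<^sup>2 * ((p\<^sup>2 + 2 * a\<^sup>2 + 2 * b\<^sup>2) + s\<^sup>2)"
    unfolding defs by (intro add_mono mult_left_mono X_step_sq) auto
  finally have "\<eta> / r ^ 3 * d
      \<le> \<eta> / r ^ 3 * (3 * (E' + E) + 3 * L\<^sup>2 * ((p\<^sup>2 + 2 * a\<^sup>2 + 2 * b\<^sup>2) + s\<^sup>2))"
    using eta r by (intro mult_left_mono) auto
  also have "\<dots> = 3 * (\<eta> / r ^ 3 * (E' + E)) + 3 * (\<eta> / r ^ 3 * (L\<^sup>2 * s\<^sup>2))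
      + 3 * (\<eta> / r ^ 3 * (L\<^sup>2 * p\<^sup>2)) + 6 * (\<eta> / r ^ 3 * (L\<^sup>2 * a\<^sup>2)) + 6 * (\<eta> / r ^ 3 * (L\<^sup>2 * b\<^sup>2))"
  proof -
    have "z * (3 * (E' + E) + 3 * L\<^sup>2 * ((p\<^sup>2 + 2 * a\<^sup>2 + 2 * b\<^sup>2) + s\<^sup>2))
      = 3 * (z * (E' + E)) + 3 * (z * (L\<^sup>2 * s\<^sup>2)) + 3 * (z * (L\<^sup>2 * p\<^sup>2))
        + 6 * (z * (L\<^sup>2 * a\<^sup>2)) + 6 * (z * (L\<^sup>2 * b\<^sup>2))" for z
      by (simp add: algebra_simps)
    then show ?thesis .
  qed
  finally have 6: "\<eta> / r ^ 3 * d \<le> \<dots>" .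
  have w: "\<eta> / r ^ 3 \<le> weight / (10 * L)"
    using L_pos by (simp add: weight_def field_simps)
  have 7: "\<eta> / r ^ 3 * (E' + E) \<le> 1 / 10 * (weight * E' / L) + 1 / 10 * (weight * E / L)"
    using mult_right_mono[OF w, of "E' + E"] nn by (simp add: distrib_left add_divide_distrib)
  have 8: "\<eta> / r ^ 3 * (L\<^sup>2 * s\<^sup>2) \<le> 1 / 10 * (weight * L * s\<^sup>2)"
    using mult_right_mono[OF w, of "L\<^sup>2 * s\<^sup>2"] L_pos by (simp add: power2_eq_square field_simps)
  have small: "\<eta> / r ^ 3 * L\<^sup>2 \<le> r / (129600 * \<eta>)"
  proof -
    have "(\<eta> * L)\<^sup>2 \<le> (r\<^sup>2 / 360)\<^sup>2" using eta_L_le eta L_pos by (intro power_mono) auto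
    also have "\<dots> = r ^ 3 * r / 129600" by (simp add: power_divide power2_eq_square power3_eq_cube)
    finally have "(\<eta> * L)\<^sup>2 * (1 / (\<eta> * r ^ 3)) \<le> r ^ 3 * r / 129600 * (1 / (\<eta> * r ^ 3))"
      using eta r by (intro mult_right_mono) auto
    then show ?thesis using eta r by (simp add: power_mult_distrib power2_eq_square mult_ac)
  qed
  have 9: "\<eta> / r ^ 3 * (L\<^sup>2 * z\<^sup>2) \<le> 1 / 129600 * (r * z\<^sup>2 / \<eta>)" for z
    using mult_right_mono[OF small, of "z\<^sup>2"] by (simp add: mult.assoc)
  have 10: "r * p\<^sup>2 / \<eta> \<le> p\<^sup>2 / \<eta>"
    using r eta by (intro divide_right_mono) (auto simp: mult_left_le_one_le)
  have nn2: "0 \<le> p\<^sup>2 / \<eta>" "0 \<le> weight * L * s\<^sup>2" "0 \<le> weight * E / L" "0 \<le> weight * E' / L"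
      "0 \<le> r * a\<^sup>2 / \<eta>" "0 \<le> r * b\<^sup>2 / \<eta>"
    using eta L_pos weight_pos nn r by auto
  have "x / z = x / (2 * z) + x / (2 * z)" for x z :: real by simp
  from this[of "\<eta> * v\<^sup>2" r] have "lyap (Suc t) - lyap t + progress t
    \<le> 51 / 1000 * (r * b\<^sup>2 / \<eta>) + 109 / 100 * (weight * E / L) + 3 / 10 * (weight * E' / L)"
    using 1 2 3 4 5 6 7 8 9[of p] 9[of a] 9[of b] 10 nn2
    unfolding lyap_def progress_def defs[symmetric] right_diff_distrib by linarith
  then show ?thesis unfolding defs by (simp add: algebra_simps)
qed

lemma lyap_lower:
  assumes "\<And>x l. x \<in> C \<Longrightarrow> J x = x \<Longrightarrow> \<P> x l + G x \<ge> m"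
  shows "lyap t \<ge> m"
proof -
  have "\<P> (J (X t)) (\<Lambda> t) + G (J (X t)) \<ge> m" by (intro assms G_J X_in J_idem)
  moreover have "0 \<le> weight * gap t" using weight_pos gap_nonneg by simp
  moreover have "0 \<le> \<rho> / (2 * \<eta>) * (cons t)\<^sup>2" "0 \<le> \<eta> / r\<^sup>2 * (vperp t)\<^sup>2"
    using rho eta by auto
  ultimately show ?thesis unfolding lyap_def by linarith
qed

lemma stationarity_x:
  assumes q: "q \<in> C" "\<And>x. x \<in> C \<Longrightarrow> G x \<ge> G q
    + (1 / \<eta>) *\<^sub>R (J (X t) - \<eta> *\<^sub>R J (FX (J (X t)) (Yopt t)) - q) \<bullet> (x - q)"
  shows "norm (J (X t) - q) \<le> dp t + cons (Suc t) + cons t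
    + \<eta> * (vperp t + norm (ex t) + L * cons t + L * norm (Y t - Yopt t))"
proof -
  let ?x = "X (Suc t)" and ?J = "J (X t)" and ?g = "J (FX (J (X t)) (Yopt t))"
  define d where "d = (W (X t) - \<eta> *\<^sub>R V t) - (?J - \<eta> *\<^sub>R ?g)"
  have "0 \<le> \<eta> * (((1 / \<eta>) *\<^sub>R (W (X t) - \<eta> *\<^sub>R V t - ?x) - (1 / \<eta>) *\<^sub>R (?J - \<eta> *\<^sub>R ?g - q)) \<bullet> (?x - q))"
    using X_Suc[OF q(1), of t] q(2)[OF X_in[of "Suc t"]] eta
    by (intro mult_nonneg_nonneg) (auto simp: inner_diff_left inner_diff_right)
  also have "\<dots> = (d - (?x - q)) \<bullet> (?x - q)"
    using eta unfolding inner_diff_left inner_scaleR_left d_def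
    by (simp add: field_simps inner_diff_left inner_diff_right)
  finally have "norm (?x - q) * norm (?x - q) \<le> d \<bullet> (?x - q)"
    by (simp add: inner_diff_left power2_norm_eq_inner[unfolded power2_eq_square])
  also have "\<dots> \<le> norm d * norm (?x - q)" by (rule norm_cauchy_schwarz)
  finally have xq: "norm (?x - q) \<le> norm d" by (cases "?x = q") auto
  have gx: "norm (J (V t) - ?g) \<le> norm (ex t) + L * cons t + L * norm (Y t - Yopt t)"
  proof -
    have "J (V t) - ?g = J (ex t + (FX (X t) (Y t) - FX ?J (Yopt t)))"
      by (simp add: J_V J_diff[symmetric] ex_def)
    also have "norm \<dots> \<le> norm (ex t + (FX (X t) (Y t) - FX ?J (Yopt t)))" by (rule norm_J_le)
    also have "\<dots> \<le> norm (ex t) + L * (cons t + norm (Y t - Yopt t))"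
      unfolding cons_def by (intro norm_triangle_le add_left_mono FX_lip_norm)
    finally show ?thesis by (simp add: algebra_simps)
  qed
  have "d = (W (X t) - ?J) - \<eta> *\<^sub>R ((V t - J (V t)) + (J (V t) - ?g))"
    by (simp add: d_def algebra_simps)
  then have "norm d \<le> norm (W (X t) - ?J) + \<eta> * norm ((V t - J (V t)) + (J (V t) - ?g))"
    using eta norm_triangle_ineq4 by (metis abs_of_pos norm_scaleR)
  also have "\<dots> \<le> \<rho> * cons t + \<eta> * (vperp t + norm (J (V t) - ?g))"
    using W_gap[of "X t"] eta unfolding cons_def vperp_def
    by (intro add_mono mult_left_mono norm_triangle_ineq) auto
  also have "\<dots> \<le> cons t + \<eta> * (vperp t + (norm (ex t) + L * cons t + L * norm (Y t - Yopt t)))"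
    using rho eta gx mult_right_mono[of \<rho> 1 "cons t"]
    by (intro add_mono mult_left_mono) (auto simp: cons_def)
  finally have "norm d \<le> cons t + \<eta> * (vperp t + norm (ex t) + L * cons t + L * norm (Y t - Yopt t))"
    by (simp add: add.assoc)
  moreover have "norm (?J - q) \<le> norm (J ?x - ?J) + norm (?x - J ?x) + norm (?x - q)"
  proof -
    have "?J - q = (?x - q) - ((J ?x - ?J) + (?x - J ?x))" by simp
    then have "norm (?J - q) \<le> norm (?x - q) + norm ((J ?x - ?J) + (?x - J ?x))"
      by (metis norm_triangle_ineq4)
    then show ?thesis using norm_triangle_ineq[of "J ?x - ?J" "?x - J ?x"] by linarith
  qed
  ultimately show ?thesis using xq by (simp add: dp_def cons_def)
qed

lemma stationarity_\<Lambda>: "norm (B (Yopt t)) \<le> dl t / \<theta> + L * norm (Y t - Yopt t)"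
proof -
  have "B (Yopt t) = B (Y t) - B (Y t - Yopt t)" by (simp add: B_diff)
  then have "norm (B (Yopt t)) \<le> norm (B (Y t)) + norm (B (Y t - Yopt t))"
    by (metis norm_triangle_ineq4)
  also have "norm (B (Y t)) = dl t / \<theta>" using theta by (simp add: dl_def dLambda)
  finally show ?thesis using B_norm[of "Y t - Yopt t"] by linarith
qed

end

section \<open>Matrices with agents as rows\<close>

lemma norm_sq_rows: "(norm A)\<^sup>2 = (\<Sum>i\<in>UNIV. (norm (A $ i))\<^sup>2)" for A :: "('a::real_inner)^'m::finite"
  unfolding power2_norm_eq_inner inner_vec_def ..

lemma row_mean_inner: "row_mean X \<bullet> u = (1 / real CARD('m)) * (\<Sum>i\<in>UNIV. X $ i \<bullet> u)"
  for X :: "real^'d^'m"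
  by (simp add: row_mean_def inner_sum_left)

lemma all_rows_inner: "all_rows u \<bullet> X = real CARD('m) * (u \<bullet> row_mean X)" for X :: "real^'d^'m"
  unfolding inner_vec_def[of "all_rows u"] inner_commute[of u] row_mean_inner
  by (simp add: all_rows_def inner_commute)

lemma norm_all_rows: "(norm (all_rows u :: real^'d^'m))\<^sup>2 = real CARD('m) * (norm u)\<^sup>2"
  unfolding norm_sq_rows by (simp add: all_rows_def)

lemma all_rows_diff: "all_rows (u - v) = all_rows u - all_rows v"
  and all_rows_scaleR: "all_rows (c *\<^sub>R u) = c *\<^sub>R all_rows u"
  and all_rows_add: "all_rows (u + v) = all_rows u + all_rows v"
  by (simp_all add: all_rows_def vec_eq_iff)

lemma row_mean_all_rows: "row_mean (all_rows u :: real^'d^'m) = u"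
  by (simp add: row_mean_def all_rows_def sum_constant_scaleR del: sum_constant)

lemma linear_row_mean: "linear row_mean"
  by (rule linearI) (simp_all add: row_mean_def sum.distrib scaleR_right.sum scaleR_add_right mult.commute)

lemma linear_all_rows: "linear all_rows"
  by (rule linearI) (simp_all add: all_rows_add all_rows_scaleR)

lemma linear_matrix_matrix_mult: "linear (\<lambda>X :: real^'d^'n. (A :: real^'n^'m) ** X)"
  by (rule linearI)
    (simp_all add: matrix_matrix_mult_def vec_eq_iff sum.distrib distrib_left sum_distrib_left mult.left_commute)

lemma matrix_matrix_mult_adjoint:
  fixes A :: "real^'n^'m" and Y :: "real^'d^'n" and l :: "real^'d^'m"
  shows "(transpose A ** l) \<bullet> Y = l \<bullet> (A ** Y)"
proof -
  have "(transpose A ** l) \<bullet> Y = (\<Sum>i\<in>UNIV. \<Sum>j\<in>UNIV. \<Sum>k\<in>UNIV. A$k$i * l$k$j * Y$i$j)"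
    by (simp add: inner_vec_def matrix_matrix_mult_def transpose_def sum_distrib_right)
  also have "\<dots> = (\<Sum>j\<in>UNIV. \<Sum>i\<in>UNIV. \<Sum>k\<in>UNIV. A$k$i * l$k$j * Y$i$j)"
    by (rule sum.swap)
  also have "\<dots> = (\<Sum>j\<in>UNIV. \<Sum>k\<in>UNIV. \<Sum>i\<in>UNIV. A$k$i * l$k$j * Y$i$j)"
    by (intro sum.cong refl sum.swap)
  also have "\<dots> = (\<Sum>k\<in>UNIV. \<Sum>j\<in>UNIV. \<Sum>i\<in>UNIV. A$k$i * l$k$j * Y$i$j)"
    by (rule sum.swap)
  also have "\<dots> = l \<bullet> (A ** Y)"
    by (simp add: inner_vec_def matrix_matrix_mult_def sum_distrib_left mult_ac)
  finally show ?thesis .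
qed

lemma norm_matrix_matrix_mult_le:
  fixes A :: "real^'n^'m" and X :: "real^'d^'n"
  shows "norm (A ** X) \<le> spectral_norm A * norm X"
proof (rule power2_le_imp_le)
  have bl: "bounded_linear ((*v) A)" by (rule matrix_vector_mul_bounded_linear)
  have cols: "(norm Z)\<^sup>2 = (\<Sum>j\<in>UNIV. (norm (\<chi> i. Z$i$j))\<^sup>2)" for Z :: "real^'d^'k"
    unfolding norm_sq_rows by (simp add: norm_sq_rows) (rule sum.swap)
  have col: "(\<chi> i. (A ** X)$i$j) = A *v (\<chi> i. X$i$j)" for j
    by (simp add: matrix_matrix_mult_def matrix_vector_mult_def)
  have "(norm (A ** X))\<^sup>2 = (\<Sum>j\<in>UNIV. (norm (A *v (\<chi> i. X$i$j)))\<^sup>2)"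
    unfolding cols[of "A ** X"] col ..
  also have "\<dots> \<le> (\<Sum>j\<in>UNIV. (spectral_norm A * norm (\<chi> i. X$i$j))\<^sup>2)"
    unfolding spectral_norm_def using onorm[OF bl] by (intro sum_mono power_mono) auto
  also have "\<dots> = (spectral_norm A * norm X)\<^sup>2"
    by (simp add: power_mult_distrib cols[of X] sum_distrib_left)
  finally show "(norm (A ** X))\<^sup>2 \<le> (spectral_norm A * norm X)\<^sup>2" .
  show "0 \<le> spectral_norm A * norm X"
    unfolding spectral_norm_def using onorm_pos_le[OF bl] by simp
qed

lemma spectral_norm_nonneg: "0 \<le> spectral_norm A"
  unfolding spectral_norm_def by (rule onorm_pos_le) (rule matrix_vector_mul_bounded_linear)

lemma averaging_mult: "averaging ** X = all_rows (row_mean X)"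
  by (simp add: averaging_def matrix_matrix_mult_def all_rows_def row_mean_def vec_eq_iff sum_distrib_left)

lemma GDERIV_of_quadratic_bound:
  fixes F :: "'a::real_inner \<Rightarrow> real"
  assumes "\<And>z'. \<bar>F z' - F z - D \<bullet> (z' - z)\<bar> \<le> c * (norm (z' - z))\<^sup>2"
  shows "GDERIV F z :> D"
  unfolding gderiv_def has_derivative_at
proof (intro conjI)
  show "bounded_linear (\<lambda>h. h \<bullet> D)" by (rule bounded_linear_inner_left)
  show "((\<lambda>h. norm (F (z + h) - F z - h \<bullet> D) / norm h) \<longlongrightarrow> 0) (at 0)"
  proof (rule Lim_null_comparison)
    have "norm (norm (F (z + h) - F z - h \<bullet> D) / norm h) \<le> c * norm h" for h
    proof -
      have "norm (F (z + h) - F z - h \<bullet> D) / norm h \<le> c * (norm h)\<^sup>2 / norm h"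
        using assms[of "z + h"] by (intro divide_right_mono) (auto simp: inner_commute)
      then show ?thesis by (cases "h = 0") (simp_all add: power2_eq_square)
    qed
    then show "\<forall>\<^sub>F h in at 0. norm (norm (F (z + h) - F z - h \<bullet> D) / norm h) \<le> c * norm h"
      by simp
    show "((\<lambda>h. c * norm h) \<longlongrightarrow> 0) (at 0)"
      by (auto intro!: tendsto_eq_intros)
  qed
qed

lemma GDERIV_partial_snd:
  assumes "GDERIV F (x, y) :> D"
  shows "GDERIV (\<lambda>y. F (x, y)) y :> snd D"
proof -
  have "((\<lambda>y. (x, y)) has_derivative (\<lambda>h. (0, h))) (at y)"
    by (auto intro!: derivative_eq_intros)
  from has_derivative_compose[OF this, of F "\<lambda>h. h \<bullet> D"] assms
  show ?thesis by (cases D) (simp add: gderiv_def)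
qed

lemma closed_convex_fun_row_mean:
  fixes X :: "real^'d^'m"
  assumes r: "closed_convex_fun r" and X: "\<And>i. X $ i \<in> edom r"
  shows "row_mean X \<in> edom r"
    and "real CARD('m) * real_of_ereal (r (row_mean X)) \<le> (\<Sum>i\<in>UNIV. real_of_ereal (r (X $ i)))"
proof -
  let ?E = "{(x, a::real). r x \<le> ereal a}" and ?rr = "\<lambda>x. real_of_ereal (r x)"
  have cv: "convex ?E" using r by (simp add: closed_convex_fun_def)
  have "(\<Sum>i\<in>UNIV. (1 / real CARD('m)) *\<^sub>R (X $ i, ?rr (X $ i))) \<in> ?E"
    using edom_real[OF r X] by (intro convex_sum[OF _ cv]) auto
  then have le: "r (row_mean X) \<le> ereal (1 / real CARD('m) * (\<Sum>i\<in>UNIV. ?rr (X $ i)))"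
    by (simp add: row_mean_def sum_prod scaleR_right.sum sum_distrib_left)
  then show d: "row_mean X \<in> edom r" by (auto simp: edom_def intro: le_less_trans)
  have "?rr (row_mean X) \<le> 1 / real CARD('m) * (\<Sum>i\<in>UNIV. ?rr (X $ i))"
    using le edom_real[OF r d] by (metis ereal_less_eq(3))
  then show "real CARD('m) * ?rr (row_mean X) \<le> (\<Sum>i\<in>UNIV. ?rr (X $ i))"
    by (simp add: field_simps)
qed

lemma sum_ereal_MInfty:
  fixes a :: "'a \<Rightarrow> ereal"
  assumes "finite S" "i \<in> S" "a i = - \<infinity>" "\<And>j. j \<in> S \<Longrightarrow> a j \<noteq> \<infinity>"
  shows "sum a S = - \<infinity>"
proof -
  have "sum a (S - {i}) \<noteq> \<infinity>" using assms by (auto simp: sum_Pinfty)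
  then show ?thesis
    using assms by (subst sum.remove[of S i]) (cases "sum a (S - {i})", auto)
qed

lemma step_size_bounds:
  fixes L \<mu> \<kappa> \<rho> L\<^sub>P \<eta>\<^sub>x \<eta>\<^sub>\<Lambda> :: real
  assumes L: "0 < L" and k: "1 \<le> \<kappa>" and rho: "\<rho> < 1"
    and LP: "L\<^sub>P = L * sqrt (4 * \<kappa>\<^sup>2 + 1)"
    and x: "\<eta>\<^sub>x = min ((1 - \<rho>)\<^sup>2 / (180 * L\<^sub>P)) (1 / (20 * (L + 1) * (12 * \<kappa>\<^sup>2 + 2 * \<kappa> + 5)))"
    and l: "\<eta>\<^sub>\<Lambda> = min (5 * L\<^sub>P * (1 - \<rho>)\<^sup>2 / (24 * L\<^sup>2 * (12 * \<kappa>\<^sup>2 + \<kappa> + 1)))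
      (1 / (2 * L\<^sub>P + 128 * L * \<kappa>\<^sup>2 + (L + 1) * (20 * \<kappa>\<^sup>2 + \<kappa> + 1) / 2
            + 4 * L\<^sup>2 * (12 * \<kappa>\<^sup>2 + \<kappa> + 1) / (30 * L\<^sub>P)))"
  shows "0 < \<eta>\<^sub>x" "\<eta>\<^sub>x * L * \<kappa> \<le> (1 - \<rho>)\<^sup>2 / 360" "\<eta>\<^sub>x * L * \<kappa>\<^sup>2 \<le> 1 / 240"
    and "0 < \<eta>\<^sub>\<Lambda>" "\<eta>\<^sub>\<Lambda> * L * \<kappa> \<le> (1 - \<rho>)\<^sup>2 / 25" "\<eta>\<^sub>\<Lambda> * L * \<kappa>\<^sup>2 \<le> 1 / 138"
proof -
  define R where "R = (1 - \<rho>)\<^sup>2"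
  have R: "0 < R" using rho by (simp add: R_def)
  have k2: "1 \<le> \<kappa>\<^sup>2" "0 < \<kappa>" "0 < \<kappa>\<^sup>2" using k one_le_power[OF k, of 2] by auto
  have "2 * \<kappa> = sqrt (4 * \<kappa>\<^sup>2)" using k by (simp add: real_sqrt_mult)
  also have "\<dots> \<le> sqrt (4 * \<kappa>\<^sup>2 + 1)" by simp
  finally have s1: "2 * \<kappa> \<le> sqrt (4 * \<kappa>\<^sup>2 + 1)" .
  have "4 * \<kappa>\<^sup>2 + 1 \<le> (9 / 4)\<^sup>2 * \<kappa>\<^sup>2" using k2(1) by (simp add: power2_eq_square[of "9 / 4"])
  then have s2: "sqrt (4 * \<kappa>\<^sup>2 + 1) \<le> 9 / 4 * \<kappa>"
    using k by (intro real_le_lsqrt) (simp_all add: power_mult_distrib power_divide)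
  have LP1: "2 * L * \<kappa> \<le> L\<^sub>P" and LP2: "L\<^sub>P \<le> 9 / 4 * L * \<kappa>"
    using mult_left_mono[OF s1, of L] mult_left_mono[OF s2, of L] L by (simp_all add: LP mult_ac)
  have LP0: "0 < L\<^sub>P" using LP1 L k2 by (smt (verit) mult_pos_pos)
  have d1: "240 * L * \<kappa>\<^sup>2 \<le> 20 * (L + 1) * (12 * \<kappa>\<^sup>2 + 2 * \<kappa> + 5)"
  proof -
    have "L * (12 * \<kappa>\<^sup>2) \<le> (L + 1) * (12 * \<kappa>\<^sup>2 + 2 * \<kappa> + 5)"
      using L k2 by (intro mult_mono) auto
    then show ?thesis unfolding mult.assoc by linarith
  qed
  have d1': "0 < 20 * (L + 1) * (12 * \<kappa>\<^sup>2 + 2 * \<kappa> + 5)"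
    using L k2 by (intro mult_pos_pos add_pos_pos) auto
  have d2: "138 * L * \<kappa>\<^sup>2 \<le> 2 * L\<^sub>P + 128 * L * \<kappa>\<^sup>2 + (L + 1) * (20 * \<kappa>\<^sup>2 + \<kappa> + 1) / 2
            + 4 * L\<^sup>2 * (12 * \<kappa>\<^sup>2 + \<kappa> + 1) / (30 * L\<^sub>P)"
  proof -
    have "L * (20 * \<kappa>\<^sup>2) \<le> (L + 1) * (20 * \<kappa>\<^sup>2 + \<kappa> + 1)"
      using L k2 by (intro mult_mono) auto
    moreover have "0 \<le> 4 * L\<^sup>2 * (12 * \<kappa>\<^sup>2 + \<kappa> + 1) / (30 * L\<^sub>P)"
      using LP0 k2 by (intro divide_nonneg_nonneg mult_nonneg_nonneg) auto
    ultimately show ?thesis using LP0 by simp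
  qed
  have Lk: "0 < L * \<kappa>\<^sup>2" "0 < L * \<kappa>" using L k2 by auto
  have p1: "0 < R / (180 * L\<^sub>P)" using R LP0 by simp
  have p2: "0 < 5 * L\<^sub>P * R / (24 * L\<^sup>2 * (12 * \<kappa>\<^sup>2 + \<kappa> + 1))"
    using R LP0 L k2 by (intro divide_pos_pos mult_pos_pos add_pos_pos) auto
  show "0 < \<eta>\<^sub>x" using p1 d1' unfolding x R_def by simp
  show "0 < \<eta>\<^sub>\<Lambda>" using p2 d2 Lk unfolding l R_def by simp
  have "\<eta>\<^sub>x \<le> R / (180 * L\<^sub>P)" by (simp add: x R_def)
  also have "\<dots> \<le> R / (180 * (2 * L * \<kappa>))"
    using LP1 LP0 R Lk by (intro divide_left_mono mult_left_mono) auto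
  finally have "\<eta>\<^sub>x * (L * \<kappa>) \<le> R / (180 * (2 * L * \<kappa>)) * (L * \<kappa>)" using Lk by (intro mult_right_mono) auto
  then show "\<eta>\<^sub>x * L * \<kappa> \<le> (1 - \<rho>)\<^sup>2 / 360" using L k2 by (simp add: R_def mult.assoc)
  have "\<eta>\<^sub>x \<le> 1 / (20 * (L + 1) * (12 * \<kappa>\<^sup>2 + 2 * \<kappa> + 5))" by (simp add: x)
  also have "\<dots> \<le> 1 / (240 * L * \<kappa>\<^sup>2)"
    using d1 d1' Lk by (intro divide_left_mono) auto
  finally have "\<eta>\<^sub>x * (L * \<kappa>\<^sup>2) \<le> 1 / (240 * L * \<kappa>\<^sup>2) * (L * \<kappa>\<^sup>2)" using Lk by (intro mult_right_mono) auto
  then show "\<eta>\<^sub>x * L * \<kappa>\<^sup>2 \<le> 1 / 240" using L k2 by (simp add: mult.assoc)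
  have "\<eta>\<^sub>\<Lambda> \<le> 5 * L\<^sub>P * R / (24 * L\<^sup>2 * (12 * \<kappa>\<^sup>2 + \<kappa> + 1))" by (simp add: l R_def)
  also have "\<dots> \<le> 5 * (9 / 4 * L * \<kappa>) * R / (24 * L\<^sup>2 * (12 * \<kappa>\<^sup>2))"
    using LP0 LP2 R L k2 by (intro frac_le mult_mono) auto
  finally have "\<eta>\<^sub>\<Lambda> * (L * \<kappa>) \<le> 5 * (9 / 4 * L * \<kappa>) * R / (24 * L\<^sup>2 * (12 * \<kappa>\<^sup>2)) * (L * \<kappa>)"
    using Lk by (intro mult_right_mono) auto
  also have "\<dots> = 45 / 1152 * R" using L k2 by (simp add: field_simps power2_eq_square)
  also have "\<dots> \<le> R / 25" using R by simp
  finally show "\<eta>\<^sub>\<Lambda> * L * \<kappa> \<le> (1 - \<rho>)\<^sup>2 / 25" by (simp add: R_def mult.assoc)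
  have "\<eta>\<^sub>\<Lambda> \<le> 1 / (2 * L\<^sub>P + 128 * L * \<kappa>\<^sup>2 + (L + 1) * (20 * \<kappa>\<^sup>2 + \<kappa> + 1) / 2
            + 4 * L\<^sup>2 * (12 * \<kappa>\<^sup>2 + \<kappa> + 1) / (30 * L\<^sub>P))" by (simp add: l)
  also have "\<dots> \<le> 1 / (138 * L * \<kappa>\<^sup>2)"
    using d2 Lk by (intro divide_left_mono) auto
  finally have "\<eta>\<^sub>\<Lambda> * (L * \<kappa>\<^sup>2) \<le> 1 / (138 * L * \<kappa>\<^sup>2) * (L * \<kappa>\<^sup>2)" using Lk by (intro mult_right_mono) auto
  then show "\<eta>\<^sub>\<Lambda> * L * \<kappa>\<^sup>2 \<le> 1 / 138" using L k2 by (simp add: mult.assoc)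
qed

section \<open>The decentralised problem as a saddle problem\<close>

lemma norm_Pair_sq: "(norm (a, b))\<^sup>2 = (norm a)\<^sup>2 + (norm b)\<^sup>2"
  by (simp add: norm_Pair)

lemma norm_sq_fst_snd: "(norm z)\<^sup>2 = (norm (fst z))\<^sup>2 + (norm (snd z))\<^sup>2"
  by (cases z) (simp add: norm_Pair)

locale vrlm_problem =
  fixes f :: "'m::finite \<Rightarrow> (real^'d1) \<times> (real^'d2) \<Rightarrow> real"
    and g :: "real^'d1 \<Rightarrow> ereal" and h :: "real^'d2 \<Rightarrow> ereal"
    and W :: "real^'m^'m"
    and L \<mu> \<kappa> \<rho> L\<^sub>P \<eta>\<^sub>x \<eta>\<^sub>\<Lambda> :: real and x0 :: "real^'d1" and y0 :: "real^'d2"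
  assumes g_convex: "closed_convex_fun g" and h_convex: "closed_convex_fun h"
    and mu_pos: "\<mu> > 0" and f_concave: "\<And>i x. strongly_concave \<mu> (\<lambda>y. f i (x, y))"
    and W_null: "{v. (W - mat 1) *v v = 0} = span {1}"
    and W_stochastic: "transpose W *v 1 = 1"
    and rho_def: "\<rho> = spectral_norm (W - averaging)"
    and W_gap: "\<rho> < 1" "spectral_norm (W - mat 1) \<le> 2"
    and f_smooth: "\<And>i. smooth_fun L (f i)"
    and kappa_def: "\<kappa> = L / \<mu>"
    and L_P_def: "L\<^sub>P = L * sqrt (4 * \<kappa>\<^sup>2 + 1)"
    and eta_x_def: "\<eta>\<^sub>x = min ((1 - \<rho>)\<^sup>2 / (180 * L\<^sub>P))
                              (1 / (20 * (L + 1) * (12 * \<kappa>\<^sup>2 + 2 * \<kappa> + 5)))"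
    and eta_Lambda_def: "\<eta>\<^sub>\<Lambda> = min (5 * L\<^sub>P * (1 - \<rho>)\<^sup>2 / (24 * L\<^sup>2 * (12 * \<kappa>\<^sup>2 + \<kappa> + 1)))
                              (1 / (2 * L\<^sub>P + 128 * L * \<kappa>\<^sup>2 + (L + 1) * (20 * \<kappa>\<^sup>2 + \<kappa> + 1) / 2
                                    + 4 * L\<^sup>2 * (12 * \<kappa>\<^sup>2 + \<kappa> + 1) / (30 * L\<^sub>P)))"
    and x0: "x0 \<in> edom g" and y0: "y0 \<in> edom h"
begin

definition FF :: "real^'d1^'m \<Rightarrow> real^'d2^'m \<Rightarrow> real" where
  "FF X Y = (\<Sum>i\<in>UNIV. f i (X $ i, Y $ i))"

definition FFX :: "real^'d1^'m \<Rightarrow> real^'d2^'m \<Rightarrow> real^'d1^'m" where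
  "FFX X Y = (\<chi> i. fst (grad (f i) (X $ i, Y $ i)))"

definition FFY :: "real^'d1^'m \<Rightarrow> real^'d2^'m \<Rightarrow> real^'d2^'m" where
  "FFY X Y = (\<chi> i. snd (grad (f i) (X $ i, Y $ i)))"

definition HH :: "real^'d2^'m \<Rightarrow> real" where
  "HH Y = (\<Sum>i\<in>UNIV. real_of_ereal (h (Y $ i)))"

definition KK :: "(real^'d2^'m) set" where
  "KK = {Y. \<forall>i. Y $ i \<in> edom h}"

definition GG :: "real^'d1^'m \<Rightarrow> real" where
  "GG X = (\<Sum>i\<in>UNIV. real_of_ereal (g (X $ i)))"

definition CC :: "(real^'d1^'m) set" where
  "CC = {X. \<forall>i. X $ i \<in> edom g}"

definition BB :: "real^'d2^'m \<Rightarrow> real^'d2^'m" where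
  "BB Y = (- (L / 2)) *\<^sub>R ((W - mat 1) ** Y)"

definition BB' :: "real^'d2^'m \<Rightarrow> real^'d2^'m" where
  "BB' l = (- (L / 2)) *\<^sub>R (transpose (W - mat 1) ** l)"

definition is_best_response :: "'m \<Rightarrow> real^'d1 \<Rightarrow> real^'d2 \<Rightarrow> real^'d2 \<Rightarrow> bool" where
  "is_best_response i x c y \<longleftrightarrow> y \<in> edom h \<and> (\<forall>v\<in>edom h. real_of_ereal (h v)
     \<ge> real_of_ereal (h y) + (snd (grad (f i) (x, y)) + c) \<bullet> (v - y))"

definition YY :: "real^'d1^'m \<Rightarrow> real^'d2^'m \<Rightarrow> real^'d2^'m" where
  "YY X l = (\<chi> i. SOME y. is_best_response i (X $ i) (BB' l $ i) y)"

definition JJ :: "real^'d1^'m \<Rightarrow> real^'d1^'m" where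
  "JJ X = all_rows (row_mean X)"

lemma GDERIV_f: "GDERIV (f i) z :> grad (f i) z"
  by (rule smooth_fun_GDERIV[OF f_smooth])

lemma f_concave_first_order:
  "f i (x, y') \<le> f i (x, y) + snd (grad (f i) (x, y)) \<bullet> (y' - y) - \<mu> / 2 * (norm (y' - y))\<^sup>2"
  by (rule strongly_concave_first_order[OF f_concave GDERIV_partial_snd[OF GDERIV_f]])

lemma mu_le_L: "\<mu> \<le> L"
proof -
  fix i :: 'm
  define y where "y = (axis undefined 1 :: real^'d2)"
  have "norm y = 1" by (simp add: y_def)
  moreover have "f i (0, y) \<ge> f i (0, 0) + grad (f i) (0, 0) \<bullet> ((0, y) - (0, 0))
      - L / 2 * (norm ((0, y) - (0, 0) :: (real^'d1) \<times> (real^'d2)))\<^sup>2"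
    using smooth_fun_quadratic[OF f_smooth, of i "(0, y)" "(0, 0)"] unfolding abs_le_iff by linarith
  ultimately show ?thesis
    using f_concave_first_order[of i 0 y 0] by (simp add: norm_Pair inner_prod_def)
qed

lemma best_response_exists: "\<exists>y. is_best_response i x c y"
proof -
  let ?\<phi> = "\<lambda>y. - f i (x, y) - c \<bullet> y"
  have D: "GDERIV ?\<phi> y :> - snd (grad (f i) (x, y)) - c" for y
  proof -
    have "GDERIV (\<lambda>y. c \<bullet> y) y :> c"
      unfolding gderiv_def by (auto intro!: derivative_eq_intros simp: inner_commute)
    then show ?thesis
      by (intro GDERIV_diff GDERIV_minus GDERIV_partial_snd GDERIV_f)
  qed
  have cont: "continuous_on UNIV ?\<phi>"
    using D unfolding gderiv_def by (intro has_derivative_continuous_on) blast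
  obtain p where p: "p \<in> edom h"
    "\<And>v. v \<in> edom h \<Longrightarrow> real_of_ereal (h p) + ?\<phi> p \<le> real_of_ereal (h v) + ?\<phi> v"
  proof (rule closed_convex_fun_minimiser[OF h_convex y0 cont, of "\<mu> / 2"
        "- snd (grad (f i) (x, 0)) - c" "- f i (x, 0)"])
    show "\<mu> / 2 * (norm v)\<^sup>2 + (- snd (grad (f i) (x, 0)) - c) \<bullet> v + - f i (x, 0) \<le> ?\<phi> v" for v
      using f_concave_first_order[of i x v 0] by (simp add: inner_diff_left)
  qed (use mu_pos in auto)
  have "is_best_response i x c p"
    unfolding is_best_response_def
  proof (intro conjI ballI p(1))
    fix v assume "v \<in> edom h"
    from closed_convex_fun_first_order[OF h_convex p(1) this p(2) D]
    show "real_of_ereal (h p) + (snd (grad (f i) (x, p)) + c) \<bullet> (v - p) \<le> real_of_ereal (h v)"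
      by (simp add: inner_add_left inner_diff_left)
  qed
  then show ?thesis ..
qed

lemma YY_best_response: "is_best_response i (X $ i) (BB' l $ i) (YY X l $ i)"
  unfolding YY_def vec_lambda_beta by (rule someI_ex[OF best_response_exists])

lemma F_quad: "\<bar>FF X' Y' - FF X Y - FFX X Y \<bullet> (X' - X) - FFY X Y \<bullet> (Y' - Y)\<bar>
  \<le> L / 2 * ((norm (X' - X))\<^sup>2 + (norm (Y' - Y))\<^sup>2)"
proof -
  have "FF X' Y' - FF X Y - FFX X Y \<bullet> (X' - X) - FFY X Y \<bullet> (Y' - Y)
    = (\<Sum>i\<in>UNIV. f i (X' $ i, Y' $ i) - f i (X $ i, Y $ i)
        - grad (f i) (X $ i, Y $ i) \<bullet> ((X' $ i, Y' $ i) - (X $ i, Y $ i)))"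
    by (simp add: FF_def FFX_def FFY_def inner_vec_def inner_prod_def sum_subtractf sum.distrib)
  also have "\<bar>\<dots>\<bar> \<le> (\<Sum>i\<in>UNIV. L / 2 * (norm ((X' $ i, Y' $ i) - (X $ i, Y $ i)))\<^sup>2)"
    by (intro sum_abs[THEN order_trans] sum_mono smooth_fun_quadratic f_smooth)
  also have "\<dots> = L / 2 * ((norm (X' - X))\<^sup>2 + (norm (Y' - Y))\<^sup>2)"
    by (simp add: norm_sq_rows norm_Pair_sq sum_distrib_left sum.distrib distrib_left)
  finally show ?thesis .
qed

lemma F_lip: "(norm (FFX X Y - FFX X' Y'))\<^sup>2 + (norm (FFY X Y - FFY X' Y'))\<^sup>2
  \<le> L\<^sup>2 * ((norm (X - X'))\<^sup>2 + (norm (Y - Y'))\<^sup>2)"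
proof -
  have "(norm (FFX X Y - FFX X' Y'))\<^sup>2 + (norm (FFY X Y - FFY X' Y'))\<^sup>2
    = (\<Sum>i\<in>UNIV. (norm (grad (f i) (X $ i, Y $ i) - grad (f i) (X' $ i, Y' $ i)))\<^sup>2)"
    by (simp add: norm_sq_rows norm_sq_fst_snd sum.distrib FFX_def FFY_def)
  also have "\<dots> \<le> (\<Sum>i\<in>UNIV. (L * norm ((X $ i, Y $ i) - (X' $ i, Y' $ i)))\<^sup>2)"
    by (intro sum_mono power_mono smooth_fun_lipschitz[OF f_smooth]) simp
  also have "\<dots> = L\<^sup>2 * ((norm (X - X'))\<^sup>2 + (norm (Y - Y'))\<^sup>2)"
    by (simp add: norm_sq_rows norm_Pair_sq power_mult_distrib sum_distrib_left sum.distrib distrib_left)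
  finally show ?thesis .
qed

sublocale saddle FF FFX FFY HH KK BB BB' YY L \<mu> \<kappa>
proof
  show "0 < \<mu>" by (rule mu_pos)
  show "\<mu> \<le> L" by (rule mu_le_L)
  show "\<kappa> = L / \<mu>" by (rule kappa_def)
  show "(norm (FFX X Y - FFX X' Y'))\<^sup>2 + (norm (FFY X Y - FFY X' Y'))\<^sup>2
    \<le> L\<^sup>2 * ((norm (X - X'))\<^sup>2 + (norm (Y - Y'))\<^sup>2)" for X Y X' Y' by (rule F_lip)
  show "\<bar>FF X' Y' - FF X Y - FFX X Y \<bullet> (X' - X) - FFY X Y \<bullet> (Y' - Y)\<bar>
    \<le> L / 2 * ((norm (X' - X))\<^sup>2 + (norm (Y' - Y))\<^sup>2)" for X' Y' X Y by (rule F_quad)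
  show "FF X Y' \<le> FF X Y + FFY X Y \<bullet> (Y' - Y) - \<mu> / 2 * (norm (Y' - Y))\<^sup>2" for X Y Y'
  proof -
    have "FF X Y' \<le> (\<Sum>i\<in>UNIV. f i (X $ i, Y $ i) + snd (grad (f i) (X $ i, Y $ i)) \<bullet> (Y' $ i - Y $ i)
        - \<mu> / 2 * (norm (Y' $ i - Y $ i))\<^sup>2)"
      unfolding FF_def by (intro sum_mono f_concave_first_order)
    then show ?thesis
      by (simp add: FF_def FFY_def inner_vec_def norm_sq_rows sum.distrib sum_subtractf sum_distrib_left)
  qed
  show "BB (Y - Y') = BB Y - BB Y'" for Y Y'
    by (simp add: BB_def linear_diff[OF linear_matrix_matrix_mult] scaleR_diff_right)
  show "norm (BB Y) \<le> L * norm Y" for Y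
  proof -
    have "norm (BB Y) = L / 2 * norm ((W - mat 1) ** Y)"
      using mu_pos mu_le_L by (simp add: BB_def)
    also have "\<dots> \<le> L / 2 * (2 * norm Y)"
      using mu_pos mu_le_L W_gap(2)
      by (intro mult_left_mono norm_matrix_matrix_mult_le[THEN order_trans] mult_right_mono) auto
    finally show ?thesis by simp
  qed
  show "BB' l \<bullet> Y = l \<bullet> BB Y" for l Y
    by (simp add: BB_def BB'_def matrix_matrix_mult_adjoint)
  show "YY X l \<in> KK" for X l
    using YY_best_response by (simp add: KK_def is_best_response_def)
  show "HH Y \<ge> HH (YY X l) + (FFY X (YY X l) + BB' l) \<bullet> (Y - YY X l)" if "Y \<in> KK" for Y X l
  proof -
    have "HH Y \<ge> (\<Sum>i\<in>UNIV. real_of_ereal (h (YY X l $ i))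
        + (snd (grad (f i) (X $ i, YY X l $ i)) + BB' l $ i) \<bullet> (Y $ i - YY X l $ i))"
      unfolding HH_def using that YY_best_response[of _ X l]
      by (intro sum_mono) (auto simp: KK_def is_best_response_def)
    then show ?thesis
      by (simp add: HH_def FFY_def inner_vec_def sum.distrib)
  qed
qed

text \<open>
  After replacing \<open>P\<close> by \<open>m P\<close> and \<open>\<Lambda>\<close> by \<open>\<surd>m \<Lambda>\<close>, all norms are Frobenius norms without factors of \<open>m\<close>.
\<close>

abbreviation scaled :: "real^'d2^'m \<Rightarrow> real^'d2^'m" where
  "scaled l \<equiv> sqrt (real CARD('m)) *\<^sub>R l"

lemma Phi_eq:
  assumes "Y \<in> KK"
  shows "Phi L W f h X \<Lambda> Y = ereal (1 / real CARD('m) * \<Phi> X (scaled \<Lambda>) Y)"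
proof -
  have "ereal (f i (X $ i, Y $ i)) - h (Y $ i) = ereal (f i (X $ i, Y $ i) - real_of_ereal (h (Y $ i)))" for i
    using edom_real[OF h_convex, of "Y $ i"] assms by (metis (mono_tags) KK_def ereal_minus(1) mem_Collect_eq)
  then have "(\<Sum>i\<in>UNIV. ereal (f i (X $ i, Y $ i)) - h (Y $ i)) = ereal (FF X Y - HH Y)"
    by (simp add: FF_def HH_def sum_subtractf)
  moreover have "L / (2 * sqrt (real CARD('m))) * (\<Lambda> \<bullet> ((W - mat 1) ** Y))
      = - (1 / real CARD('m) * ((scaled \<Lambda>) \<bullet> BB Y))"
    by (simp add: BB_def real_divide_square_eq field_simps)
  ultimately show ?thesis
    by (simp add: Phi_def \<Phi>_def algebra_simps add_divide_distrib diff_divide_distrib)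
qed

lemma Phi_MInfty:
  assumes "Y \<notin> KK"
  shows "Phi L W f h X \<Lambda> Y = - \<infinity>"
proof -
  obtain i where "h (Y $ i) = \<infinity>" using assms by (auto simp: KK_def edom_def)
  moreover have "h v \<noteq> - \<infinity>" for v using h_convex by (simp add: closed_convex_fun_def)
  then have "ereal a - h v \<noteq> \<infinity>" for a v by (cases "h v") auto
  ultimately have "(\<Sum>i\<in>UNIV. ereal (f i (X $ i, Y $ i)) - h (Y $ i)) = - \<infinity>"
    by (intro sum_ereal_MInfty[of _ i]) auto
  then show ?thesis by (simp add: Phi_def)
qed

lemma P_eq: "P L W f h x \<Lambda> = ereal (1 / real CARD('m) * \<P> (all_rows x) (scaled \<Lambda>))"
proof (rule antisym)
  show "P L W f h x \<Lambda> \<le> ereal (1 / real CARD('m) * \<P> (all_rows x) (scaled \<Lambda>))"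
    unfolding P_def
  proof (rule SUP_least)
    fix Y
    show "Phi L W f h (all_rows x) \<Lambda> Y \<le> ereal (1 / real CARD('m) * \<P> (all_rows x) (scaled \<Lambda>))"
      by (cases "Y \<in> KK") (auto simp: Phi_eq Phi_MInfty intro!: divide_right_mono \<Phi>_le_\<P>)
  qed
  show "ereal (1 / real CARD('m) * \<P> (all_rows x) (scaled \<Lambda>)) \<le> P L W f h x \<Lambda>"
    unfolding P_def \<P>_def Phi_eq[OF Ys_in, symmetric] by (rule SUP_upper) simp
qed

lemma Pval_eq: "Pval L W f h x \<Lambda> = 1 / real CARD('m) * \<P> (all_rows x) (scaled \<Lambda>)"
  unfolding Pval_def P_eq by simp

lemma grad_Pval_x:
  "grad (\<lambda>x. Pval L W f h x \<Lambda>) x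
    = row_mean (FFX (all_rows x) (YY (all_rows x) (scaled \<Lambda>)))"
proof (rule grad_eq, rule GDERIV_of_quadratic_bound)
  fix x'
  let ?l = "sqrt (real CARD('m)) *\<^sub>R \<Lambda>" and ?m = "real CARD('m)"
  let ?X = "all_rows x :: real^'d1^'m" and ?X' = "all_rows x' :: real^'d1^'m"
  let ?g = "FFX ?X (YY ?X ?l)"
  have n: "(norm (?X' - ?X))\<^sup>2 = ?m * (norm (x' - x))\<^sup>2"
    unfolding all_rows_diff[symmetric] by (rule norm_all_rows)
  have i: "?g \<bullet> (?X' - ?X) = ?m * (row_mean ?g \<bullet> (x' - x))"
    unfolding all_rows_diff[symmetric] by (simp add: inner_commute[of ?g] all_rows_inner inner_commute)
  have "\<P> ?X' ?l - \<P> ?X ?l - ?m * (row_mean ?g \<bullet> (x' - x)) \<le> (L * \<kappa> + L / 2) * (?m * (norm (x' - x))\<^sup>2)"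
    using \<P>_upper[of ?X' ?l ?X ?l] unfolding n i by simp
  moreover have "\<P> ?X' ?l - \<P> ?X ?l - ?m * (row_mean ?g \<bullet> (x' - x)) \<ge> - (L / 2) * (?m * (norm (x' - x))\<^sup>2)"
    using \<P>_lower[of ?X ?l ?X' ?l] unfolding n i by simp
  moreover have "- (L * \<kappa> + L / 2) * (?m * (norm (x' - x))\<^sup>2) \<le> - (L / 2) * (?m * (norm (x' - x))\<^sup>2)"
    using L_pos kappa_ge_1 by (intro mult_right_mono) auto
  ultimately have b: "\<bar>\<P> ?X' ?l - \<P> ?X ?l - ?m * (row_mean ?g \<bullet> (x' - x))\<bar>
      \<le> (L * \<kappa> + L / 2) * (?m * (norm (x' - x))\<^sup>2)"
    unfolding abs_le_iff by linarith
  have "\<bar>Pval L W f h x' \<Lambda> - Pval L W f h x \<Lambda> - row_mean ?g \<bullet> (x' - x)\<bar>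
      = \<bar>1 / ?m * (\<P> ?X' ?l - \<P> ?X ?l - ?m * (row_mean ?g \<bullet> (x' - x)))\<bar>"
    by (simp add: Pval_eq right_diff_distrib diff_divide_distrib)
  also have "\<dots> = 1 / ?m * \<bar>\<P> ?X' ?l - \<P> ?X ?l - ?m * (row_mean ?g \<bullet> (x' - x))\<bar>"
    by (simp add: abs_mult)
  also have "\<dots> \<le> 1 / ?m * ((L * \<kappa> + L / 2) * (?m * (norm (x' - x))\<^sup>2))"
    using b by (intro mult_left_mono) auto
  also have "\<dots> = (L * \<kappa> + L / 2) * (norm (x' - x))\<^sup>2" by simp
  finally show "\<bar>Pval L W f h x' \<Lambda> - Pval L W f h x \<Lambda> - row_mean ?g \<bullet> (x' - x)\<bar>
      \<le> (L * \<kappa> + L / 2) * (norm (x' - x))\<^sup>2" .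
qed

lemma grad_Pval_\<Lambda>:
  "grad (\<lambda>\<Lambda>. Pval L W f h x \<Lambda>) \<Lambda>
    = (1 / sqrt (real CARD('m))) *\<^sub>R BB (YY (all_rows x) (scaled \<Lambda>))"
proof (rule grad_eq, rule GDERIV_of_quadratic_bound)
  fix \<Lambda>' :: "real^'d2^'m"
  let ?s = "sqrt (real CARD('m))" and ?X = "all_rows x :: real^'d1^'m" and ?m = "real CARD('m)"
  let ?l = "?s *\<^sub>R \<Lambda>" and ?l' = "?s *\<^sub>R \<Lambda>'"
  let ?b = "BB (YY ?X ?l)"
  have n: "(norm (?l' - ?l))\<^sup>2 = ?m * (norm (\<Lambda>' - \<Lambda>))\<^sup>2"
    unfolding scaleR_diff_right[symmetric] by (simp add: power_mult_distrib)
  have i: "(?l' - ?l) \<bullet> ?b = ?s * (?b \<bullet> (\<Lambda>' - \<Lambda>))"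
    unfolding scaleR_diff_right[symmetric] by (simp add: inner_commute)
  have ms: "1 / ?m * (?s * z) = 1 / ?s * z" for z
    by (simp add: real_div_sqrt field_simps)
  have "\<P> ?X ?l' - \<P> ?X ?l - ?s * (?b \<bullet> (\<Lambda>' - \<Lambda>)) \<le> L * \<kappa> * (?m * (norm (\<Lambda>' - \<Lambda>))\<^sup>2)"
    using \<P>_upper[of ?X ?l' ?X ?l] unfolding n i by simp
  moreover have "\<P> ?X ?l' - \<P> ?X ?l - ?s * (?b \<bullet> (\<Lambda>' - \<Lambda>)) \<ge> 0"
    using \<P>_lower[of ?X ?l ?X ?l'] unfolding n i by simp
  ultimately have b: "\<bar>\<P> ?X ?l' - \<P> ?X ?l - ?s * (?b \<bullet> (\<Lambda>' - \<Lambda>))\<bar> \<le> L * \<kappa> * (?m * (norm (\<Lambda>' - \<Lambda>))\<^sup>2)"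
    unfolding abs_le_iff by linarith
  have "\<bar>Pval L W f h x \<Lambda>' - Pval L W f h x \<Lambda> - (1 / ?s) *\<^sub>R ?b \<bullet> (\<Lambda>' - \<Lambda>)\<bar>
      = \<bar>1 / ?m * (\<P> ?X ?l' - \<P> ?X ?l - ?s * (?b \<bullet> (\<Lambda>' - \<Lambda>)))\<bar>"
    unfolding right_diff_distrib ms by (simp add: Pval_eq)
  also have "\<dots> = 1 / ?m * \<bar>\<P> ?X ?l' - \<P> ?X ?l - ?s * (?b \<bullet> (\<Lambda>' - \<Lambda>))\<bar>"
    by (simp add: abs_mult)
  also have "\<dots> \<le> 1 / ?m * (L * \<kappa> * (?m * (norm (\<Lambda>' - \<Lambda>))\<^sup>2))"
    using b by (intro mult_left_mono) auto
  also have "\<dots> = L * \<kappa> * (norm (\<Lambda>' - \<Lambda>))\<^sup>2" by simp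
  finally show "\<bar>Pval L W f h x \<Lambda>' - Pval L W f h x \<Lambda> - (1 / ?s) *\<^sub>R ?b \<bullet> (\<Lambda>' - \<Lambda>)\<bar>
      \<le> L * \<kappa> * (norm (\<Lambda>' - \<Lambda>))\<^sup>2" .
qed

lemma mult_one: "A *v 1 = (\<chi> i. \<Sum>j\<in>UNIV. A $ i $ j)" for A :: "real^'m^'m"
  by (simp add: matrix_vector_mult_def)

lemma W_rows: "(\<Sum>j\<in>UNIV. W $ i $ j) = 1" and W_columns: "(\<Sum>i\<in>UNIV. W $ i $ j) = 1"
proof -
  have "(1 :: real^'m) \<in> {v. (W - mat 1) *v v = 0}" unfolding W_null by (simp add: span_base)
  then have "W *v 1 = (1 :: real^'m)" by (simp add: matrix_vector_mult_diff_rdistrib)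
  then show "(\<Sum>j\<in>UNIV. W $ i $ j) = 1" by (simp add: mult_one vec_eq_iff)
  have "(transpose W *v 1) $ j = (1 :: real^'m) $ j" by (simp only: W_stochastic)
  then show "(\<Sum>i\<in>UNIV. W $ i $ j) = 1" by (simp only: mult_one) (simp add: transpose_def)
qed

lemma W_all_rows: "W ** all_rows u = (all_rows u :: real^'d^'m)"
  by (simp add: vec_eq_iff matrix_matrix_mult_def all_rows_def sum_distrib_right[symmetric] W_rows)

lemma row_mean_W: "row_mean (W ** X) = row_mean X" for X :: "real^'d^'m"
proof -
  have "(\<Sum>i\<in>UNIV. \<Sum>k\<in>UNIV. W $ i $ k * X $ k $ j) = (\<Sum>k\<in>UNIV. X $ k $ j)" for j
    by (subst sum.swap) (simp add: sum_distrib_right[symmetric] W_columns)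
  then show ?thesis
    by (simp add: row_mean_def vec_eq_iff matrix_matrix_mult_def)
qed

lemma rho_nonneg: "0 \<le> \<rho>"
  unfolding rho_def by (rule spectral_norm_nonneg)

lemma W_contraction: "norm (W ** X - JJ X) \<le> \<rho> * norm (X - JJ X)"
proof -
  have "(W - averaging) ** (X - JJ X) = W ** X - JJ X"
  proof -
    have "averaging ** (X - JJ X) = 0"
      unfolding averaging_mult JJ_def
      by (simp add: linear_diff[OF linear_row_mean] row_mean_all_rows linear_0[OF linear_all_rows])
    moreover have "(W - averaging) ** Z = W ** Z - averaging ** Z" for Z :: "real^'d1^'m"
      by (simp add: matrix_matrix_mult_def vec_eq_iff left_diff_distrib sum_subtractf)
    moreover have "W ** (X - JJ X) = W ** X - JJ X"
      by (simp add: linear_diff[OF linear_matrix_matrix_mult] JJ_def W_all_rows)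
    ultimately show ?thesis by simp
  qed
  then show ?thesis
    unfolding rho_def by (metis norm_matrix_matrix_mult_le)
qed

lemma prox_rows_g:
  defines "p \<equiv> \<lambda>U. prox_rows (\<lambda>v. ereal \<eta>\<^sub>x * g v) U"
  assumes "\<eta>\<^sub>x > 0"
  shows "p U \<in> CC" and "X \<in> CC \<Longrightarrow> GG X \<ge> GG (p U) + (1 / \<eta>\<^sub>x) *\<^sub>R (U - p U) \<bullet> (X - p U)"
proof -
  note pv = prox_variational[OF g_convex x0 assms(2)]
  show "p U \<in> CC" unfolding CC_def p_def prox_rows_def using pv(1) by simp
  assume "X \<in> CC"
  then have "GG X \<ge> (\<Sum>i\<in>UNIV. real_of_ereal (g (p U $ i)) + (1 / \<eta>\<^sub>x) *\<^sub>R (U $ i - p U $ i) \<bullet> (X $ i - p U $ i))"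
    unfolding GG_def p_def prox_rows_def vec_lambda_beta CC_def by (intro sum_mono pv(2)) simp
  then show "GG X \<ge> GG (p U) + (1 / \<eta>\<^sub>x) *\<^sub>R (U - p U) \<bullet> (X - p U)"
    by (simp add: GG_def inner_vec_def sum.distrib)
qed

lemma prox_rows_h:
  defines "p \<equiv> \<lambda>U. prox_rows (\<lambda>v. ereal (1 / (4 * L)) * h v) U"
  shows "p U \<in> KK" and "Y \<in> KK \<Longrightarrow> HH Y \<ge> HH (p U) + (4 * L) *\<^sub>R (U - p U) \<bullet> (Y - p U)"
proof -
  have "1 / (4 * L) > 0" using L_pos by simp
  note pv = prox_variational[OF h_convex y0 this]
  show "p U \<in> KK" unfolding KK_def p_def prox_rows_def using pv(1) by simp
  assume "Y \<in> KK"
  then have "HH Y \<ge> (\<Sum>i\<in>UNIV. real_of_ereal (h (p U $ i)) + (1 / (1 / (4 * L))) *\<^sub>R (U $ i - p U $ i) \<bullet> (Y $ i - p U $ i))"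
    unfolding HH_def p_def prox_rows_def vec_lambda_beta KK_def by (intro sum_mono pv(2)) simp
  then show "HH Y \<ge> HH (p U) + (4 * L) *\<^sub>R (U - p U) \<bullet> (Y - p U)"
    by (simp add: HH_def inner_vec_def sum.distrib)
qed

lemmas step_sizes = step_size_bounds[OF L_pos kappa_ge_1 W_gap(1) L_P_def eta_x_def eta_Lambda_def]

lemma GG_JJ:
  assumes "X \<in> CC"
  shows "JJ X \<in> CC" "GG (JJ X) \<le> GG X"
  using closed_convex_fun_row_mean[OF g_convex, of X] assms
  by (auto simp: CC_def JJ_def GG_def all_rows_def)

lemma vrlm_pathI:
  assumes X0: "X 0 = all_rows x0" and Y0: "Y 0 = all_rows y0"
    and Vx0: "Vx 0 = Dx 0" and Vx: "\<And>t. Vx (Suc t) = W ** (Vx t + Dx (Suc t) - Dx t)"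
    and Vy: "\<And>t. Vy t = Dy t - (L * sqrt (real CARD('m)) / 2) *\<^sub>R (transpose (W - mat 1) ** \<Lambda> t)"
    and \<Lambda>: "\<And>t. \<Lambda> (Suc t) = \<Lambda> t + (L * \<eta>\<^sub>\<Lambda> / (2 * sqrt (real CARD('m)))) *\<^sub>R ((W - mat 1) ** Y t)"
    and X: "\<And>t. X (Suc t) = prox_rows (\<lambda>v. ereal \<eta>\<^sub>x * g v) (W ** X t - \<eta>\<^sub>x *\<^sub>R Vx t)"
    and Y: "\<And>t. Y (Suc t) = prox_rows (\<lambda>v. ereal (1 / (4 * L)) * h v) (Y t + (1 / (4 * L)) *\<^sub>R Vy t)"
  shows "vrlm_path FF FFX FFY HH KK BB BB' YY L \<mu> \<kappa> JJ (\<lambda>X. W ** X) GG CC X Vx Dx Y Dy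
    (\<lambda>t. scaled (\<Lambda> t)) \<rho> \<eta>\<^sub>x \<eta>\<^sub>\<Lambda>"
proof (rule vrlm_path.intro[OF saddle_axioms vrlm_path_axioms.intro])
  let ?s = "sqrt (real CARD('m))"
  show "linear JJ" unfolding JJ_def using linear_compose[OF linear_row_mean linear_all_rows] by (simp add: comp_def)
  show "JJ (JJ X) = JJ X" for X by (simp add: JJ_def row_mean_all_rows)
  show "JJ X \<bullet> X' = X \<bullet> JJ X'" for X X'
    unfolding JJ_def inner_commute[of X] all_rows_inner by (simp add: inner_commute)
  show "JJ (W ** X) = JJ X" for X by (simp add: JJ_def row_mean_W)
  show "norm (W ** X - JJ X) \<le> \<rho> * norm (X - JJ X)" for X by (rule W_contraction)
  show "0 \<le> \<rho>" by (rule rho_nonneg)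
  show "\<rho> < 1" by (rule W_gap)
  show "JJ X \<in> CC" "GG (JJ X) \<le> GG X" if "X \<in> CC" for X using that by (rule GG_JJ)+
  show "X t \<in> CC" for t
    by (cases t) (simp_all add: X0 X prox_rows_g(1) step_sizes, simp add: CC_def all_rows_def x0)
  show "Y t \<in> KK" for t
    by (cases t) (simp_all only: Y0 Y prox_rows_h(1), simp add: KK_def all_rows_def y0)
  show "Vx 0 = Dx 0" "Vx (Suc t) = W ** (Vx t + Dx (Suc t) - Dx t)" for t by (rule Vx0 Vx)+
  show "?s *\<^sub>R \<Lambda> (Suc t) = ?s *\<^sub>R \<Lambda> t - \<eta>\<^sub>\<Lambda> *\<^sub>R BB (Y t)" for t
    by (simp add: \<Lambda> BB_def scaleR_add_right)
  show "GG (X (Suc t)) + (1 / \<eta>\<^sub>x) *\<^sub>R (W ** X t - \<eta>\<^sub>x *\<^sub>R Vx t - X (Suc t)) \<bullet> (Z - X (Suc t)) \<le> GG Z"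
    if "Z \<in> CC" for Z t
    unfolding X by (rule prox_rows_g(2)[OF step_sizes(1) that])
  show "HH (Y (Suc t)) + (4 * L) *\<^sub>R (Y t + (1 / (4 * L)) *\<^sub>R (Dy t + BB' (?s *\<^sub>R \<Lambda> t)) - Y (Suc t)) \<bullet> (Z - Y (Suc t)) \<le> HH Z"
    if "Z \<in> KK" for Z t
  proof -
    have "Dy t + BB' (?s *\<^sub>R \<Lambda> t) = Vy t"
      by (simp add: Vy BB'_def linear_scale[OF linear_matrix_matrix_mult] mult_ac)
    then show ?thesis unfolding Y using prox_rows_h(2)[OF that] by simp
  qed
qed (use step_sizes in auto)

end

section \<open>Second moment of a fresh minibatch\<close>

context prob_space
begin

lemma integrable_simple:
  fixes f :: "'a \<Rightarrow> 'b::{banach, second_countable_topology}"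
  assumes "simple_function M f"
  shows "integrable M f"
  using assms by (rule integrable_simple_function) simp

lemma expectation_diagonal_le:
  fixes \<Psi> :: "'a \<Rightarrow> 'a \<Rightarrow> real" and b :: "'a \<Rightarrow> real"
  assumes A: "simple_function M A"
    and cong: "\<And>w w'. w \<in> space M \<Longrightarrow> w' \<in> space M \<Longrightarrow> A w = A w' \<Longrightarrow> \<Psi> w = \<Psi> w' \<and> b w = b w'"
    and ind: "\<And>w0. w0 \<in> space M \<Longrightarrow> indep_var borel (\<lambda>w. indicator {A w0} (A w)) borel (\<Psi> w0)"
    and int: "\<And>w0. w0 \<in> space M \<Longrightarrow> integrable M (\<Psi> w0)"
    and le: "\<And>w0. w0 \<in> space M \<Longrightarrow> (\<integral>w. \<Psi> w0 w \<partial>M) \<le> b w0"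
  shows "(\<integral>w. \<Psi> w w \<partial>M) \<le> (\<integral>w. b w \<partial>M)"
proof -
  define R where "R = A ` space M"
  have finR: "finite R" unfolding R_def using A by (rule simple_functionD)
  define pt where "pt = inv_into (space M) A"
  have pt: "pt a \<in> space M" "A (pt a) = a" if "a \<in> R" for a
    using that unfolding pt_def R_def by (auto intro: inv_into_into f_inv_into_f)
  let ?I = "\<lambda>a w. indicator {a} (A w) :: real"
  have sum_I: "(\<Sum>a\<in>R. ?I a w * x a) = x (A w)" if "w \<in> space M" for w and x :: "_ \<Rightarrow> real"
  proof -
    have "(\<Sum>a\<in>R. ?I a w * x a) = (\<Sum>a\<in>R. if a = A w then x a else 0)"
      by (intro sum.cong) (auto simp: indicator_def)
    then show ?thesis using that finR by (simp add: R_def)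
  qed
  have intI: "integrable M (?I a)" for a
    by (rule integrable_simple, rule simple_function_compose1[OF A])
  have prod: "integrable M (\<lambda>w. ?I a w * \<Psi> (pt a) w)"
    "(\<integral>w. ?I a w * \<Psi> (pt a) w \<partial>M) = (\<integral>w. ?I a w \<partial>M) * (\<integral>w. \<Psi> (pt a) w \<partial>M)" if "a \<in> R" for a
    using indep_var_integrable[OF ind[OF pt(1)[OF that]]] indep_var_lebesgue_integral[OF ind[OF pt(1)[OF that]]]
      intI int[OF pt(1)[OF that]] pt(2)[OF that] by simp_all
  have "(\<integral>w. \<Psi> w w \<partial>M) = (\<integral>w. (\<Sum>a\<in>R. ?I a w * \<Psi> (pt a) w) \<partial>M)"
  proof (rule Bochner_Integration.integral_cong)
    fix w assume w: "w \<in> space M"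
    then have "A w \<in> R" by (simp add: R_def)
    then have "\<Psi> (pt (A w)) = \<Psi> w" using cong[OF pt(1) w pt(2)] by blast
    then show "\<Psi> w w = (\<Sum>a\<in>R. ?I a w * \<Psi> (pt a) w)" using sum_I[OF w, of "\<lambda>a. \<Psi> (pt a) w"] by simp
  qed simp
  also have "\<dots> = (\<Sum>a\<in>R. (\<integral>w. ?I a w \<partial>M) * (\<integral>w. \<Psi> (pt a) w \<partial>M))"
    using prod by (subst Bochner_Integration.integral_sum) auto
  also have "\<dots> \<le> (\<Sum>a\<in>R. (\<integral>w. ?I a w \<partial>M) * b (pt a))"
    using le pt by (intro sum_mono mult_left_mono) auto
  also have "\<dots> = (\<integral>w. (\<Sum>a\<in>R. ?I a w * b (pt a)) \<partial>M)"
    using intI by (subst Bochner_Integration.integral_sum) auto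
  also have "\<dots> = (\<integral>w. b w \<partial>M)"
  proof (rule Bochner_Integration.integral_cong)
    fix w assume w: "w \<in> space M"
    then have "A w \<in> R" by (simp add: R_def)
    then have "b (pt (A w)) = b w" using cong[OF pt(1) w pt(2)] by blast
    then show "(\<Sum>a\<in>R. ?I a w * b (pt a)) = b w" using sum_I[OF w, of "\<lambda>a. b (pt a)"] by simp
  qed simp
  finally show ?thesis .
qed

lemma integral_sample:
  fixes \<phi> :: "'x \<Rightarrow> 'c::{banach, second_countable_topology}"
  assumes "simple_function M X" "distr M (count_space UNIV) X = measure_pmf D"
  shows "(\<integral>w. \<phi> (X w) \<partial>M) = measure_pmf.expectation D \<phi>"
  unfolding assms(2)[symmetric]
  by (subst integral_distr) (auto intro: measurable_simple_function assms(1))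

lemma simple_function_finite_space:
  assumes "f \<in> measurable M N" "finite (space N)" "\<And>x. x \<in> space N \<Longrightarrow> {x} \<in> sets N"
  shows "simple_function M f"
  unfolding simple_function_def
proof
  show "finite (f ` space M)"
    using measurable_space[OF assms(1)] by (intro finite_subset[OF _ assms(2)]) auto
  show "\<forall>x\<in>f ` space M. f -` {x} \<inter> space M \<in> sets M"
    using measurable_space[OF assms(1)] by (auto intro!: measurable_sets[OF assms(1)] assms(3))
qed

lemma minibatch_second_moment:
  fixes z :: "'x \<Rightarrow> 'b::euclidean_space" and s :: "nat \<Rightarrow> 'a \<Rightarrow> 'x"
  assumes fin: "finite (set_pmf D)" and n: "n \<ge> 1"
    and iv: "indep_vars (\<lambda>k. count_space (set_pmf D)) s {..<n}"
    and dist: "\<And>k. k < n \<Longrightarrow> distr M (count_space UNIV) (s k) = measure_pmf D"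
    and mean: "measure_pmf.expectation D z = 0"
    and var: "measure_pmf.expectation D (\<lambda>x. (norm (z x))\<^sup>2) \<le> v"
  shows "(\<integral>w. (norm (u + (1 / real n) *\<^sub>R (\<Sum>k<n. z (s k w))))\<^sup>2 \<partial>M) \<le> (norm u)\<^sup>2 + v / real n"
proof -
  have rv: "s k \<in> measurable M (count_space (set_pmf D))" if "k < n" for k
    using iv that unfolding indep_vars_def by auto
  have sf: "simple_function M (s k)" if "k < n" for k
    using rv[OF that] by (rule simple_function_finite_space) (use fin in auto)
  have int: "integrable M (\<lambda>w. \<phi> (s k w))" if "k < n" for k and \<phi> :: "'x \<Rightarrow> real"
    by (rule integrable_simple, rule simple_function_compose1[OF sf[OF that]])
  have zint: "integrable M (\<lambda>w. z (s k w))" if "k < n" for k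
    by (rule integrable_simple, rule simple_function_compose1[OF sf[OF that]])
  have inner0: "(\<integral>w. z (s k w) \<bullet> x \<partial>M) = 0" if "k < n" for k x
    using zint[OF that] integral_sample[OF sf[OF that] dist[OF that], of z] mean
    by (subst integral_inner_left) auto
  have cross: "(\<integral>w. z (s k w) \<bullet> z (s l w) \<partial>M) = 0" if kl: "k < n" "l < n" "k \<noteq> l" for k l
  proof -
    have ind: "indep_var borel (\<lambda>w. z (s k w) \<bullet> b) borel (\<lambda>w. z (s l w) \<bullet> b)" for b
    proof -
      have iv2: "indep_var (PiM {k} (\<lambda>k. count_space (set_pmf D))) (\<lambda>w. restrict (\<lambda>i. s i w) {k})
          (PiM {l} (\<lambda>k. count_space (set_pmf D))) (\<lambda>w. restrict (\<lambda>i. s i w) {l})"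
        using kl by (intro indep_var_restrict[OF iv]) auto
      have meas: "(\<lambda>f. z (f j) \<bullet> b) \<in> borel_measurable (PiM {j} (\<lambda>k. count_space (set_pmf D)))" for j
        by (rule measurable_compose[OF measurable_component_singleton]) auto
      show ?thesis
        using indep_var_compose[OF iv2 meas meas] by (simp add: comp_def)
    qed
    have "(\<integral>w. z (s k w) \<bullet> z (s l w) \<partial>M)
        = (\<integral>w. (\<Sum>b\<in>Basis. (z (s k w) \<bullet> b) * (z (s l w) \<bullet> b)) \<partial>M)"
      by (subst euclidean_inner) simp
    also have "\<dots> = (\<Sum>b\<in>Basis. (\<integral>w. (z (s k w) \<bullet> b) * (z (s l w) \<bullet> b) \<partial>M))"
      using kl by (intro Bochner_Integration.integral_sum integrable_simple
          simple_function_compose2[OF sf sf, where h = "\<lambda>x y. (z x \<bullet> _) * (z y \<bullet> _)"])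
    also have "\<dots> = 0"
      using indep_var_lebesgue_integral[OF ind int[OF kl(1)] int[OF kl(2)]] inner0 kl by simp
    finally show ?thesis .
  qed
  have "(norm (u + (1 / real n) *\<^sub>R (\<Sum>k<n. z (s k w))))\<^sup>2
      = (norm u)\<^sup>2 + (\<Sum>k<n. 2 / real n * (z (s k w) \<bullet> u))
        + (\<Sum>k<n. \<Sum>l<n. (1 / real n)\<^sup>2 * (z (s l w) \<bullet> z (s k w)))" for w
  proof -
    have "(norm (u + c *\<^sub>R S))\<^sup>2 = (norm u)\<^sup>2 + 2 * c * (S \<bullet> u) + c\<^sup>2 * (S \<bullet> S)" for c S
      unfolding power2_norm_eq_inner
      by (simp add: inner_add_left inner_add_right inner_commute[of u S] power2_eq_square distrib_left)
    then show ?thesis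
      by (simp only: inner_sum_left inner_sum_right sum_distrib_left mult_1_right times_divide_eq_right)
  qed
  then have "(\<integral>w. (norm (u + (1 / real n) *\<^sub>R (\<Sum>k<n. z (s k w))))\<^sup>2 \<partial>M)
      = (\<integral>w. (norm u)\<^sup>2 + (\<Sum>k<n. 2 / real n * (z (s k w) \<bullet> u))
        + (\<Sum>k<n. \<Sum>l<n. (1 / real n)\<^sup>2 * (z (s l w) \<bullet> z (s k w))) \<partial>M)"
    by simp
  also have "\<dots> = (norm u)\<^sup>2 + (\<Sum>k<n. 2 / real n * (\<integral>w. z (s k w) \<bullet> u \<partial>M))
        + (\<Sum>k<n. \<Sum>l<n. (1 / real n)\<^sup>2 * (\<integral>w. z (s l w) \<bullet> z (s k w) \<partial>M))"
  proof -
    have i1: "integrable M (\<lambda>w. 2 / real n * (z (s k w) \<bullet> u))" if "k \<in> {..<n}" for k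
      using that by (intro integrable_simple simple_function_compose1[OF sf, where g = "\<lambda>x. 2 / real n * (z x \<bullet> u)"]) simp
    have i2: "integrable M (\<lambda>w. (1 / real n)\<^sup>2 * (z (s l w) \<bullet> z (s k w)))" if "k \<in> {..<n}" "l \<in> {..<n}" for k l
      using that by (intro integrable_simple simple_function_compose2[OF sf sf, where h = "\<lambda>x y. (1 / real n)\<^sup>2 * (z y \<bullet> z x)"]) auto
    have s1: "integrable M (\<lambda>w. \<Sum>k<n. 2 / real n * (z (s k w) \<bullet> u))"
      by (rule Bochner_Integration.integrable_sum) (rule i1)
    have i3: "integrable M (\<lambda>w. \<Sum>l<n. (1 / real n)\<^sup>2 * (z (s l w) \<bullet> z (s k w)))" if "k \<in> {..<n}" for k
      by (rule Bochner_Integration.integrable_sum) (rule i2[OF that])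
    have s2: "integrable M (\<lambda>w. \<Sum>k<n. \<Sum>l<n. (1 / real n)\<^sup>2 * (z (s l w) \<bullet> z (s k w)))"
      by (rule Bochner_Integration.integrable_sum) (rule i3)
    have e1: "(\<integral>w. (\<Sum>k<n. 2 / real n * (z (s k w) \<bullet> u)) \<partial>M)
        = (\<Sum>k<n. 2 / real n * (\<integral>w. z (s k w) \<bullet> u \<partial>M))"
      using i1 by (subst Bochner_Integration.integral_sum) auto
    have e2: "(\<integral>w. (\<Sum>l<n. (1 / real n)\<^sup>2 * (z (s l w) \<bullet> z (s k w))) \<partial>M)
        = (\<Sum>l<n. (1 / real n)\<^sup>2 * (\<integral>w. z (s l w) \<bullet> z (s k w) \<partial>M))" if "k \<in> {..<n}" for k
      using i2[OF that] by (subst Bochner_Integration.integral_sum) auto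
    have e3: "(\<integral>w. (\<Sum>k<n. \<Sum>l<n. (1 / real n)\<^sup>2 * (z (s l w) \<bullet> z (s k w))) \<partial>M)
        = (\<Sum>k<n. \<Sum>l<n. (1 / real n)\<^sup>2 * (\<integral>w. z (s l w) \<bullet> z (s k w) \<partial>M))"
      using i3 e2 by (subst Bochner_Integration.integral_sum) auto
    have c: "integrable M (\<lambda>w. (norm u)\<^sup>2)" by simp
    show ?thesis
      unfolding Bochner_Integration.integral_add[OF Bochner_Integration.integrable_add[OF c s1] s2]
        Bochner_Integration.integral_add[OF c s1] e1 e3
      by (simp add: prob_space)
  qed
  also have "\<dots> = (norm u)\<^sup>2 + (\<Sum>k<n. (1 / real n)\<^sup>2 * (\<integral>w. (norm (z (s k w)))\<^sup>2 \<partial>M))"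
  proof -
    have "(\<Sum>l<n. (1 / real n)\<^sup>2 * (\<integral>w. z (s l w) \<bullet> z (s k w) \<partial>M))
        = (\<Sum>l<n. if l = k then (1 / real n)\<^sup>2 * (\<integral>w. z (s k w) \<bullet> z (s k w) \<partial>M) else 0)" if "k < n" for k
      by (intro sum.cong refl) (use cross that in auto)
    then show ?thesis using inner0 by (simp add: power2_norm_eq_inner)
  qed
  also have "\<dots> \<le> (norm u)\<^sup>2 + (\<Sum>k<n. (1 / real n)\<^sup>2 * v)"
    using var integral_sample[OF sf dist, where \<phi> = "\<lambda>x. (norm (z x))\<^sup>2"] by (intro add_left_mono sum_mono mult_left_mono) auto
  also have "\<dots> = (norm u)\<^sup>2 + v / real n"
    using n by (simp add: power2_eq_square)
  finally show ?thesis .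
qed

lemma block_space_finite:
  assumes "finite J" "\<And>i. finite (set_pmf (D i))"
  shows "finite (space (block_space D J))" and "a \<in> space (block_space D J) \<Longrightarrow> {a} \<in> sets (block_space D J)"
proof -
  show "finite (space (block_space D J))"
    unfolding block_space_def space_PiM using assms by (intro finite_PiE) (auto split: prod.split)
  assume a: "a \<in> space (block_space D J)"
  then have "{a} = PiE J (\<lambda>j. {a j})"
    unfolding block_space_def space_PiM by (subst PiE_singleton) (auto simp: PiE_def)
  also have "\<dots> \<in> sets (block_space D J)"
    unfolding block_space_def using a assms(1)
    by (intro sets_PiM_I_finite) (auto simp: block_space_def space_PiM PiE_def Pi_def split: prod.splits)
  finally show "{a} \<in> sets (block_space D J)" .
qed

lemma fresh_minibatch_second_moment:
  fixes U :: "'a \<Rightarrow> 'b::euclidean_space" and Z :: "'a \<Rightarrow> 'x \<Rightarrow> 'b"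
  assumes fin: "finite past" "\<And>i. finite (set_pmf (D i))" and n: "n \<ge> 1"
    and iv: "indep_vars (\<lambda>k. count_space (set_pmf (D i))) (\<lambda>k. s t i k) {..<n}"
    and dist: "\<And>k. k < n \<Longrightarrow> distr M (count_space UNIV) (s t i k) = measure_pmf (D i)"
    and fresh: "indep_var (block_space D past) (sample_block s past)
      (block_space D ({t} \<times> {i} \<times> {..<n})) (sample_block s ({t} \<times> {i} \<times> {..<n}))"
    and adapted: "\<And>w w'. w \<in> space M \<Longrightarrow> w' \<in> space M
      \<Longrightarrow> (\<And>r j k. (r, j, k) \<in> past \<Longrightarrow> s r j k w = s r j k w') \<Longrightarrow> U w = U w' \<and> Z w = Z w' \<and> v w = v w'"
    and mean: "\<And>w. w \<in> space M \<Longrightarrow> measure_pmf.expectation (D i) (Z w) = 0"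
    and var: "\<And>w. w \<in> space M \<Longrightarrow> measure_pmf.expectation (D i) (\<lambda>x. (norm (Z w x))\<^sup>2) \<le> v w"
  shows "(\<integral>w. (norm (U w + (1 / real n) *\<^sub>R (\<Sum>k<n. Z w (s t i k w))))\<^sup>2 \<partial>M)
    \<le> (\<integral>w. (norm (U w))\<^sup>2 + v w / real n \<partial>M)"
proof -
  let ?A = "sample_block s past" and ?batch = "{t} \<times> {i} \<times> {..<n}"
  define \<psi> where "\<psi> w0 \<beta> = (norm (U w0 + (1 / real n) *\<^sub>R (\<Sum>k<n. Z w0 (\<beta> (t, i, k)))))\<^sup>2"
    for w0 and \<beta> :: "nat \<times> 'c \<times> nat \<Rightarrow> 'x"
  have rv: "?A \<in> measurable M (block_space D past)"
    "sample_block s ?batch \<in> measurable M (block_space D ?batch)"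
    using indep_var_rv1[OF fresh] indep_var_rv2[OF fresh] by auto
  have \<psi>_batch: "\<psi> w0 (sample_block s ?batch w)
      = (norm (U w0 + (1 / real n) *\<^sub>R (\<Sum>k<n. Z w0 (s t i k w))))\<^sup>2" for w0 w
    by (simp add: \<psi>_def sample_block_def)
  have A: "simple_function M ?A"
    using rv(1) by (rule simple_function_finite_space) (use block_space_finite[OF fin] in auto)
  have S: "simple_function M (sample_block s ?batch)"
    using rv(2) by (rule simple_function_finite_space) (use block_space_finite[of ?batch D] fin in auto)
  have meas: "\<psi> w0 \<in> borel_measurable (block_space D ?batch)" for w0
  proof -
    have "(\<lambda>\<beta>. Z w0 (\<beta> (t, i, k))) \<in> borel_measurable (block_space D ?batch)" if "k \<in> {..<n}" for k
      unfolding block_space_def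
      by (rule measurable_compose[OF measurable_component_singleton]) (use that in auto)
    then show ?thesis
      unfolding \<psi>_def by (intro borel_measurable_power borel_measurable_norm borel_measurable_add
          borel_measurable_const borel_measurable_scaleR borel_measurable_sum) auto
  qed
  have "(\<integral>w. \<psi> w (sample_block s ?batch w) \<partial>M) \<le> (\<integral>w. (norm (U w))\<^sup>2 + v w / real n \<partial>M)"
  proof (rule expectation_diagonal_le[where A = ?A and \<Psi> = "\<lambda>w0 w. \<psi> w0 (sample_block s ?batch w)"])
    show "simple_function M ?A" by (rule A)
    fix w w' assume *: "w \<in> space M" "w' \<in> space M" "?A w = ?A w'"
    have "s r j k w = s r j k w'" if "(r, j, k) \<in> past" for r j k
      using fun_cong[OF *(3), of "(r, j, k)"] that by (simp add: sample_block_def)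
    from adapted[OF *(1,2) this]
    show "(\<lambda>x. \<psi> w (sample_block s ?batch x)) = (\<lambda>x. \<psi> w' (sample_block s ?batch x))
        \<and> (norm (U w))\<^sup>2 + v w / real n = (norm (U w'))\<^sup>2 + v w' / real n"
      by (auto simp: \<psi>_def)
  next
    fix w0 assume w: "w0 \<in> space M"
    have "{?A w0} \<in> sets (block_space D past)"
      by (rule block_space_finite(2)[OF fin measurable_space[OF rv(1) w]])
    then have "indicator {?A w0} \<in> borel_measurable (block_space D past)" by simp
    from indep_var_compose[OF fresh this meas]
    show "indep_var borel (\<lambda>w. indicator {?A w0} (?A w) :: real) borel (\<lambda>w. \<psi> w0 (sample_block s ?batch w))"
      by (simp add: comp_def)
    show "integrable M (\<lambda>w. \<psi> w0 (sample_block s ?batch w))"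
      by (rule integrable_simple, rule simple_function_compose1[OF S])
    show "(\<integral>w. \<psi> w0 (sample_block s ?batch w) \<partial>M) \<le> (norm (U w0))\<^sup>2 + v w0 / real n"
      unfolding \<psi>_batch
      by (rule minibatch_second_moment[OF fin(2) n iv dist mean[OF w] var[OF w]])
  qed
  then show ?thesis unfolding \<psi>_batch .
qed

end

section \<open>Summation of the expected descent\<close>

text \<open>
  The variance of the recursive estimator grows by at most \<open>c / q * R t\<close> per step and is reset every
  \<open>q\<close> steps; the additional term \<open>(q - T mod q) * e T\<close> makes the bound inductive.
\<close>

lemma spider_sum:
  fixes e R :: "nat \<Rightarrow> real"
  assumes q: "q \<ge> 1" and reset: "\<And>t. t mod q = 0 \<Longrightarrow> e t = 0"
    and step: "\<And>t. Suc t mod q \<noteq> 0 \<Longrightarrow> e (Suc t) \<le> e t + c / real q * R t"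
    and nn: "\<And>t. 0 \<le> c * R t"
  shows "(\<Sum>u<T. e u) + real (q - T mod q) * e T \<le> c * (\<Sum>u<T. R u)"
proof (induction T)
  case 0
  then show ?case using reset[of 0] by simp
next
  case (Suc T)
  define j where "j = T mod q"
  have j: "j < q" using q by (simp add: j_def)
  show ?case
  proof (cases "Suc T mod q = 0")
    case True
    then have "Suc j = q" using q by (simp add: j_def mod_Suc split: if_splits)
    then have "real (q - j) = 1" by auto
    then show ?thesis
      using Suc True reset[OF True] nn[of T] unfolding j_def[symmetric] by (simp add: distrib_left)
  next
    case False
    then have m: "Suc T mod q = Suc j" by (simp add: j_def mod_Suc split: if_splits)
    have "real (q - Suc j) * e (Suc T) \<le> real (q - Suc j) * (e T + c / real q * R T)"
      by (intro mult_left_mono step False) simp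
    also have "\<dots> = real (q - Suc j) * e T + real (q - Suc j) / real q * (c * R T)"
      by (simp add: distrib_left)
    also have "real (q - Suc j) / real q * (c * R T) \<le> 1 * (c * R T)"
      using q nn by (intro mult_right_mono) (auto simp: divide_le_eq_1)
    finally have "real (q - Suc j) * e (Suc T) \<le> real (q - Suc j) * e T + c * R T" by simp
    moreover have "real (q - j) * e T = real (q - Suc j) * e T + e T"
      using j by (simp add: of_nat_diff algebra_simps)
    ultimately show ?thesis
      using Suc unfolding m j_def[symmetric] by (simp add: distrib_left)
  qed
qed

lemma spider_sum_le:
  fixes e R :: "nat \<Rightarrow> real"
  assumes q: "q \<ge> 1" and reset: "\<And>t. t mod q = 0 \<Longrightarrow> e t = 0"
    and step: "\<And>t. Suc t mod q \<noteq> 0 \<Longrightarrow> e (Suc t) \<le> e t + c / real q * R t"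
    and nn: "\<And>t. 0 \<le> c * R t" and e: "\<And>t. 0 \<le> e t"
  shows "(\<Sum>u<T. e u) \<le> c * (\<Sum>u<T. R u)" and "(\<Sum>u<T. e (Suc u)) \<le> c * (\<Sum>u<T. R u)"
proof -
  have main: "(\<Sum>u<T. e u) + real (q - T mod q) * e T \<le> c * (\<Sum>u<T. R u)"
    by (rule spider_sum[where e = e and R = R, OF q reset step nn])
  have "T mod q < q" using q by simp
  then have "1 * e T \<le> real (q - T mod q) * e T" by (intro mult_right_mono e) auto
  then have *: "(\<Sum>u<T. e u) + e T \<le> c * (\<Sum>u<T. R u)" using main by simp
  then show "(\<Sum>u<T. e u) \<le> c * (\<Sum>u<T. R u)" using e[of T] by linarith
  have "(\<Sum>u<T. e (Suc u)) = (\<Sum>u<Suc T. e u) - e 0" by (subst sum.lessThan_Suc_shift) simp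
  then show "(\<Sum>u<T. e (Suc u)) \<le> c * (\<Sum>u<T. R u)" using * e[of 0] by simp
qed

lemma descent_summable:
  fixes y p l s b v e R :: "nat \<Rightarrow> real"
  assumes nn: "\<And>t. 0 \<le> p t" "\<And>t. 0 \<le> l t" "\<And>t. 0 \<le> s t" "\<And>t. 0 \<le> b t" "\<And>t. 0 \<le> v t" "\<And>t. 0 \<le> e t"
    and b0: "b 0 = 0" and low: "\<And>t. m \<le> y t"
    and pos: "0 < \<eta>" "0 < \<theta>" "0 < w" "0 < L" "0 < r"
    and w1: "w * \<eta> * L \<le> 1 / 235" and w2: "w * \<eta> * L \<le> 3 / 1000 * r"
    and step: "\<And>t. y (Suc t) + (1 / 3 * (p t / \<eta>) + 12 / 25 * (l t / \<theta>) + 3 / 2 * (w * L * s t)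
        + 9 / 20 * (r * b (Suc t) / \<eta>) + \<eta> * v t / (2 * r))
      \<le> y t + 51 / 1000 * (r * b t / \<eta>) + w / L * (109 / 100 * e t + 3 / 10 * e (Suc t))"
    and R: "\<And>t. R t \<le> p t + 2 * b (Suc t) + 2 * b t + s t"
    and e: "\<And>T. (\<Sum>u<T. e u) \<le> L\<^sup>2 * (\<Sum>u<T. R u)" "\<And>T. (\<Sum>u<T. e (Suc u)) \<le> L\<^sup>2 * (\<Sum>u<T. R u)"
  shows "p \<longlonglongrightarrow> 0" "l \<longlonglongrightarrow> 0" "s \<longlonglongrightarrow> 0" "b \<longlonglongrightarrow> 0" "v \<longlonglongrightarrow> 0" "e \<longlonglongrightarrow> 0"
proof -
  define A where "A f = (\<lambda>T. \<Sum>t<T. f t)" for f :: "nat \<Rightarrow> real"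
  note A = A_def
  have Ann: "0 \<le> A f T" if "\<And>t. 0 \<le> f t" for f T unfolding A using that by (simp add: sum_nonneg)
  define b' where "b' t = b (Suc t)" for t
  have A_b: "A b T \<le> A b' T" for T
  proof -
    have "A b' T = A b (Suc T)"
      unfolding A b'_def by (subst sum.lessThan_Suc_shift) (simp add: b0)
    then show ?thesis using nn(4)[of T] by (simp add: A)
  qed
  have A_R: "A R T \<le> A p T + 4 * A b' T + A s T" for T
  proof -
    have "A R T \<le> (\<Sum>t<T. p t + 2 * b' t + 2 * b t + s t)" unfolding A b'_def by (intro sum_mono R)
    also have "\<dots> = A p T + 2 * A b' T + 2 * A b T + A s T"
      by (simp add: A sum.distrib sum_distrib_left)
    finally show ?thesis using A_b[of T] by simp
  qed
  have A_e: "A e T \<le> L\<^sup>2 * A R T" "A (\<lambda>t. e (Suc t)) T \<le> L\<^sup>2 * A R T" for T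
    unfolding A by (rule e)+
  have tele: "y T + 1 / 3 * (A p T / \<eta>) + 12 / 25 * (A l T / \<theta>) + 3 / 2 * (w * L * A s T)
        + 9 / 20 * (r * A b' T / \<eta>) + \<eta> * A v T / (2 * r)
      \<le> y 0 + 51 / 1000 * (r * A b T / \<eta>) + w / L * (109 / 100 * A e T + 3 / 10 * A (\<lambda>t. e (Suc t)) T)" for T
  proof (induction T)
    case 0
    then show ?case by (simp add: A)
  next
    case (Suc T)
    have S: "A f (Suc T) = A f T + f T" for f by (simp add: A)
    show ?case
      using Suc step[of T] unfolding S b'_def
      by (simp add: distrib_left add_divide_distrib)
  qed
  define D where "D T = 3 / 10 * (A p T / \<eta>) + 12 / 25 * (A l T / \<theta>) + 1 / 10 * (w * L * A s T)
      + 3 / 10 * (r * A b' T / \<eta>) + \<eta> * A v T / (2 * r)" for T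
  have main: "D T \<le> y 0 - m" for T
  proof -
    have nA: "0 \<le> A p T" "0 \<le> A s T" "0 \<le> A b' T"
      by (rule Ann, simp add: nn b'_def)+
    have "w / L * (109 / 100 * A e T + 3 / 10 * A (\<lambda>t. e (Suc t)) T) \<le> w / L * (139 / 100 * (L\<^sup>2 * A R T))"
      using A_e[of T] pos by (intro mult_left_mono) auto
    also have "\<dots> = 139 / 100 * (w * L) * A R T" using pos by (simp add: power2_eq_square)
    also have "\<dots> \<le> 139 / 100 * (w * L) * (A p T + 4 * A b' T + A s T)"
      using pos A_R by (intro mult_left_mono) auto
    also have "\<dots> = 139 / 100 * (w * L * A p T) + 139 / 25 * (w * L * A b' T) + 139 / 100 * (w * L * A s T)"
      by (simp add: algebra_simps)
    finally have 1: "w / L * (109 / 100 * A e T + 3 / 10 * A (\<lambda>t. e (Suc t)) T) \<le> \<dots>" .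
    have 2: "w * L * A p T \<le> 1 / 235 * (A p T / \<eta>)"
      using mult_right_mono[OF w1, of "A p T / \<eta>"] nA pos by (simp add: field_simps)
    have 3: "w * L * A b' T \<le> 3 / 1000 * (r * A b' T / \<eta>)"
      using mult_right_mono[OF w2, of "A b' T / \<eta>"] nA pos by (simp add: field_simps)
    have 4: "r * A b T / \<eta> \<le> r * A b' T / \<eta>"
      using A_b[of T] pos by (intro divide_right_mono mult_left_mono) auto
    have 5: "0 \<le> A p T / \<eta>" "0 \<le> r * A b' T / \<eta>" "0 \<le> w * L * A s T"
      using nA pos by auto
    show ?thesis
      unfolding D_def using tele[of T] 1 2 3 4 5 low[of T] by argo
  qed
  have parts: "A p T \<le> (y 0 - m) * (\<eta> * (10 / 3))" (is ?p) "A l T \<le> (y 0 - m) * (\<theta> * (25 / 12))" (is ?l)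
    "A s T \<le> (y 0 - m) * (10 / (w * L))" (is ?s) "A b' T \<le> (y 0 - m) * (10 / 3 * \<eta> / r)" (is ?b)
    "A v T \<le> (y 0 - m) * (2 * r / \<eta>)" (is ?v) for T
  proof -
    have nA: "0 \<le> A p T / \<eta>" "0 \<le> A l T / \<theta>" "0 \<le> w * L * A s T" "0 \<le> r * A b' T / \<eta>" "0 \<le> \<eta> * A v T / (2 * r)"
      using Ann[of p] Ann[of l] Ann[of s] Ann[of b'] Ann[of v] nn pos by (auto simp: b'_def)
    have "3 / 10 * (A p T / \<eta>) \<le> y 0 - m" "12 / 25 * (A l T / \<theta>) \<le> y 0 - m" "1 / 10 * (w * L * A s T) \<le> y 0 - m"
      "3 / 10 * (r * A b' T / \<eta>) \<le> y 0 - m" "\<eta> * A v T / (2 * r) \<le> y 0 - m"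
      using main[of T] nA unfolding D_def by argo+
    then show ?p ?l ?s ?b ?v
      using pos by (simp_all add: field_simps)
  qed
  have sm: "f \<longlonglongrightarrow> 0" if "\<And>t. 0 \<le> f t" "\<And>T. A f T \<le> x" for f x
    using that unfolding A by (intro summable_LIMSEQ_zero summableI_nonneg_bounded)
  show "p \<longlonglongrightarrow> 0" "l \<longlonglongrightarrow> 0" "s \<longlonglongrightarrow> 0" "v \<longlonglongrightarrow> 0"
    using sm[OF nn(1) parts(1)] sm[OF nn(2) parts(2)] sm[OF nn(3) parts(3)] sm[OF nn(5) parts(5)] .
  have "b' \<longlonglongrightarrow> 0" using sm[of b', OF _ parts(4)] nn(4) by (simp add: b'_def)
  then show "b \<longlonglongrightarrow> 0" unfolding b'_def by (rule LIMSEQ_imp_Suc)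
  define x where "x = (y 0 - m) * (\<eta> * (10 / 3)) + 4 * ((y 0 - m) * (10 / 3 * \<eta> / r)) + (y 0 - m) * (10 / (w * L))"
  have "A e T \<le> L\<^sup>2 * x" for T
  proof -
    have "A R T \<le> x" unfolding x_def using A_R[of T] parts[of T] by linarith
    then have "L\<^sup>2 * A R T \<le> L\<^sup>2 * x" by (intro mult_left_mono) auto
    then show ?thesis using A_e(1)[of T] by linarith
  qed
  then show "e \<longlonglongrightarrow> 0" by (rule sm[OF nn(6)])
qed

lemma batch_grad_indexed:
  "batch_grad G (image_mset x (mset_set A)) z = (1 / real (card A)) *\<^sub>R (\<Sum>k\<in>A. G z (x k))"
  by (simp add: batch_grad_def sum_unfold_sum_mset multiset.map_comp comp_def)

lemma batch_grad_full:
  fixes G :: "'z \<Rightarrow> 'x \<Rightarrow> 'b::{banach, second_countable_topology}" and \<xi> :: "'m \<Rightarrow> 'n::finite \<Rightarrow> 'x"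
  shows "batch_grad G (full_batch \<xi> i) z = measure_pmf.expectation (local_dist \<xi> i) (G z)"
proof -
  have "measure_pmf.expectation (local_dist \<xi> i) (G z)
      = measure_pmf.expectation (pmf_of_set UNIV) (\<lambda>j. G z (\<xi> i j))"
    unfolding local_dist_def by simp
  also have "\<dots> = (\<Sum>j\<in>UNIV. pmf (pmf_of_set UNIV) j *\<^sub>R G z (\<xi> i j))"
    by (rule integral_measure_pmf) auto
  finally show ?thesis
    unfolding full_batch_def batch_grad_indexed by (simp add: scaleR_right.sum)
qed

lemma finite_set_pmf_local_dist: "finite (set_pmf (local_dist \<xi> i))"
  by (simp add: local_dist_def)

lemma expectation_centred_sq_le:
  fixes X :: "'x \<Rightarrow> 'b::euclidean_space"
  assumes fin: "finite (set_pmf D)" and a: "measure_pmf.expectation D X = a"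
  shows "measure_pmf.expectation D (\<lambda>x. X x - a) = 0"
    and "measure_pmf.expectation D (\<lambda>x. (norm (X x - a))\<^sup>2) \<le> measure_pmf.expectation D (\<lambda>x. (norm (X x))\<^sup>2)"
proof -
  have int: "integrable (measure_pmf D) X" "integrable (measure_pmf D) (\<lambda>x. (norm (X x))\<^sup>2)"
    "integrable (measure_pmf D) (\<lambda>x. (norm (X x - a))\<^sup>2)"
    by (intro integrable_measure_pmf_finite fin)+
  show "measure_pmf.expectation D (\<lambda>x. X x - a) = 0"
    using int(1) a by simp
  have "measure_pmf.expectation D (\<lambda>x. (norm (X x - a))\<^sup>2)
      = measure_pmf.expectation D (\<lambda>x. (norm (X x))\<^sup>2 - 2 * (X x \<bullet> a) + (norm a)\<^sup>2)"
    by (simp add: power2_norm_eq_inner inner_diff_left inner_diff_right inner_commute algebra_simps)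
  also have "\<dots> = measure_pmf.expectation D (\<lambda>x. (norm (X x))\<^sup>2) - 2 * (a \<bullet> a) + (norm a)\<^sup>2"
    using int(1,2) a by (simp add: integral_inner_left)
  also have "\<dots> \<le> measure_pmf.expectation D (\<lambda>x. (norm (X x))\<^sup>2)"
    by (simp add: power2_norm_eq_inner)
  finally show "measure_pmf.expectation D (\<lambda>x. (norm (X x - a))\<^sup>2) \<le> measure_pmf.expectation D (\<lambda>x. (norm (X x))\<^sup>2)" .
qed

context prob_space
begin

lemma simple_function_determined:
  assumes fin: "finite J" and S: "\<And>j. j \<in> J \<Longrightarrow> simple_function M (S j)"
    and det: "\<And>w w'. w \<in> space M \<Longrightarrow> w' \<in> space M \<Longrightarrow> (\<And>j. j \<in> J \<Longrightarrow> S j w = S j w') \<Longrightarrow> F w = F w'"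
  shows "simple_function M F"
proof -
  define A where "A w = restrict (\<lambda>j. S j w) J" for w
  have A: "simple_function M A"
    unfolding simple_function_def
  proof
    have "A ` space M \<subseteq> PiE J (\<lambda>j. S j ` space M)" by (auto simp: A_def)
    then show "finite (A ` space M)"
      by (rule finite_subset) (intro finite_PiE fin simple_functionD S)
    show "\<forall>a\<in>A ` space M. A -` {a} \<inter> space M \<in> sets M"
    proof
      fix a assume "a \<in> A ` space M"
      then obtain w0 where a: "a = A w0" by blast
      have "A w = a \<longleftrightarrow> (\<forall>j\<in>J. S j w = a j)" for w
      proof
        assume "A w = a"
        then show "\<forall>j\<in>J. S j w = a j" by (auto simp: A_def)
      next
        assume *: "\<forall>j\<in>J. S j w = a j"
        have "S j w = S j w0" if "j \<in> J" for j
          using bspec[OF * that] that by (simp add: a A_def)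
        then show "A w = a" unfolding a by (auto simp: A_def)
      qed
      then have "A -` {a} \<inter> space M = {w \<in> space M. \<forall>j\<in>J. S j w = a j}" by auto
      also have "{w \<in> space M. S j w = a j} = S j -` {a j} \<inter> space M" for j by auto
      then have "{w \<in> space M. \<forall>j\<in>J. S j w = a j} \<in> sets M"
        using simple_functionD(2)[OF S] by (intro sets.sets_Collect_finite_All fin) simp
      finally show "A -` {a} \<inter> space M \<in> sets M" .
    qed
  qed
  have "simple_function M (\<lambda>w. F (inv_into (space M) A (A w)))"
    by (rule simple_function_compose1[OF A])
  moreover have "F (inv_into (space M) A (A w)) = F w" if w: "w \<in> space M" for w
  proof (rule det)
    have mem: "A w \<in> A ` space M" using w by simp
    show "inv_into (space M) A (A w) \<in> space M" by (rule inv_into_into[OF mem])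
    show "w \<in> space M" by (rule w)
    show "S j (inv_into (space M) A (A w)) = S j w" if "j \<in> J" for j
      using fun_cong[OF f_inv_into_f[OF mem], of j] that by (simp add: A_def)
  qed
  ultimately show ?thesis by (subst simple_function_cong) auto
qed

definition vanishing :: "(nat \<Rightarrow> 'a \<Rightarrow> real) \<Rightarrow> bool" where
  "vanishing F \<longleftrightarrow> (\<forall>t. integrable M (F t)) \<and> (\<lambda>t. \<integral>w. F t w \<partial>M) \<longlonglongrightarrow> 0"

lemma vanishing_add: "vanishing F \<Longrightarrow> vanishing F' \<Longrightarrow> vanishing (\<lambda>t w. F t w + F' t w)"
  unfolding vanishing_def using tendsto_add[of "\<lambda>t. \<integral>w. F t w \<partial>M" 0 sequentially "\<lambda>t. \<integral>w. F' t w \<partial>M" 0]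
  by simp

lemma vanishing_cmult: "vanishing F \<Longrightarrow> vanishing (\<lambda>t w. c * F t w)"
  unfolding vanishing_def using tendsto_mult_right_zero[of "\<lambda>t. \<integral>w. F t w \<partial>M" sequentially c]
  by simp

lemma vanishing_prob:
  assumes F: "vanishing F" and \<epsilon>: "\<epsilon> > 0"
    and S: "\<And>t w. w \<in> space M \<Longrightarrow> 0 \<le> S t w \<and> S t w \<le> F t w"
  shows "(\<lambda>t. measure M {w \<in> space M. S t w \<ge> \<epsilon>}) \<longlonglongrightarrow> 0"
proof (rule tendsto_sandwich[OF _ _ tendsto_const])
  have "measure M {w \<in> space M. S t w \<ge> \<epsilon>} \<le> (\<integral>w. F t w \<partial>M) / \<epsilon>" for t
  proof -
    have int: "integrable M (F t)" using F by (simp add: vanishing_def)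
    have "measure M {w \<in> space M. S t w \<ge> \<epsilon>} \<le> measure M {w \<in> space M. F t w \<ge> \<epsilon>}"
      using S int by (intro finite_measure_mono) (auto intro: order_trans)
    also have "\<dots> \<le> (\<integral>w. F t w \<partial>M) / \<epsilon>"
      using S by (intro integral_Markov_inequality_measure[OF int sets.empty_sets] \<epsilon> AE_I2) (blast intro: order_trans)
    finally show ?thesis .
  qed
  then show "\<forall>\<^sub>F t in sequentially. measure M {w \<in> space M. S t w \<ge> \<epsilon>} \<le> (\<integral>w. F t w \<partial>M) / \<epsilon>" by simp
  show "(\<lambda>t. (\<integral>w. F t w \<partial>M) / \<epsilon>) \<longlonglongrightarrow> 0"
    using F \<epsilon> unfolding vanishing_def by (auto intro!: tendsto_eq_intros)
qed simp

end

section \<open>Convergence in probability\<close>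

locale vrlm_run = vrlm_problem f g h W L \<mu> \<kappa> \<rho> L\<^sub>P \<eta>\<^sub>x \<eta>\<^sub>\<Lambda> x0 y0 + prob_space M
  for f :: "'m::finite \<Rightarrow> (real^'d1) \<times> (real^'d2) \<Rightarrow> real"
    and g h W L \<mu> \<kappa> \<rho> L\<^sub>P \<eta>\<^sub>x \<eta>\<^sub>\<Lambda> x0 y0 and M :: "'w measure" +
  fixes G :: "'m \<Rightarrow> (real^'d1) \<times> (real^'d2) \<Rightarrow> 'xi \<Rightarrow> (real^'d1) \<times> (real^'d2)"
    and \<xi> :: "'m \<Rightarrow> 'n::finite \<Rightarrow> 'xi" and s :: "nat \<Rightarrow> 'm \<Rightarrow> nat \<Rightarrow> 'w \<Rightarrow> 'xi" and q :: nat
    and X V :: "nat \<Rightarrow> 'w \<Rightarrow> real^'d1^'m" and \<Lambda> Y :: "nat \<Rightarrow> 'w \<Rightarrow> real^'d2^'m"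
    and d :: "nat \<Rightarrow> 'w \<Rightarrow> 'm \<Rightarrow> (real^'d1) \<times> (real^'d2)" and phi_star :: real
  assumes phi_lower: "phi L W f g h x \<Lambda>' \<ge> ereal phi_star"
    and unbiased: "measure_pmf.expectation (local_dist \<xi> i) (G i z) = grad (f i) z"
    and mean_square_smooth: "measure_pmf.expectation (local_dist \<xi> i)
        (\<lambda>u. (norm (G i (x, y) u - G i (x', y') u))\<^sup>2) \<le> L\<^sup>2 * ((norm (x - x'))\<^sup>2 + (norm (y - y'))\<^sup>2)"
    and q: "q \<ge> 1" and samples: "spider_samples M (local_dist \<xi>) q q s"
    and init: "w \<in> space M \<Longrightarrow> X 0 w = all_rows x0 \<and> Y 0 w = all_rows y0 \<and> \<Lambda> 0 w = 0"
    and d_0: "w \<in> space M \<Longrightarrow> d 0 w i = batch_grad (G i) (spider_batch \<xi> q q s w 0 i) (X 0 w $ i, Y 0 w $ i)"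
    and d_Suc: "w \<in> space M \<Longrightarrow> d (Suc t) w i = (if Suc t mod q = 0
        then batch_grad (G i) (spider_batch \<xi> q q s w (Suc t) i) (X (Suc t) w $ i, Y (Suc t) w $ i)
        else batch_grad (G i) (spider_batch \<xi> q q s w (Suc t) i) (X (Suc t) w $ i, Y (Suc t) w $ i)
          - batch_grad (G i) (spider_batch \<xi> q q s w (Suc t) i) (X t w $ i, Y t w $ i) + d t w i)"
    and V_0: "w \<in> space M \<Longrightarrow> V 0 w = (\<chi> i. fst (d 0 w i))"
    and V_Suc: "w \<in> space M \<Longrightarrow>
        V (Suc t) w = W ** (V t w + (\<chi> i. fst (d (Suc t) w i)) - (\<chi> i. fst (d t w i)))"
    and \<Lambda>_Suc: "w \<in> space M \<Longrightarrow>
        \<Lambda> (Suc t) w = \<Lambda> t w + (L * \<eta>\<^sub>\<Lambda> / (2 * sqrt (real CARD('m)))) *\<^sub>R ((W - mat 1) ** Y t w)"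
    and X_Suc: "w \<in> space M \<Longrightarrow> X (Suc t) w = prox_rows (\<lambda>v. ereal \<eta>\<^sub>x * g v) (W ** X t w - \<eta>\<^sub>x *\<^sub>R V t w)"
    and Y_Suc: "w \<in> space M \<Longrightarrow> Y (Suc t) w = prox_rows (\<lambda>v. ereal (1 / (4 * L)) * h v)
        (Y t w + (1 / (4 * L)) *\<^sub>R ((\<chi> i. snd (d t w i))
          - (L * sqrt (real CARD('m)) / 2) *\<^sub>R (transpose (W - mat 1) ** \<Lambda> t w)))"
begin

abbreviation z :: "nat \<Rightarrow> 'w \<Rightarrow> 'm \<Rightarrow> (real^'d1) \<times> (real^'d2)" where
  "z t w i \<equiv> (X t w $ i, Y t w $ i)"

lemma is_path:
  assumes "w \<in> space M"
  shows "vrlm_path FF FFX FFY HH KK BB BB' YY L \<mu> \<kappa> JJ (\<lambda>X. W ** X) GG CC (\<lambda>t. X t w) (\<lambda>t. V t w)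
    (\<lambda>t. \<chi> i. fst (d t w i)) (\<lambda>t. Y t w) (\<lambda>t. \<chi> i. snd (d t w i)) (\<lambda>t. scaled (\<Lambda> t w)) \<rho> \<eta>\<^sub>x \<eta>\<^sub>\<Lambda>"
  by (rule vrlm_pathI[where Vy = "\<lambda>t. (\<chi> i. snd (d t w i))
        - (L * sqrt (real CARD('m)) / 2) *\<^sub>R (transpose (W - mat 1) ** \<Lambda> t w)"])
    (use init[OF assms] V_0[OF assms] V_Suc[OF assms] \<Lambda>_Suc[OF assms] X_Suc[OF assms] Y_Suc[OF assms] in auto)

definition state where "state t w = (X t w, \<Lambda> t w, Y t w, d t w, V t w)"

lemma next_iterate_determined:
  assumes "w \<in> space M" "w' \<in> space M" "state t w = state t w'"
  shows "X (Suc t) w = X (Suc t) w'" "Y (Suc t) w = Y (Suc t) w'" "\<Lambda> (Suc t) w = \<Lambda> (Suc t) w'"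
  using assms(3) by (simp_all add: X_Suc Y_Suc \<Lambda>_Suc assms(1,2) state_def)

lemma state_determined:
  assumes w: "w \<in> space M" "w' \<in> space M"
    and agree: "\<And>r j k. r \<le> t \<Longrightarrow> r mod q \<noteq> 0 \<Longrightarrow> k < q \<Longrightarrow> s r j k w = s r j k w'"
  shows "state t w = state t w'"
proof -
  have batch: "spider_batch \<xi> q q s w r i = spider_batch \<xi> q q s w' r i" if "r \<le> t" for r i
    unfolding spider_batch_def using agree[OF that]
    by (auto intro!: image_mset_cong)
  show ?thesis using batch
  proof (induction t)
    case 0
    have "d 0 w = d 0 w'" using 0 init[OF w(1)] init[OF w(2)] by (auto simp: d_0 w)
    then show ?case using init[OF w(1)] init[OF w(2)] by (simp add: state_def V_0 w)
  next
    case (Suc t)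
    then have st: "state t w = state t w'" by simp
    note nxt = next_iterate_determined[OF w st]
    have "d (Suc t) w = d (Suc t) w'"
      using st Suc.prems by (auto simp: d_Suc w nxt state_def fun_eq_iff)
    then show ?case using st by (simp add: state_def nxt V_Suc w)
  qed
qed

definition minibatch_index :: "nat \<Rightarrow> (nat \<times> 'm \<times> nat) set" where
  "minibatch_index t = {(r, j, k). r < t \<and> r mod q \<noteq> 0 \<and> k < q}"

lemma finite_minibatch_index: "finite (minibatch_index t)"
  by (rule finite_subset[of _ "{..<t} \<times> UNIV \<times> {..<q}"]) (auto simp: minibatch_index_def)

lemma samplesD:
  assumes "t mod q \<noteq> 0"
  shows "indep_vars (\<lambda>k. count_space (set_pmf (local_dist \<xi> i))) (\<lambda>k. s t i k) {..<q}"
    and "k < q \<Longrightarrow> distr M (count_space UNIV) (s t i k) = measure_pmf (local_dist \<xi> i)"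
    and "indep_var (block_space (local_dist \<xi>) (minibatch_index t)) (sample_block s (minibatch_index t))
      (block_space (local_dist \<xi>) ({t} \<times> {i} \<times> {..<q})) (sample_block s ({t} \<times> {i} \<times> {..<q}))"
  using samples assms unfolding spider_samples_def Let_def minibatch_index_def by auto

lemma simple_function_sample:
  assumes "t mod q \<noteq> 0" "k < q"
  shows "simple_function M (s t i k)"
proof -
  have "s t i k \<in> measurable M (count_space (set_pmf (local_dist \<xi> i)))"
    using samplesD(1)[OF assms(1), of i] assms(2) unfolding indep_vars_def by auto
  then show ?thesis
    by (rule simple_function_finite_space) (use finite_set_pmf_local_dist in auto)
qed

lemma adapted_integrable:
  fixes F :: "'w \<Rightarrow> real"
  assumes "\<And>w w'. w \<in> space M \<Longrightarrow> w' \<in> space M \<Longrightarrow> state t w = state t w'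
    \<Longrightarrow> state (Suc t) w = state (Suc t) w' \<Longrightarrow> F w = F w'"
  shows "integrable M F"
proof (rule integrable_simple, rule simple_function_determined[where S = "\<lambda>(r, j, k). s r j k"])
  show "finite (minibatch_index (Suc (Suc t)))" by (rule finite_minibatch_index)
  show "simple_function M (case j of (r, i, k) \<Rightarrow> s r i k)" if "j \<in> minibatch_index (Suc (Suc t))" for j
    using that simple_function_sample by (auto simp: minibatch_index_def)
  fix w w' assume w: "w \<in> space M" "w' \<in> space M"
    and agree: "\<And>j. j \<in> minibatch_index (Suc (Suc t))
      \<Longrightarrow> (case j of (r, i, k) \<Rightarrow> s r i k) w = (case j of (r, i, k) \<Rightarrow> s r i k) w'"
  have "s r j k w = s r j k w'" if "r \<le> Suc t" "r mod q \<noteq> 0" "k < q" for r j k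
    using agree[of "(r, j, k)"] that by (simp add: minibatch_index_def)
  then show "F w = F w'"
    by (intro assms w state_determined) auto
qed

definition dp2 where "dp2 t w = (norm (JJ (X (Suc t) w) - JJ (X t w)))\<^sup>2"
definition dl2 where "dl2 t w = (norm (scaled (\<Lambda> (Suc t) w) - scaled (\<Lambda> t w)))\<^sup>2"
definition ds2 where "ds2 t w = (norm (Y (Suc t) w - Y t w))\<^sup>2"
definition cons2 where "cons2 t w = (norm (X t w - JJ (X t w)))\<^sup>2"
definition vperp2 where "vperp2 t w = (norm (V t w - JJ (V t w)))\<^sup>2"
definition err where "err t w = (\<Sum>i\<in>UNIV. (norm (d t w i - grad (f i) (z t w i)))\<^sup>2)"
definition wt where "wt = 1 + 10 * (\<eta>\<^sub>x * L) / (1 - \<rho>) ^ 3"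
definition ly where
  "ly t w = \<P> (JJ (X t w)) (scaled (\<Lambda> t w)) + GG (JJ (X t w))
    + wt * (\<P> (JJ (X t w)) (scaled (\<Lambda> t w)) - \<Phi> (JJ (X t w)) (scaled (\<Lambda> t w)) (Y t w))
    + \<rho> / (2 * \<eta>\<^sub>x) * cons2 t w + \<eta>\<^sub>x / (1 - \<rho>)\<^sup>2 * vperp2 t w"
definition Yopt where "Yopt t w = YY (JJ (X t w)) (scaled (\<Lambda> t w))"
definition dstep where "dstep t w = (norm (X (Suc t) w - X t w))\<^sup>2 + ds2 t w"

lemmas quantity_defs = dp2_def dl2_def ds2_def cons2_def vperp2_def err_def ly_def dstep_def

lemma integrable_quantities [simp]:
  "integrable M (dp2 t)" "integrable M (dl2 t)" "integrable M (ds2 t)" "integrable M (cons2 t)"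
  "integrable M (vperp2 t)" "integrable M (err t)" "integrable M (ly t)" "integrable M (dstep t)"
  by (rule adapted_integrable[where t = t]; simp add: quantity_defs state_def)+

lemma lower_bound:
  assumes "Z \<in> CC" "JJ Z = Z"
  shows "\<P> Z l + GG Z \<ge> real CARD('m) * phi_star"
proof -
  define x where "x = row_mean Z"
  have Z: "Z = all_rows x" using assms(2) by (simp add: JJ_def x_def)
  then have x: "x \<in> edom g" using assms(1) by (simp add: CC_def all_rows_def)
  have l: "sqrt (real CARD('m)) *\<^sub>R ((1 / sqrt (real CARD('m))) *\<^sub>R l) = l" by simp
  have "ereal phi_star \<le> P L W f h x ((1 / sqrt (real CARD('m))) *\<^sub>R l) + g x"
    using phi_lower[of x "(1 / sqrt (real CARD('m))) *\<^sub>R l"] by (simp add: phi_def)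
  also have "\<dots> = ereal (1 / real CARD('m) * \<P> Z l + real_of_ereal (g x))"
    unfolding P_eq l Z by (subst edom_real[OF g_convex x]) simp
  finally have "phi_star \<le> 1 / real CARD('m) * \<P> Z l + real_of_ereal (g x)" by simp
  then have "real CARD('m) * phi_star \<le> \<P> Z l + real CARD('m) * real_of_ereal (g x)"
    by (simp add: field_simps)
  then show ?thesis by (simp add: GG_def Z all_rows_def)
qed

lemma pathwise:
  assumes w: "w \<in> space M"
  shows weight: "0 < wt \<and> wt * \<eta>\<^sub>x * L \<le> 1 / 235 \<and> wt * \<eta>\<^sub>x * L \<le> 3 / 1000 * (1 - \<rho>)" (is ?weight)
    and step: "ly (Suc t) w + (1 / 3 * (dp2 t w / \<eta>\<^sub>x) + 12 / 25 * (dl2 t w / \<eta>\<^sub>\<Lambda>) + 3 / 2 * (wt * L * ds2 t w)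
        + 9 / 20 * ((1 - \<rho>) * cons2 (Suc t) w / \<eta>\<^sub>x) + \<eta>\<^sub>x * vperp2 t w / (2 * (1 - \<rho>)))
      \<le> ly t w + 51 / 1000 * ((1 - \<rho>) * cons2 t w / \<eta>\<^sub>x) + wt / L * (109 / 100 * err t w + 3 / 10 * err (Suc t) w)" (is ?step)
    and low: "real CARD('m) * phi_star \<le> ly t w" (is ?low)
    and dstep_le: "dstep t w \<le> dp2 t w + 2 * cons2 (Suc t) w + 2 * cons2 t w + ds2 t w" (is ?dstep)
    and Yopt_le: "(norm (Y t w - Yopt t w))\<^sup>2
      \<le> 45 * \<kappa>\<^sup>2 * ds2 t w + 10 * \<kappa>\<^sup>2 * (err t w / L\<^sup>2 + cons2 t w)" (is ?Yopt)
    and stat_\<Lambda>: "norm (BB (Yopt t w))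
      \<le> sqrt (dl2 t w) / \<eta>\<^sub>\<Lambda> + L * norm (Y t w - Yopt t w)" (is ?stat_L)
    and stat_x: "norm (JJ (X t w) - prox_rows (\<lambda>v. ereal \<eta>\<^sub>x * g v)
        (JJ (X t w) - \<eta>\<^sub>x *\<^sub>R JJ (FFX (JJ (X t w)) (Yopt t w))))
      \<le> sqrt (dp2 t w) + sqrt (cons2 (Suc t) w) + sqrt (cons2 t w)
        + \<eta>\<^sub>x * (sqrt (vperp2 t w) + sqrt (err t w) + L * sqrt (cons2 t w)
          + L * norm (Y t w - Yopt t w))" (is ?stat_x)
proof -
  interpret path: vrlm_path FF FFX FFY HH KK BB BB' YY L \<mu> \<kappa> JJ "\<lambda>X. W ** X" GG CC "\<lambda>t. X t w" "\<lambda>t. V t w"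
    "\<lambda>t. \<chi> i. fst (d t w i)" "\<lambda>t. Y t w" "\<lambda>t. \<chi> i. snd (d t w i)" "\<lambda>t. scaled (\<Lambda> t w)" \<rho> \<eta>\<^sub>x \<eta>\<^sub>\<Lambda>
    by (rule is_path[OF w])
  have eqs: "(path.dp t)\<^sup>2 = dp2 t w" "(path.dl t)\<^sup>2 = dl2 t w" "(path.ds t)\<^sup>2 = ds2 t w" "(path.cons t)\<^sup>2 = cons2 t w"
    "(path.vperp t)\<^sup>2 = vperp2 t w" "path.weight = wt" for t
    by (simp_all add: path.dp_def path.dl_def path.ds_def path.cons_def path.vperp_def path.weight_def
        quantity_defs wt_def)
  have er: "path.Er t = err t w" for t
    by (simp add: path.Er_def path.ex_def path.ey_def err_def FFX_def FFY_def norm_sq_rows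
        norm_sq_fst_snd[of "_ - _"] sum.distrib)
  have lyap: "path.lyap t = ly t w" for t
    unfolding path.lyap_def path.gap_def eqs ly_def ..
  have rt: "path.dp t = sqrt (dp2 t w)" "path.dl t = sqrt (dl2 t w)" "path.cons t = sqrt (cons2 t w)"
    "path.vperp t = sqrt (vperp2 t w)" for t
    by (simp_all add: eqs[symmetric] path.dp_def path.dl_def path.cons_def path.vperp_def)
  have "wt * \<eta>\<^sub>x * L * 1 \<le> wt * \<eta>\<^sub>x * L * \<kappa>\<^sup>2"
    using path.weight_pos step_sizes(1) L_pos kappa_ge_1 unfolding eqs
    by (intro mult_left_mono) (auto intro: one_le_power)
  then show ?weight
    using path.weight_pos path.weight_bounds(1,3) unfolding eqs by linarith
  show ?step
    using path.lyap_step[of t] unfolding path.progress_def lyap eqs er .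
  show ?low
    using path.lyap_lower[OF lower_bound] unfolding lyap .
  show ?dstep
    using path.X_step_sq[of t] unfolding eqs by (simp add: dstep_def)
  show ?Yopt
    using path.Yopt_dist_sq(2)[of t] unfolding eqs er path.Yopt_def Yopt_def .
  show ?stat_L
    using path.stationarity_\<Lambda>[of t] unfolding rt path.Yopt_def Yopt_def .
  have ex: "norm (path.ex t) \<le> sqrt (err t w)"
    unfolding er[symmetric] path.Er_def by (intro real_le_rsqrt) simp
  note ps = prox_rows_g[OF step_sizes(1)]
  have "\<eta>\<^sub>x * norm (path.ex t) \<le> \<eta>\<^sub>x * sqrt (err t w)" using ex step_sizes(1) by (intro mult_left_mono) auto
  then show ?stat_x
    using path.stationarity_x[OF ps(1) ps(2), of t] unfolding rt path.Yopt_def Yopt_def distrib_left by linarith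
qed

lemma wt_pos: "0 < wt" and wt_bounds: "wt * \<eta>\<^sub>x * L \<le> 1 / 235" "wt * \<eta>\<^sub>x * L \<le> 3 / 1000 * (1 - \<rho>)"
  using weight not_empty by blast+

lemma quantities_nonneg: "0 \<le> dp2 t w" "0 \<le> dl2 t w" "0 \<le> ds2 t w" "0 \<le> cons2 t w" "0 \<le> vperp2 t w" "0 \<le> err t w" "0 \<le> dstep t w"
  by (auto simp: quantity_defs intro: sum_nonneg)

lemma err_reset:
  assumes "w \<in> space M" "t mod q = 0"
  shows "err t w = 0"
proof -
  have "d t w i = grad (f i) (z t w i)" for i
    using assms d_0[OF assms(1), of i] d_Suc[OF assms(1), of _ i]
    by (cases t) (simp_all add: spider_batch_def batch_grad_full unbiased)
  then show ?thesis by (simp add: err_def)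
qed

lemma err_step:
  assumes t: "Suc t mod q \<noteq> 0"
  shows "(\<integral>w. err (Suc t) w \<partial>M) \<le> (\<integral>w. err t w \<partial>M) + L\<^sup>2 / real q * (\<integral>w. dstep t w \<partial>M)"
proof -
  define U where "U i w = d t w i - grad (f i) (z t w i)" for i w
  define a where "a i w = grad (f i) (z (Suc t) w i) - grad (f i) (z t w i)" for i w
  define D where "D i w u = G i (z (Suc t) w i) u - G i (z t w i) u" for i w u
  define v where "v i w = L\<^sup>2 * ((norm (X (Suc t) w $ i - X t w $ i))\<^sup>2 + (norm (Y (Suc t) w $ i - Y t w $ i))\<^sup>2)" for i w
  have fresh: "(\<integral>w. (norm (U i w + (1 / real q) *\<^sub>R (\<Sum>k<q. D i w (s (Suc t) i k w) - a i w)))\<^sup>2 \<partial>M)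
      \<le> (\<integral>w. (norm (U i w))\<^sup>2 + v i w / real q \<partial>M)" for i
  proof (rule fresh_minibatch_second_moment[OF finite_minibatch_index finite_set_pmf_local_dist q samplesD[OF t]])
    fix w w' assume w: "w \<in> space M" "w' \<in> space M"
      and agree: "\<And>r j k. (r, j, k) \<in> minibatch_index (Suc t) \<Longrightarrow> s r j k w = s r j k w'"
    have st: "state t w = state t w'"
      using agree by (intro state_determined[OF w]) (simp add: minibatch_index_def)
    show "U i w = U i w' \<and> (\<lambda>u. D i w u - a i w) = (\<lambda>u. D i w' u - a i w') \<and> v i w = v i w'"
      using st next_iterate_determined[OF w st] by (simp add: U_def D_def a_def v_def state_def)
  next
    fix w
    have "measure_pmf.expectation (local_dist \<xi> i) (D i w) = a i w"
      unfolding D_def a_def unbiased[symmetric]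
      by (intro Bochner_Integration.integral_diff integrable_measure_pmf_finite finite_set_pmf_local_dist)
    note c = expectation_centred_sq_le[OF finite_set_pmf_local_dist this]
    show "measure_pmf.expectation (local_dist \<xi> i) (\<lambda>u. D i w u - a i w) = 0" by (rule c(1))
    show "measure_pmf.expectation (local_dist \<xi> i) (\<lambda>u. (norm (D i w u - a i w))\<^sup>2) \<le> v i w"
      using c(2) mean_square_smooth[of i "X (Suc t) w $ i" "Y (Suc t) w $ i" "X t w $ i" "Y t w $ i"]
      unfolding D_def v_def by linarith
  qed simp
  have dec: "d (Suc t) w i - grad (f i) (z (Suc t) w i)
      = U i w + (1 / real q) *\<^sub>R (\<Sum>k<q. D i w (s (Suc t) i k w) - a i w)" if "w \<in> space M" for i w
  proof -
    have "(1 / real q) *\<^sub>R (\<Sum>k<q. a i w) = a i w"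
      using q by (simp add: sum_constant_scaleR del: sum_constant)
    then show ?thesis
      using t by (simp add: d_Suc[OF that] spider_batch_def batch_grad_indexed U_def D_def a_def
          sum_subtractf scaleR_diff_right)
  qed
  have int: "integrable M (\<lambda>w. (norm (d (Suc t) w i - grad (f i) (z (Suc t) w i)))\<^sup>2)" for i
    by (rule adapted_integrable[where t = t]) (simp add: state_def)
  have intU: "integrable M (\<lambda>w. (norm (U i w))\<^sup>2 + v i w / real q)" for i
    by (rule adapted_integrable[where t = t]) (simp add: U_def v_def state_def)
  have "(\<integral>w. err (Suc t) w \<partial>M) = (\<Sum>i\<in>UNIV. (\<integral>w. (norm (d (Suc t) w i - grad (f i) (z (Suc t) w i)))\<^sup>2 \<partial>M))"
    unfolding err_def by (rule Bochner_Integration.integral_sum) (rule int)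
  also have "\<dots> \<le> (\<Sum>i\<in>UNIV. (\<integral>w. (norm (U i w))\<^sup>2 + v i w / real q \<partial>M))"
  proof (rule sum_mono)
    fix i
    have "(\<integral>w. (norm (d (Suc t) w i - grad (f i) (z (Suc t) w i)))\<^sup>2 \<partial>M)
        = (\<integral>w. (norm (U i w + (1 / real q) *\<^sub>R (\<Sum>k<q. D i w (s (Suc t) i k w) - a i w)))\<^sup>2 \<partial>M)"
      by (rule Bochner_Integration.integral_cong) (simp_all only: dec)
    also have "\<dots> \<le> (\<integral>w. (norm (U i w))\<^sup>2 + v i w / real q \<partial>M)" by (rule fresh)
    finally show "(\<integral>w. (norm (d (Suc t) w i - grad (f i) (z (Suc t) w i)))\<^sup>2 \<partial>M) \<le> \<dots>" .
  qed
  also have "\<dots> = (\<integral>w. (\<Sum>i\<in>UNIV. (norm (U i w))\<^sup>2 + v i w / real q) \<partial>M)"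
    by (rule Bochner_Integration.integral_sum[symmetric]) (rule intU)
  also have "\<dots> = (\<integral>w. err t w + L\<^sup>2 / real q * dstep t w \<partial>M)"
    by (simp add: err_def U_def v_def dstep_def ds2_def norm_sq_rows sum.distrib sum_distrib_left
        sum_divide_distrib distrib_left add_divide_distrib)
  also have "\<dots> = (\<integral>w. err t w \<partial>M) + L\<^sup>2 / real q * (\<integral>w. dstep t w \<partial>M)"
    by simp
  finally show ?thesis .
qed

lemma quantities_vanish:
  "vanishing dp2" "vanishing dl2" "vanishing ds2" "vanishing cons2" "vanishing vperp2" "vanishing err"
proof -
  let ?E = "\<lambda>F t. \<integral>w. F t w \<partial>M"
  have nn: "0 \<le> ?E dp2 t" "0 \<le> ?E dl2 t" "0 \<le> ?E ds2 t" "0 \<le> ?E cons2 t" "0 \<le> ?E vperp2 t" "0 \<le> ?E err t"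
    "0 \<le> ?E dstep t" for t
    using quantities_nonneg by (auto intro!: Bochner_Integration.integral_nonneg)
  have c0: "?E cons2 0 = 0"
  proof -
    have "?E cons2 0 = (\<integral>w. 0 \<partial>M)"
      by (rule Bochner_Integration.integral_cong)
        (simp_all add: cons2_def init JJ_def row_mean_all_rows)
    then show ?thesis by simp
  qed
  have low': "real CARD('m) * phi_star \<le> ?E ly t" for t
    using integral_mono[of M "\<lambda>_. real CARD('m) * phi_star" "ly t"] low by (simp add: prob_space)
  have reset: "?E err t = 0" if "t mod q = 0" for t
  proof -
    have "?E err t = (\<integral>w. 0 \<partial>M)"
      by (rule Bochner_Integration.integral_cong) (simp_all add: err_reset that)
    then show ?thesis by simp
  qed
  have R: "?E dstep t \<le> ?E dp2 t + 2 * ?E cons2 (Suc t) + 2 * ?E cons2 t + ?E ds2 t" for t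
  proof -
    have "?E dstep t \<le> (\<integral>w. dp2 t w + 2 * cons2 (Suc t) w + 2 * cons2 t w + ds2 t w \<partial>M)"
      by (rule integral_mono) (simp_all add: dstep_le)
    then show ?thesis by simp
  qed
  have st: "?E ly (Suc t) + (1 / 3 * (?E dp2 t / \<eta>\<^sub>x) + 12 / 25 * (?E dl2 t / \<eta>\<^sub>\<Lambda>) + 3 / 2 * (wt * L * ?E ds2 t)
        + 9 / 20 * ((1 - \<rho>) * ?E cons2 (Suc t) / \<eta>\<^sub>x) + \<eta>\<^sub>x * ?E vperp2 t / (2 * (1 - \<rho>)))
      \<le> ?E ly t + 51 / 1000 * ((1 - \<rho>) * ?E cons2 t / \<eta>\<^sub>x) + wt / L * (109 / 100 * ?E err t + 3 / 10 * ?E err (Suc t))" for t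
  proof -
    have "(\<integral>w. ly (Suc t) w + (1 / 3 * (dp2 t w / \<eta>\<^sub>x) + 12 / 25 * (dl2 t w / \<eta>\<^sub>\<Lambda>) + 3 / 2 * (wt * L * ds2 t w)
        + 9 / 20 * ((1 - \<rho>) * cons2 (Suc t) w / \<eta>\<^sub>x) + \<eta>\<^sub>x * vperp2 t w / (2 * (1 - \<rho>))) \<partial>M)
      \<le> (\<integral>w. ly t w + 51 / 1000 * ((1 - \<rho>) * cons2 t w / \<eta>\<^sub>x)
        + wt / L * (109 / 100 * err t w + 3 / 10 * err (Suc t) w) \<partial>M)"
      by (rule integral_mono) (simp_all only: step, simp_all)
    then show ?thesis by simp
  qed
  note sums = spider_sum_le[where e = "?E err" and R = "?E dstep" and c = "L\<^sup>2", OF q reset err_step]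
  have rho1: "0 < 1 - \<rho>" using W_gap(1) by simp
  note conv = descent_summable[where p = "?E dp2" and l = "?E dl2" and s = "?E ds2" and b = "?E cons2" and v = "?E vperp2"
      and e = "?E err" and R = "?E dstep" and y = "?E ly", OF nn(1-6) c0 low' step_sizes(1,4) wt_pos L_pos rho1
      wt_bounds st R sums(1) sums(2)]
  show "vanishing dp2" "vanishing dl2" "vanishing ds2" "vanishing cons2" "vanishing vperp2" "vanishing err"
    unfolding vanishing_def using conv nn by (auto simp: mult_nonneg_nonneg)
qed

lemma vanishing_cons2_Suc: "vanishing (\<lambda>t. cons2 (Suc t))"
  using quantities_vanish(4) unfolding vanishing_def
  by (auto intro: LIMSEQ_Suc[of "\<lambda>t. \<integral>w. cons2 t w \<partial>M"])

lemma limit_x: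
  assumes "\<epsilon> > 0"
  shows "(\<lambda>t. measure M {w \<in> space M.
      (norm ((1 / \<eta>\<^sub>x) *\<^sub>R (row_mean (X t w) - prox (\<lambda>v. ereal \<eta>\<^sub>x * g v)
          (row_mean (X t w) - \<eta>\<^sub>x *\<^sub>R grad (\<lambda>x. Pval L W f h x (\<Lambda> t w)) (row_mean (X t w))))))\<^sup>2
      + L\<^sup>2 / real CARD('m) * (norm (perp (X t w)))\<^sup>2 \<ge> \<epsilon>}) \<longlonglongrightarrow> 0"
    (is "(\<lambda>t. measure M {w \<in> space M. ?S t w \<ge> \<epsilon>}) \<longlonglongrightarrow> 0")
proof (rule vanishing_prob[OF _ assms])
  define F where "F t w = 1 / (\<eta>\<^sub>x\<^sup>2 * real CARD('m)) * (6 * (dp2 t w + cons2 (Suc t) w + cons2 t w)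
      + 8 * \<eta>\<^sub>x\<^sup>2 * (vperp2 t w + err t w + L\<^sup>2 * cons2 t w
        + L\<^sup>2 * (45 * \<kappa>\<^sup>2 * ds2 t w + 10 * \<kappa>\<^sup>2 * (1 / L\<^sup>2 * err t w + cons2 t w))))
    + L\<^sup>2 / real CARD('m) * cons2 t w" for t w
  show "vanishing F"
    unfolding F_def
    by (intro vanishing_add vanishing_cmult quantities_vanish vanishing_cons2_Suc)
  fix t w assume w: "w \<in> space M"
  define x where "x = row_mean (X t w)"
  define Q where "Q = prox (\<lambda>v. ereal \<eta>\<^sub>x * g v) (x - \<eta>\<^sub>x *\<^sub>R grad (\<lambda>x. Pval L W f h x (\<Lambda> t w)) x)"
  define D where "D = norm (Y t w - Yopt t w)"
  define n where "n = norm (all_rows (x - Q) :: real^'d1^'m)"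
  have J: "JJ (X t w) = all_rows x" by (simp add: JJ_def x_def)
  have "prox_rows (\<lambda>v. ereal \<eta>\<^sub>x * g v) (JJ (X t w) - \<eta>\<^sub>x *\<^sub>R JJ (FFX (JJ (X t w))
      (Yopt t w))) = (all_rows Q :: real^'d1^'m)"
    unfolding Yopt_def J Q_def grad_Pval_x by (simp add: JJ_def prox_rows_def all_rows_def vec_eq_iff)
  then have n: "n \<le> (sqrt (dp2 t w) + sqrt (cons2 (Suc t) w) + sqrt (cons2 t w))
      + \<eta>\<^sub>x * ((sqrt (vperp2 t w) + sqrt (err t w)) + (L * sqrt (cons2 t w) + L * D))"
    using stat_x[OF w, of t] unfolding n_def D_def all_rows_diff J by (simp add: add.assoc)
  note nn = quantities_nonneg
  have "n\<^sup>2 \<le> 2 * (sqrt (dp2 t w) + sqrt (cons2 (Suc t) w) + sqrt (cons2 t w))\<^sup>2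
      + 2 * (\<eta>\<^sub>x * ((sqrt (vperp2 t w) + sqrt (err t w)) + (L * sqrt (cons2 t w) + L * D)))\<^sup>2"
    by (rule order_trans[OF power_mono[OF n] power2_sum2_le]) (simp add: n_def)
  also have "\<dots> \<le> 2 * (3 * (dp2 t w + cons2 (Suc t) w + cons2 t w))
      + 2 * (\<eta>\<^sub>x\<^sup>2 * (2 * (2 * vperp2 t w + 2 * err t w) + 2 * (2 * (L\<^sup>2 * cons2 t w) + 2 * (L\<^sup>2 * D\<^sup>2))))"
    unfolding power_mult_distrib[of \<eta>\<^sub>x]
  proof (intro add_mono mult_left_mono)
    show "(sqrt (dp2 t w) + sqrt (cons2 (Suc t) w) + sqrt (cons2 t w))\<^sup>2
        \<le> 3 * (dp2 t w + cons2 (Suc t) w + cons2 t w)"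
      using power2_sum3_le[of "sqrt (dp2 t w)" "sqrt (cons2 (Suc t) w)" "sqrt (cons2 t w)"] nn by simp
    have "(sqrt (vperp2 t w) + sqrt (err t w))\<^sup>2 \<le> 2 * vperp2 t w + 2 * err t w"
      using power2_sum2_le[of "sqrt (vperp2 t w)" "sqrt (err t w)"] nn by simp
    moreover have "(L * sqrt (cons2 t w) + L * D)\<^sup>2 \<le> 2 * (L\<^sup>2 * cons2 t w) + 2 * (L\<^sup>2 * D\<^sup>2)"
      using power2_sum2_le[of "L * sqrt (cons2 t w)" "L * D"] nn by (simp add: power_mult_distrib)
    ultimately show "((sqrt (vperp2 t w) + sqrt (err t w)) + (L * sqrt (cons2 t w) + L * D))\<^sup>2
        \<le> 2 * (2 * vperp2 t w + 2 * err t w) + 2 * (2 * (L\<^sup>2 * cons2 t w) + 2 * (L\<^sup>2 * D\<^sup>2))"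
      using power2_sum2_le[of "sqrt (vperp2 t w) + sqrt (err t w)" "L * sqrt (cons2 t w) + L * D"] by argo
  qed simp_all
  also have "\<dots> = 6 * (dp2 t w + cons2 (Suc t) w + cons2 t w)
      + 8 * \<eta>\<^sub>x\<^sup>2 * (vperp2 t w + err t w + L\<^sup>2 * cons2 t w + L\<^sup>2 * D\<^sup>2)"
    by (simp add: algebra_simps)
  also have "\<dots> \<le> 6 * (dp2 t w + cons2 (Suc t) w + cons2 t w)
      + 8 * \<eta>\<^sub>x\<^sup>2 * (vperp2 t w + err t w + L\<^sup>2 * cons2 t w
        + L\<^sup>2 * (45 * \<kappa>\<^sup>2 * ds2 t w + 10 * \<kappa>\<^sup>2 * (1 / L\<^sup>2 * err t w + cons2 t w)))"
    using Yopt_le[OF w, of t] unfolding D_def by (intro add_left_mono mult_left_mono) auto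
  finally have n2: "n\<^sup>2 \<le> \<dots>" .
  have "(norm ((1 / \<eta>\<^sub>x) *\<^sub>R (x - Q)))\<^sup>2 = 1 / (\<eta>\<^sub>x\<^sup>2 * real CARD('m)) * n\<^sup>2"
    using step_sizes(1) by (simp add: n_def norm_all_rows power_mult_distrib power_divide)
  also have "\<dots> \<le> F t w - L\<^sup>2 / real CARD('m) * cons2 t w"
    unfolding F_def using mult_left_mono[OF n2, of "1 / (\<eta>\<^sub>x\<^sup>2 * real CARD('m))"] by simp
  finally have "(norm ((1 / \<eta>\<^sub>x) *\<^sub>R (x - Q)))\<^sup>2 + L\<^sup>2 / real CARD('m) * (norm (perp (X t w)))\<^sup>2 \<le> F t w"
    by (simp add: perp_def cons2_def JJ_def)
  then show "0 \<le> ?S t w \<and> ?S t w \<le> F t w"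
    unfolding Q_def x_def by simp
qed

lemma limit_\<Lambda>:
  assumes "\<epsilon> > 0"
  shows "(\<lambda>t. measure M {w \<in> space M.
      (norm (grad (\<lambda>\<Lambda>'. Pval L W f h (row_mean (X t w)) \<Lambda>') (\<Lambda> t w)))\<^sup>2 \<ge> \<epsilon>}) \<longlonglongrightarrow> 0"
    (is "(\<lambda>t. measure M {w \<in> space M. ?S t w \<ge> \<epsilon>}) \<longlonglongrightarrow> 0")
proof (rule vanishing_prob[OF _ assms])
  define F where "F t w = 1 / real CARD('m) * (2 / \<eta>\<^sub>\<Lambda>\<^sup>2 * dl2 t w
      + 2 * L\<^sup>2 * (45 * \<kappa>\<^sup>2 * ds2 t w + 10 * \<kappa>\<^sup>2 * (1 / L\<^sup>2 * err t w + cons2 t w)))" for t w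
  show "vanishing F"
    unfolding F_def by (intro vanishing_add vanishing_cmult quantities_vanish)
  fix t w assume w: "w \<in> space M"
  define D where "D = norm (Y t w - Yopt t w)"
  define b where "b = BB (Yopt t w)"
  have "norm b \<le> sqrt (dl2 t w) / \<eta>\<^sub>\<Lambda> + L * D"
    using stat_\<Lambda>[OF w, of t] by (simp add: b_def D_def)
  then have "(norm b)\<^sup>2 \<le> (sqrt (dl2 t w) / \<eta>\<^sub>\<Lambda> + L * D)\<^sup>2" by (intro power_mono) auto
  also have "\<dots> \<le> 2 * (sqrt (dl2 t w) / \<eta>\<^sub>\<Lambda>)\<^sup>2 + 2 * (L * D)\<^sup>2" by (rule power2_sum2_le)
  also have "\<dots> = 2 / \<eta>\<^sub>\<Lambda>\<^sup>2 * dl2 t w + 2 * L\<^sup>2 * D\<^sup>2"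
    using quantities_nonneg(2) by (simp add: power_divide power_mult_distrib)
  also have "\<dots> \<le> 2 / \<eta>\<^sub>\<Lambda>\<^sup>2 * dl2 t w
      + 2 * L\<^sup>2 * (45 * \<kappa>\<^sup>2 * ds2 t w + 10 * \<kappa>\<^sup>2 * (1 / L\<^sup>2 * err t w + cons2 t w))"
    using Yopt_le[OF w, of t] unfolding D_def by (intro add_left_mono mult_left_mono) auto
  finally have "1 / real CARD('m) * (norm b)\<^sup>2 \<le> F t w"
    unfolding F_def by (intro mult_left_mono) auto
  moreover have "grad (\<lambda>\<Lambda>'. Pval L W f h (row_mean (X t w)) \<Lambda>') (\<Lambda> t w) = (1 / sqrt (real CARD('m))) *\<^sub>R b"
    unfolding grad_Pval_\<Lambda> b_def Yopt_def JJ_def ..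
  ultimately show "0 \<le> ?S t w \<and> ?S t w \<le> F t w"
    by (simp add: power_mult_distrib power_divide)
qed

end

theorem theorem3p2:
  fixes ftilde :: "'m::finite \<Rightarrow> (real^'d1) \<times> (real^'d2) \<Rightarrow> 'xi \<Rightarrow> real"
    and G :: "'m \<Rightarrow> (real^'d1) \<times> (real^'d2) \<Rightarrow> 'xi \<Rightarrow> (real^'d1) \<times> (real^'d2)"
    and \<xi> :: "'m \<Rightarrow> 'n::finite \<Rightarrow> 'xi"
    and f :: "'m \<Rightarrow> (real^'d1) \<times> (real^'d2) \<Rightarrow> real"
    and g :: "real^'d1 \<Rightarrow> ereal" and h :: "real^'d2 \<Rightarrow> ereal"
    and W :: "real^'m^'m"
    and L \<mu> \<kappa> \<rho> \<sigma> L\<^sub>P \<eta>\<^sub>x \<eta>\<^sub>y \<eta>\<^sub>\<Lambda> :: real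
    and q S2 :: nat
    and x0 :: "real^'d1" and y0 :: "real^'d2"
    and M :: "'w measure"
    and s :: "nat \<Rightarrow> 'm \<Rightarrow> nat \<Rightarrow> 'w \<Rightarrow> 'xi"
    and X :: "nat \<Rightarrow> 'w \<Rightarrow> real^'d1^'m" and \<Lambda> Y :: "nat \<Rightarrow> 'w \<Rightarrow> real^'d2^'m"
  assumes finite_sum: "\<And>i z. f i z = (1 / real CARD('n)) * (\<Sum>j\<in>UNIV. ftilde i z (\<xi> i j))"
    and g_convex: "closed_convex_fun g" and h_convex: "closed_convex_fun h"
    and A1_concave: "\<mu> > 0" "\<And>i x. strongly_concave \<mu> (\<lambda>y. f i (x, y))"
    and A1_bounded: "\<exists>phi_star::real. \<forall>x \<Lambda>'. phi L W f g h x \<Lambda>' \<ge> ereal phi_star"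
    and A1_dom: "rel_interior (edom h) \<noteq> {}"
    and A2_null: "{v. (W - mat 1) *v v = 0} = span {1}"
    and A2_stochastic: "transpose W *v 1 = 1"
    and rho_def: "\<rho> = spectral_norm (W - averaging)"
    and A2_gap: "\<rho> < 1" "spectral_norm (W - mat 1) \<le> 2"
    and A3_smooth: "\<And>i. smooth_fun L (f i)"
    and A3_unbiased: "\<And>i z. measure_pmf.expectation (local_dist \<xi> i) (G i z) = grad (f i) z"
    and A3_variance: "\<And>i z. measure_pmf.expectation (local_dist \<xi> i)
                        (\<lambda>u. (norm (G i z u - grad (f i) z))\<^sup>2) \<le> \<sigma>\<^sup>2"
    and A3_mean_square_smooth: "\<And>i x y x' y'. measure_pmf.expectation (local_dist \<xi> i)
                        (\<lambda>u. (norm (G i (x, y) u - G i (x', y') u))\<^sup>2)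
                        \<le> L\<^sup>2 * ((norm (x - x'))\<^sup>2 + (norm (y - y'))\<^sup>2)"
    and kappa_def: "\<kappa> = L / \<mu>"
    and L_P_def: "L\<^sub>P = L * sqrt (4 * \<kappa>\<^sup>2 + 1)"
    and eta_y_def: "\<eta>\<^sub>y = 1 / (4 * L)"
    and eta_x_def: "\<eta>\<^sub>x = min ((1 - \<rho>)\<^sup>2 / (180 * L\<^sub>P))
                              (1 / (20 * (L + 1) * (12 * \<kappa>\<^sup>2 + 2 * \<kappa> + 5)))"
    and eta_Lambda_def: "\<eta>\<^sub>\<Lambda> = min (5 * L\<^sub>P * (1 - \<rho>)\<^sup>2 / (24 * L\<^sup>2 * (12 * \<kappa>\<^sup>2 + \<kappa> + 1)))
                              (1 / (2 * L\<^sub>P + 128 * L * \<kappa>\<^sup>2 + (L + 1) * (20 * \<kappa>\<^sup>2 + \<kappa> + 1) / 2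
                                    + 4 * L\<^sup>2 * (12 * \<kappa>\<^sup>2 + \<kappa> + 1) / (30 * L\<^sub>P)))"
    and q_def: "q = S2" "S2 \<ge> 1"
    and prob_M: "prob_space M"
    and samples: "spider_samples M (local_dist \<xi>) q S2 s"
    and start: "x0 \<in> edom g" "y0 \<in> edom h"
    and generated: "\<And>\<omega>. \<omega> \<in> space M \<Longrightarrow>
          vrlm_spider g h W L G q \<eta>\<^sub>x \<eta>\<^sub>y \<eta>\<^sub>\<Lambda> x0 y0 (spider_batch \<xi> q S2 s \<omega>)
            (\<lambda>t. X t \<omega>) (\<lambda>t. \<Lambda> t \<omega>) (\<lambda>t. Y t \<omega>)"
  shows "\<forall>\<epsilon>>0.
      (\<lambda>t. measure M {\<omega> \<in> space M.
          (norm ((1 / \<eta>\<^sub>x) *\<^sub>R (row_mean (X t \<omega>)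
              - prox (\<lambda>v. ereal \<eta>\<^sub>x * g v)
                  (row_mean (X t \<omega>)
                   - \<eta>\<^sub>x *\<^sub>R grad (\<lambda>x. Pval L W f h x (\<Lambda> t \<omega>)) (row_mean (X t \<omega>))))))\<^sup>2
          + L\<^sup>2 / real CARD('m) * (norm (perp (X t \<omega>)))\<^sup>2 \<ge> \<epsilon>}) \<longlonglongrightarrow> 0
    \<and> (\<lambda>t. measure M {\<omega> \<in> space M.
          (norm (grad (\<lambda>\<Lambda>'. Pval L W f h (row_mean (X t \<omega>)) \<Lambda>') (\<Lambda> t \<omega>)))\<^sup>2 \<ge> \<epsilon>}) \<longlonglongrightarrow> 0"
proof -
  obtain phi_star where phi_star: "\<forall>x \<Lambda>'. phi L W f g h x \<Lambda>' \<ge> ereal phi_star"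
    using A1_bounded by blast
  define Q where "Q \<omega> d V \<longleftrightarrow>
      (\<forall>i. d 0 i = batch_grad (G i) (spider_batch \<xi> q S2 s \<omega> 0 i) (X 0 \<omega> $ i, Y 0 \<omega> $ i))
    \<and> (\<forall>t i. d (Suc t) i = (if Suc t mod q = 0
        then batch_grad (G i) (spider_batch \<xi> q S2 s \<omega> (Suc t) i) (X (Suc t) \<omega> $ i, Y (Suc t) \<omega> $ i)
        else batch_grad (G i) (spider_batch \<xi> q S2 s \<omega> (Suc t) i) (X (Suc t) \<omega> $ i, Y (Suc t) \<omega> $ i)
          - batch_grad (G i) (spider_batch \<xi> q S2 s \<omega> (Suc t) i) (X t \<omega> $ i, Y t \<omega> $ i) + d t i))
    \<and> (\<forall>t. X (Suc t) \<omega> = prox_rows (\<lambda>v. ereal \<eta>\<^sub>x * g v) (W ** X t \<omega> - \<eta>\<^sub>x *\<^sub>R V t))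
    \<and> V 0 = (\<chi> i. fst (d 0 i))
    \<and> (\<forall>t. V (Suc t) = W ** (V t + (\<chi> i. fst (d (Suc t) i)) - (\<chi> i. fst (d t i))))
    \<and> (\<forall>t. Y (Suc t) \<omega> = prox_rows (\<lambda>v. ereal \<eta>\<^sub>y * h v) (Y t \<omega> + \<eta>\<^sub>y *\<^sub>R ((\<chi> i. snd (d t i))
          - (L * sqrt (real CARD('m)) / 2) *\<^sub>R (transpose (W - mat 1) ** \<Lambda> t \<omega>))))"
    for \<omega> and d :: "nat \<Rightarrow> 'm \<Rightarrow> (real^'d1) \<times> (real^'d2)" and V :: "nat \<Rightarrow> real^'d1^'m"
  have "\<exists>d V. Q \<omega> d V" if "\<omega> \<in> space M" for \<omega>
    using generated[OF that] unfolding vrlm_spider_def Q_def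
    by (elim exE conjE) (intro exI conjI, assumption, assumption, assumption, simp_all)
  then obtain d V where Q: "\<And>\<omega>. \<omega> \<in> space M \<Longrightarrow> Q \<omega> (d \<omega>) (V \<omega>)" by metis
  have init: "X 0 \<omega> = all_rows x0 \<and> Y 0 \<omega> = all_rows y0 \<and> \<Lambda> 0 \<omega> = 0"
    and \<Lambda>_step: "\<Lambda> (Suc t) \<omega> = \<Lambda> t \<omega> + (L * \<eta>\<^sub>\<Lambda> / (2 * sqrt (real CARD('m)))) *\<^sub>R ((W - mat 1) ** Y t \<omega>)"
    if "\<omega> \<in> space M" for \<omega> t
    using generated[OF that] unfolding vrlm_spider_def by blast+
  have S2: "S2 = q" using q_def by simp
  note Q' = Q[unfolded Q_def S2 eta_y_def]
  have "vrlm_problem f g h W L \<mu> \<kappa> \<rho> L\<^sub>P \<eta>\<^sub>x \<eta>\<^sub>\<Lambda> x0 y0"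
    by (rule vrlm_problem.intro) (fact assms)+
  then interpret vrlm_run f g h W L \<mu> \<kappa> \<rho> L\<^sub>P \<eta>\<^sub>x \<eta>\<^sub>\<Lambda> x0 y0 M G \<xi> s q X "\<lambda>t \<omega>. V \<omega> t" \<Lambda> Y "\<lambda>t \<omega>. d \<omega> t" phi_star
  proof (rule vrlm_run.intro[OF _ prob_M vrlm_run_axioms.intro])
  qed (use phi_star A3_unbiased A3_mean_square_smooth q_def samples init \<Lambda>_step Q' in \<open>auto simp only: S2 simp_thms\<close>)
  show ?thesis using limit_x limit_\<Lambda> by blast
qed

end
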